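(* Let $d\ge 2$, $\alpha\in(0,2)$, and let $\mu$ be an $\alpha$-stable distribution on $\mathbb{R}^d$ with no shift whose spectral spherical measure is $\lambda(dv)=P(v)\,\omega(dv)$ with $P\in L^2(\mathbb{S}^{d-1})$. Let $P_j=\pi_j P$, $j\in\mathbb{Z}_+$. Then, for $z\ne 0$, $$\Phi_\mu(z)=|z|^\alpha\Big[\sum_{j\ \mathrm{even}} w_j(\alpha)P_j(u_z)-i\tan\frac{\pi\alpha}{2}\sum_{j\ \mathrm{odd}} w_j(\alpha)P_j(u_z)\Big]\quad\text{if }\alpha\ne1,$$ $$\Phi_\mu(z)=|z|\Big[\sum_{j\ \mathrm{even}} w_j(1)P_j(u_z)+i\frac{2}{\pi}\sum_{j\ \mathrm{odd}} w^*_jP_j(u_z)\Big]+i|z|\ln|z|\,\frac{2\pi^{d/2-1}}{\Gamma(d/2+1)}P_1(u_z)\quad\text{if }\alpha=1,$$ where $$w_j(\alpha)=\frac{\pi^{d/2}\Gamma(\alpha+1)}{2^{\alpha-1}\Gamma((j+\alpha+d)/2)\,\Gamma((\alpha-j)/2+1)}=\frac{\pi^{d/2-1}\sin((j-\alpha)\pi/2)\Gamma(\alpha+1)\Gamma((j-\alpha)/2)}{2^{\alpha-1}\Gamma((j+\alpha+d)/2)},$$ $$w_1^*=\frac{\pi^{d/2}}{\Gamma(d/2+1)}\beta_d,\qquad w^*_j=\frac{(-1)^{(j-3)/2}\pi^{d/2}\Gamma((j-1)/2)}{2\Gamma((d+1+j)/2)}\ \ (j>1\text{ odd}),$$ with $s_0=0$,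 $s_n=s_{n-1}+1/n$ ($n\ge1$), and $\beta_d=1-\ln 2-s_{d/2}/2$ if $d$ is even, $\beta_d=1-s_{d+1}+s_{(d+1)/2}/2$ if $d$ is odd. All the series above converge absolutely.
   Context: Let $d\ge 2$, $\mathbb{S}^{d-1}=\{x\in\mathbb{R}^d:|x|=1\}$, and $\omega$ the surface measure on $\mathbb{S}^{d-1}$, normalized so that $\int_{\mathbb{R}^d}f(x)\,dx=\int_{\mathbb{S}^{d-1}}\int_0^\infty f(sv)s^{d-1}\,ds\,\omega(dv)$. For $x\ne0$, $u_x=x/|x|$. $L^2(\mathbb{S}^{d-1})$ is taken w.r.t. $\omega$. $\mathcal{H}_{j,d}$ denotes the space of spherical harmonics of degree $j$ (restrictions to $\mathbb{S}^{d-1}$ of homogeneous harmonic polynomials of degree $j$ with complex coefficients); $L^2(\mathbb{S}^{d-1})=\bigoplus_{j\ge0}\mathcal{H}_{j,d}$ orthogonally, and $\pi_j$ denotes the orthogonal projection of $L^2(\mathbb{S}^{d-1})$ onto $\mathcal{H}_{j,d}$. An $\alpha$-stable distribution $\mu$ on $\mathbb{R}^d$ ($\alpha\in(0,2)$) with no shift has $\int e^{i\langle x,z\rangle}\mu(dx)=\exp\{-\Phi_\mu(z)\}$ with characteristic exponent $\Phi_\mu(z)=\int_{\mathbb{S}^{d-1}}|\langle z,v\rangle|^\alpha[1-i\tan(\pi\alpha/2)\,\mathrm{sgn}\langle z,v\rangle]\lambda(dv)$ if $\alpha\ne1$, and $\Phi_\mu(z)=\int_{\mathbb{S}^{d-1}}[|\langle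 z,v\rangle|+i\frac{2}{\pi}\langle z,v\rangle\ln|\langle z,v\rangle|]\lambda(dv)$ if $\alpha=1$, where $\lambda$ is a finite nonzero Borel measure on $\mathbb{S}^{d-1}$ called the spectral spherical measure; if $\lambda=P\omega$, $P$ is the spectral spherical density. The reciprocal $1/\Gamma$ is understood as the entire function vanishing at nonpositive integers. *)

theory Defs
  imports "HOL-Analysis.Analysis" "HOL-Probability.Probability"
begin

text \<open>Surface measure on the unit sphere: omega(A) = d * Leb{ x : 0 < |x| <= 1, x/|x| in A }.
  This is the (unique) measure satisfying the polar-coordinates normalisation of the paper.\<close>
definition sphere_measure :: "(real^'n) measure" where
  "sphere_measure = measure_of (sphere 0 1) (sets (restrict_space borel (sphere 0 1)))
     (\<lambda>A. of_nat CARD('n) * emeasure lborel {x. x \<noteq> 0 \<and> norm x \<le> 1 \<and> sgn x \<in> A})"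

definition hom_poly :: "nat \<Rightarrow> (real^'n \<Rightarrow> complex) \<Rightarrow> bool" where
  "hom_poly j f \<longleftrightarrow> (\<exists>c :: ('n \<Rightarrow> nat) \<Rightarrow> complex.
      f = (\<lambda>x. \<Sum>k\<in>{k :: 'n \<Rightarrow> nat. sum k UNIV = j}. c k * of_real (\<Prod>i\<in>UNIV. (x $ i) ^ k i)))"

definition partial_deriv :: "'n \<Rightarrow> (real^'n \<Rightarrow> complex) \<Rightarrow> real^'n \<Rightarrow> complex" where
  "partial_deriv i f x = vector_derivative (\<lambda>t. f (x + t *\<^sub>R axis i 1)) (at 0)"

definition laplacian :: "(real^'n \<Rightarrow> complex) \<Rightarrow> real^'n \<Rightarrow> complex" where
  "laplacian f x = (\<Sum>i\<in>UNIV. partial_deriv i (partial_deriv i f) x)"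

definition harmonic :: "(real^'n \<Rightarrow> complex) \<Rightarrow> bool" where
  "harmonic f \<longleftrightarrow> (\<forall>x. laplacian f x = 0)"

text \<open>H_{j,d}: homogeneous harmonic polynomials of degree j (to be restricted to the sphere).\<close>
definition sph_harm :: "nat \<Rightarrow> (real^'n \<Rightarrow> complex) set" where
  "sph_harm j = {f. hom_poly j f \<and> harmonic f}"

text \<open>Orthogonal projection pi_j of L^2(S^{d-1}, omega) onto H_{j,d}: the unique element h of
  H_{j,d} with P - h orthogonal to H_{j,d}.  (A homogeneous polynomial is determined by its
  restriction to the sphere, so h is unique.)\<close>
definition sph_proj :: "nat \<Rightarrow> (real^'n \<Rightarrow> complex) \<Rightarrow> (real^'n \<Rightarrow> complex)" where
  "sph_proj j P = (THE h. h \<in> sph_harm j \<and>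
      (\<forall>g \<in> sph_harm j. integral\<^sup>L sphere_measure (\<lambda>v. (P v - h v) * cnj (g v)) = 0))"

definition stable_exponent :: "real \<Rightarrow> (real^'n) measure \<Rightarrow> real^'n \<Rightarrow> complex" where
  "stable_exponent \<alpha> Lam z =
    (if \<alpha> \<noteq> 1 then
       integral\<^sup>L Lam (\<lambda>v. of_real (\<bar>z \<bullet> v\<bar> powr \<alpha>) *
                         (1 - \<i> * of_real (tan (pi * \<alpha> / 2) * sgn (z \<bullet> v))))
     else
       integral\<^sup>L Lam (\<lambda>v. of_real \<bar>z \<bullet> v\<bar> + \<i> * of_real (2 / pi * (z \<bullet> v) * ln \<bar>z \<bullet> v\<bar>)))"

text \<open>w_j(alpha), using the reciprocal Gamma function rGamma (entire, zero at nonpositive integers).\<close>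
definition w_coef :: "nat \<Rightarrow> nat \<Rightarrow> real \<Rightarrow> real" where
  "w_coef d j \<alpha> = pi powr (real d / 2) * Gamma (\<alpha> + 1)
      * rGamma ((real j + \<alpha> + real d) / 2) * rGamma ((\<alpha> - real j) / 2 + 1) / 2 powr (\<alpha> - 1)"

definition beta_d :: "nat \<Rightarrow> real" where
  "beta_d d = (if even d then 1 - ln 2 - harm (d div 2) / 2
               else 1 - harm (d + 1) + harm ((d + 1) div 2) / 2)"

definition w_star :: "nat \<Rightarrow> nat \<Rightarrow> real" where
  "w_star d j = (if j = 1 then pi powr (real d / 2) / Gamma (real d / 2 + 1) * beta_d d
     else (-1) ^ ((j - 3) div 2) * pi powr (real d / 2) * Gamma ((real j - 1) / 2)
          / (2 * Gamma ((real d + 1 + real j) / 2)))"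

end

theory Submission
  imports Defs
begin

text \<open>
  For a standard Gaussian vector \<open>X\<close>, integration by parts and Euler's identity give, for a harmonic
  homogeneous polynomial \<open>h\<close> of degree \<open>j\<close>, the moments \<open>E[h(X) \<langle>X, y\<rangle>^m]\<close> as explicit multiples of
  \<open>\<bar>y\<bar>^(m - j) h(y)\<close>. In polar coordinates this is the Funk-Hecke formula for monomials on the sphere, with
  coefficient \<open>w\<^sub>j(m)\<close> if \<open>m - j\<close> is even and \<open>0\<close> otherwise. It shows that the explicit zonal harmonic
  \<open>Z\<^sub>j(\<langle>u, v\<rangle>)\<close> is the reproducing kernel of the spherical harmonics of degree \<open>j\<close>, so that
  \<open>P\<^sub>j(u) = \<integral> Z\<^sub>j(\<langle>u, v\<rangle>) P(v) \<omega>(dv)\<close>, and that the \<open>Z\<^sub>j(\<langle>u, \<cdot>\<rangle>)\<close> are orthogonal.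

  For \<open>\<bar>t\<bar>^\<alpha>\<close> and \<open>\<bar>t\<bar>^\<alpha> sgn t\<close> the integral against \<open>Z\<^sub>j\<close> is, up to common Gamma factors, a polynomial in
  \<open>\<alpha>\<close>; since it equals \<open>w\<^sub>j(\<alpha>) Z\<^sub>j(1)\<close> for infinitely many integers \<open>\<alpha>\<close>, it does so for all \<open>\<alpha> > 0\<close>.
  Differentiating at \<open>\<alpha> = 1\<close> yields the coefficients of \<open>t ln \<bar>t\<bar>\<close>. By Weierstrass approximation the
  kernels expand in \<open>L\<^sup>2\<close> along the \<open>Z\<^sub>j\<close>, and pairing with \<open>P\<close> gives the series; they converge absolutely
  by Bessel's inequality, because the signs of the coefficients may be changed freely.
\<close>

section \<open>Polar coordinates\<close>

text \<open>The Gaussian serves because its coordinates are independent: integration by parts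
  becomes a recursion for one-dimensional moments, so neither calculus on the sphere nor boundary
  terms occur. The price is a radial factor, which is removed by comparison with the moments of
  \<open>x \<bullet> x\<close>, a function constant on the sphere. The series are claimed at a
  single direction \<open>u\<close>, whereas the projections of \<open>P\<close> sum to
  \<open>P\<close> only in mean square. Hence \<open>P\<close> itself is never expanded. The kernel
  \<open>q (u \<bullet> v)\<close>, a continuous function of one real variable, is expanded instead
  and then paired with \<open>P\<close>. This also avoids bases and dimensions of the spaces of
  harmonics: only the zonal polynomials in direction \<open>u\<close> occur. For general \<alpha>
  the moments of the kernel are quotients of Gamma values. All powers in \<open>zpoly\<close> have
  the parity of \<open>j\<close>, so the Gamma arguments differ by integers and Pochhammer symbols
  clear them; what remains is polynomial in \<alpha>.\<close>

lemmas LINT_cong = Bochner_Integration.integral_cong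
lemmas LINT_add = Bochner_Integration.integral_add
lemmas LINT_diff = Bochner_Integration.integral_diff
lemmas LINT_sum = Bochner_Integration.integral_sum
lemmas LINT_integrable_add = Bochner_Integration.integrable_add
lemmas LINT_integrable_diff = Bochner_Integration.integrable_diff
lemmas LINT_integrable_bound = Bochner_Integration.integrable_bound

abbreviation sphere_omega :: "(real^'n) measure" ("\<omega>") where
  "\<omega> \<equiv> sphere_measure"

abbreviation sphere_integral :: "(real^'n \<Rightarrow> 'b::{banach, second_countable_topology}) \<Rightarrow> 'b" (binder "SI " 10) where
  "sphere_integral F \<equiv> LINT v|\<omega>. F v"

text \<open>Unlike \<open>sgn\<close>, this maps every vector, including \<open>0\<close>, into the sphere.\<close>

definition dir :: "real^'n \<Rightarrow> real^'n" where
  "dir x = (if x = 0 then axis undefined 1 else sgn x)"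

lemma norm_dir [simp]: "norm (dir x) = 1"
  by (simp add: dir_def norm_sgn)

lemma norm_scaleR_dir: "norm x *\<^sub>R dir x = x"
  by (simp add: dir_def sgn_div_norm)

lemma dir_scaleR: "c > 0 \<Longrightarrow> dir (c *\<^sub>R x) = dir x"
  by (simp add: dir_def sgn_scaleR)

lemma dir_measurable [measurable]: "dir \<in> borel \<rightarrow>\<^sub>M restrict_space borel (sphere 0 1)"
proof (rule measurable_restrict_space2)
  have "(sgn :: real^'n \<Rightarrow> _) = (\<lambda>x. x /\<^sub>R norm x)"
    by (auto simp: sgn_div_norm fun_eq_iff)
  then have [measurable]: "(sgn :: real^'n \<Rightarrow> _) \<in> borel_measurable borel" by simp
  show "(dir :: real^'n \<Rightarrow> _) \<in> borel_measurable borel" unfolding dir_def by measurable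
qed simp

lemma dir_measurable_lborel [measurable]: "dir \<in> lborel \<rightarrow>\<^sub>M restrict_space borel (sphere 0 1)"
  using dir_measurable by (simp cong: measurable_cong_sets)

text \<open>\<open>measure_of\<close> is informative only for a countably additive set function.
  Since \<open>distr\<close> is itself built by \<open>measure_of\<close>, agreement on measurable
  sets suffices and additivity is inherited. The cone over \<open>A\<close> and the
  \<open>dir\<close> preimage of \<open>A\<close> in the ball differ at most at the origin, a null
  set.\<close>

lemma sphere_measure_eq_distr:
  "(\<omega> :: (real^'n) measure) =
     distr (density lborel (\<lambda>x. of_nat CARD('n) * indicator (cball 0 1) x))
       (restrict_space borel (sphere 0 1)) dir"
proof -
  let ?S = "restrict_space borel (sphere 0 1) :: (real^'n) measure"
  let ?M = "density lborel (\<lambda>x::real^'n. of_nat CARD('n) * indicator (cball 0 1) x)"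
  have eq: "of_nat CARD('n) * emeasure lborel {x. x \<noteq> 0 \<and> norm x \<le> 1 \<and> sgn x \<in> A} =
      emeasure ?M (dir -` A \<inter> space ?M)" if A: "A \<in> sets ?S" for A
  proof -
    have m: "dir -` A \<in> sets lborel"
      using measurable_sets[OF dir_measurable A] by simp
    have "emeasure ?M (dir -` A \<inter> space ?M) = 
        (\<integral>\<^sup>+x. of_nat CARD('n) * indicator (dir -` A \<inter> cball 0 1) x \<partial>lborel)"
      using m by (subst emeasure_density)
        (auto intro!: nn_integral_cong simp: indicator_def)
    also have "\<dots> = of_nat CARD('n) * emeasure lborel (dir -` A \<inter> cball 0 1)"
      using m by (subst nn_integral_cmult_indicator) auto
    also have "emeasure lborel (dir -` A \<inter> cball 0 1) =
        emeasure lborel {x. x \<noteq> 0 \<and> norm x \<le> 1 \<and> sgn x \<in> A}"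
    proof (rule emeasure_eq_AE)
      show "AE x in lborel. (x \<in> dir -` A \<inter> cball 0 1) =
         (x \<in> {x. x \<noteq> 0 \<and> norm x \<le> 1 \<and> sgn x \<in> A})"
        using AE_lborel_singleton[of 0] by eventually_elim (auto simp: dir_def)
      show "dir -` A \<inter> cball 0 1 \<in> sets lborel" using m by auto
      have "{x. x \<noteq> 0 \<and> norm x \<le> 1 \<and> sgn x \<in> A} = dir -` A \<inter> cball 0 1 - {0}"
        by (auto simp: dir_def)
      then show "{x. x \<noteq> 0 \<and> norm x \<le> 1 \<and> sgn x \<in> A} \<in> sets lborel" using m by auto
    qed
    finally show ?thesis by simp
  qed
  have sp: "space ?S = sphere 0 1" by (simp add: space_restrict_space)
  show ?thesis
    unfolding sphere_measure_def distr_def sp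
  proof (rule measure_of_eq)
    show "sets ?S \<subseteq> Pow (sphere 0 1)" using sets.sets_into_space[of _ ?S] sp by auto
    show "of_nat CARD('n) * emeasure lborel {x. x \<noteq> 0 \<and> norm x \<le> 1 \<and> sgn x \<in> A} =
      emeasure ?M (dir -` A \<inter> space ?M)" if "A \<in> sigma_sets (sphere 0 1) (sets ?S)" for A
      using eq[of A] that sets.sigma_sets_eq[of ?S] sp by simp
  qed
qed

lemma space_sphere_measure [simp]: "space \<omega> = sphere 0 1"
  by (simp add: sphere_measure_eq_distr space_restrict_space)

lemma sets_sphere_measure [measurable_cong]:
  "sets \<omega> = sets (restrict_space borel (sphere 0 1))"
  by (simp add: sphere_measure_eq_distr)

lemma emeasure_sphere_measure:
  assumes "B \<in> sets (\<omega> :: (real^'n) measure)"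
  shows "emeasure \<omega> B =
    of_nat CARD('n) * emeasure lborel {x. norm x \<le> 1 \<and> dir x \<in> B}"
proof -
  have m: "dir -` B \<in> sets lborel"
    using measurable_sets[OF dir_measurable] assms by (simp add: sets_sphere_measure)
  have [simp]: "{x. norm x \<le> 1 \<and> dir x \<in> B} = dir -` B \<inter> cball 0 1" by auto
  have "emeasure \<omega> B =
      (\<integral>\<^sup>+x. of_nat CARD('n) * indicator (dir -` B \<inter> cball 0 1) x \<partial>lborel)"
    using m assms unfolding sphere_measure_eq_distr
    by (subst emeasure_distr)
      (auto simp: emeasure_density intro!: nn_integral_cong simp: indicator_def)
  also have "\<dots> = of_nat CARD('n) * emeasure lborel (dir -` B \<inter> cball 0 1)"
    using m by (subst nn_integral_cmult_indicator) auto
  finally show ?thesis by simp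
qed

lemma finite_sphere_measure: "finite_measure (\<omega> :: (real^'n) measure)"
proof
  have "emeasure (\<omega> :: (real^'n) measure) (sphere 0 1) \<noteq> \<infinity>"
    using emeasure_lborel_cball_finite[of "0::real^'n" 1]
    by (subst emeasure_sphere_measure)
      (auto simp: sets_sphere_measure sets_restrict_space cball_def ennreal_mult_eq_top_iff)
  then show "emeasure (\<omega> :: (real^'n) measure) (space \<omega>) \<noteq> \<infinity>" by simp
qed

text \<open>Dilation by \<open>R\<close> leaves \<open>dir\<close> unchanged and scales Lebesgue
  measure by the power of \<open>R\<close> given by the dimension.\<close>

lemma emeasure_lborel_cone:
  assumes B: "B \<in> sets (\<omega> :: (real^'n) measure)" and R: "R > 0"
  shows "emeasure lborel {x. norm x \<le> R \<and> dir x \<in> B} =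
    ennreal (R ^ CARD('n)) * emeasure lborel {x. norm x \<le> 1 \<and> dir x \<in> B}"
proof -
  have m: "dir -` B \<in> sets borel"
    using measurable_sets[OF dir_measurable] assms by (simp add: sets_sphere_measure)
  let ?S = "{x. norm x \<le> R \<and> dir x \<in> B}"
  have S: "?S = dir -` B \<inter> cball 0 R" by auto
  have "emeasure lborel ?S = emeasure
     (density (distr lborel borel (\<lambda>x::real^'n. 0 + R *\<^sub>R x)) (\<lambda>_. \<bar>R\<bar>^DIM(real^'n))) ?S"
    using R by (subst lborel_affine[of R "0::real^'n"]) auto
  also have "\<dots> = ennreal (R ^ CARD('n)) * emeasure (distr lborel borel (\<lambda>x::real^'n. 0 + R *\<^sub>R x)) ?S"
    using R m unfolding S by (subst emeasure_density_const) auto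
  also have "emeasure (distr lborel borel (\<lambda>x::real^'n. 0 + R *\<^sub>R x)) ?S =
      emeasure lborel {x. norm x \<le> 1 \<and> dir x \<in> B}"
  proof -
    have "(\<lambda>x::real^'n. 0 + R *\<^sub>R x) -` ?S = {x. norm x \<le> 1 \<and> dir x \<in> B}"
      using R by (auto simp: dir_scaleR)
    then show ?thesis using m unfolding S by (subst emeasure_distr) auto
  qed
  finally show ?thesis .
qed

definition radial_measure :: "nat \<Rightarrow> real measure" where
  "radial_measure d = density lborel (\<lambda>r. ennreal (indicator {0<..} r * r ^ (d - 1)))"

lemma sets_radial_measure [simp, measurable_cong]: "sets (radial_measure d) = sets borel"
  by (simp add: radial_measure_def)

lemma space_radial_measure [simp]: "space (radial_measure d) = UNIV"
  by (simp add: radial_measure_def)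

lemma emeasure_radial_atMost:
  assumes "d > 0"
  shows "emeasure (radial_measure d) {..R} = (if R > 0 then ennreal (R ^ d / d) else 0)"
proof -
  have "emeasure (radial_measure d) {..R} =
      (\<integral>\<^sup>+r. ennreal (r ^ (d - 1)) * indicator {0..R} r \<partial>lborel)"
    unfolding radial_measure_def using AE_lborel_singleton[of 0]
    by (subst emeasure_density)
      (auto intro!: nn_integral_cong_AE elim!: eventually_mono simp: indicator_def)
  also have "\<dots> = (if R > 0 then ennreal (R ^ d / d) else 0)"
  proof (cases "R > 0")
    case True
    have "(\<integral>\<^sup>+r. ennreal (r ^ (d - 1)) * indicator {0..R} r \<partial>lborel) =
        ennreal (R ^ d / d - 0 ^ d / d)"
      using assms True
      by (intro nn_integral_FTC_Icc) (auto intro!: derivative_eq_intros)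
    then show ?thesis using True assms by (simp add: zero_power)
  next
    case False
    then have "(\<integral>\<^sup>+r. ennreal (r ^ (d - 1)) * indicator {0..R} r \<partial>lborel) = (\<integral>\<^sup>+r. 0 \<partial>(lborel :: real measure))"
      using AE_lborel_singleton[of 0]
      by (intro nn_integral_cong_AE) (auto elim!: eventually_mono simp: indicator_def)
    then show ?thesis using False by simp
  qed
  finally show ?thesis .
qed

lemma sigma_finite_radial: "sigma_finite_measure (radial_measure d)"
  unfolding radial_measure_def
  by (subst sigma_finite_measure.sigma_finite_iff_density_finite[OF sigma_finite_lborel]) auto

text \<open>Formulated with image measures so that integrability is transported along with
  integrals. For a rectangle \<open>A \<times> B\<close> with \<open>B\<close> fixed, both sides are
  measures in \<open>A\<close>; they need only be compared on half-lines, where the scaling law for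
  cones applies.\<close>

lemma polar_coordinates:
  "radial_measure CARD('n) \<Otimes>\<^sub>M (\<omega> :: (real^'n) measure) =
     distr lborel (borel \<Otimes>\<^sub>M \<omega>) (\<lambda>x. (norm x, dir x))"
proof (rule pair_measure_eqI)
  let ?w = "\<omega> :: (real^'n) measure" and ?r = "radial_measure CARD('n)"
  let ?M = "distr lborel (borel \<Otimes>\<^sub>M ?w) (\<lambda>x. (norm x, dir x))"
  interpret finite_measure ?w by (rule finite_sphere_measure)
  show "sigma_finite_measure ?r" by (rule sigma_finite_radial)
  show "sigma_finite_measure ?w" ..
  show "sets (?r \<Otimes>\<^sub>M ?w) = sets ?M"
    by (simp cong: sets_pair_measure_cong)
  have [measurable]: "dir \<in> lborel \<rightarrow>\<^sub>M ?w"
    using dir_measurable_lborel by (simp cong: measurable_cong_sets add: sets_sphere_measure)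
  fix A B assume "A \<in> sets ?r" and B [measurable]: "B \<in> sets ?w"
  then have A [measurable]: "A \<in> sets borel" by simp
  have m [measurable]: "dir -` B \<in> sets lborel"
    using measurable_sets[OF dir_measurable] B by (simp add: sets_sphere_measure)
  define mu where "mu = distr (density lborel (indicator (dir -` B :: (real^'n) set))) borel norm"
  define nu where "nu = density ?r (\<lambda>_. emeasure ?w B)"
  have mu: "emeasure mu C = emeasure lborel {x. norm x \<in> C \<and> dir x \<in> B}" if C[measurable]: "C \<in> sets borel" for C
  proof -
    have "emeasure mu C = emeasure lborel (norm -` C \<inter> dir -` B :: (real^'n) set)"
    proof -
      have nC: "(norm -` C :: (real^'n) set) \<in> sets borel"
        using measurable_sets[of norm "borel :: (real^'n) measure" borel C] by simp
      have "emeasure mu C = emeasure (density lborel (indicator (dir -` B :: (real^'n) set))) (norm -` C)"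
        unfolding mu_def by (subst emeasure_distr) auto
      also have "\<dots> = (\<integral>\<^sup>+x. indicator (norm -` C \<inter> dir -` B :: (real^'n) set) x \<partial>lborel)"
        using nC by (subst emeasure_density) (auto intro!: nn_integral_cong simp: indicator_inter_arith ac_simps simp del: nn_integral_indicator)
      also have "\<dots> = emeasure lborel (norm -` C \<inter> dir -` B :: (real^'n) set)"
        using nC by (intro nn_integral_indicator) auto
      finally show ?thesis .
    qed
    also have "norm -` C \<inter> dir -` B = {x. norm x \<in> C \<and> dir x \<in> B}" by auto
    finally show ?thesis .
  qed
  have bs: "sets (borel :: real measure) = sigma_sets UNIV (range (\<lambda>a. {..a}))"
    by (subst borel_eq_atMost) (rule sets_measure_of, simp)
  have "mu = nu"
  proof (rule measure_eqI_generator_eq[where E="range (\<lambda>a. {..a})" and \<Omega>=UNIV and A="\<lambda>n. {..real n}"])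
    show "Int_stable (range (\<lambda>a::real. {..a}))"
      unfolding Int_stable_def by (simp add: Int_atMost)
    show "sets mu = sigma_sets UNIV (range (\<lambda>a. {..a}))" "sets nu = sigma_sets UNIV (range (\<lambda>a. {..a}))"
      using bs by (simp_all add: mu_def nu_def)
    show eq: "emeasure mu X = emeasure nu X" if "X \<in> range (\<lambda>a::real. {..a})" for X
    proof -
      from that obtain R where X: "X = {..R}" by auto
      have nu: "emeasure nu X = emeasure ?w B * emeasure ?r {..R}"
        unfolding nu_def X by (subst emeasure_density_const) auto
      show ?thesis
      proof (cases "R > 0")
        case True
        have "emeasure mu X = ennreal (R ^ CARD('n)) * emeasure lborel {x. norm x \<le> 1 \<and> dir x \<in> B}"
          using emeasure_lborel_cone[OF B True] by (simp add: mu X)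
        also have "\<dots> = emeasure nu X"
        proof -
          have "ennreal (real CARD('n)) * ennreal (R ^ CARD('n) / CARD('n)) = ennreal (R ^ CARD('n))"
            using True by (simp flip: ennreal_mult')
          then have "ennreal (R ^ CARD('n)) * c = of_nat CARD('n) * c * ennreal (R ^ CARD('n) / CARD('n))" for c
            unfolding ennreal_of_nat_eq_real_of_nat by (metis mult.commute mult.assoc)
          then show ?thesis
            unfolding nu emeasure_radial_atMost[OF zero_less_card_finite] emeasure_sphere_measure[OF B]
            using True by simp
        qed
        finally show ?thesis .
      next
        \<comment> \<open>For \<open>R \<le> 0\<close> the cone contains at most the origin, so both
          measures vanish.\<close>
        case False
        have "emeasure mu X = emeasure lborel {x. norm x \<le> R \<and> dir x \<in> B}" by (simp add: mu X)
        also have "\<dots> \<le> emeasure lborel {0::real^'n}"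
        proof (rule emeasure_mono)
          show "{x. norm x \<le> R \<and> dir x \<in> B} \<subseteq> {0}"
            using False by (auto simp: not_less) (metis norm_le_zero_iff order_trans)
        qed simp
        finally show ?thesis unfolding nu using False by (simp add: emeasure_radial_atMost)
      qed
    qed
    show "emeasure mu {..real i} \<noteq> \<infinity>" for i
    proof -
      have "emeasure mu {..real i} = emeasure nu {..real i}" by (rule eq) auto
      also have "\<dots> = emeasure ?w B * emeasure ?r {..real i}"
        unfolding nu_def by (subst emeasure_density_const) auto
      finally show ?thesis
        using emeasure_finite[of B] by (simp add: emeasure_radial_atMost ennreal_mult_eq_top_iff)
    qed
    show "(\<Union>i. {..real i}) = UNIV"
      by (simp add: set_eq_iff real_arch_simple)
  qed auto
  have "emeasure ?r A * emeasure ?w B = emeasure nu A"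
    unfolding nu_def by (subst emeasure_density_const) (auto simp: mult.commute)
  also have "\<dots> = emeasure lborel {x. norm x \<in> A \<and> dir x \<in> B}"
    using \<open>mu = nu\<close> mu[OF A] by simp
  also have "\<dots> = emeasure ?M (A \<times> B)"
  proof -
    have "(\<lambda>x. (norm x, dir x)) -` (A \<times> B) = {x. norm x \<in> A \<and> dir x \<in> B}" by auto
    then show ?thesis by (subst emeasure_distr) simp_all
  qed
  finally show "emeasure ?r A * emeasure ?w B = emeasure ?M (A \<times> B)" .
qed

section \<open>Homogeneous polynomials\<close>

definition mon :: "('n::finite \<Rightarrow> nat) \<Rightarrow> real^'n \<Rightarrow> real" where
  "mon k x = (\<Prod>i\<in>UNIV. (x $ i) ^ k i)"

lemma finite_multiindex: "finite {k :: 'n::finite \<Rightarrow> nat. sum k UNIV = j}"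
proof (rule finite_subset)
  show "{k :: 'n \<Rightarrow> nat. sum k UNIV = j} \<subseteq> PiE UNIV (\<lambda>_. {..j})"
    by (auto intro: member_le_sum)
qed (auto intro: finite_PiE)

lemma hom_poly_altdef:
  "hom_poly j f \<longleftrightarrow> (\<exists>c. f = (\<lambda>x. \<Sum>k | sum k UNIV = j. c k * of_real (mon k x)))"
  by (simp add: hom_poly_def mon_def)

lemma hom_poly_mon: "sum k UNIV = j \<Longrightarrow> hom_poly j (\<lambda>x. c * of_real (mon k x))"
  unfolding hom_poly_altdef
  by (rule exI[of _ "\<lambda>l. if l = k then c else 0"])
    (simp add: if_distrib[of "\<lambda>a. a * _"] finite_multiindex cong: if_cong)

lemma hom_poly_zero: "hom_poly j (\<lambda>x. 0)"
  unfolding hom_poly_altdef by (rule exI[of _ "\<lambda>_. 0"]) simp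

lemma hom_poly_add: "hom_poly j f \<Longrightarrow> hom_poly j g \<Longrightarrow> hom_poly j (\<lambda>x. f x + g x)"
  unfolding hom_poly_altdef
  by (elim exE, rule_tac x="\<lambda>k. c k + ca k" in exI) (simp add: sum.distrib distrib_right)

lemma hom_poly_sum: "(\<And>i. i \<in> I \<Longrightarrow> hom_poly j (f i)) \<Longrightarrow> hom_poly j (\<lambda>x. \<Sum>i\<in>I. f i x)"
  by (induction I rule: infinite_finite_induct) (auto intro: hom_poly_zero hom_poly_add)

text \<open>Linear statements reduce to single monomials. The zero polynomial needs no case of its
  own: it is the monomial case with \<open>c = 0\<close> and any exponent of degree
  \<open>j\<close>.\<close>

lemma hom_poly_induct [consumes 1, case_names mon add]:
  assumes "hom_poly j f"
    and "\<And>c k. sum k UNIV = j \<Longrightarrow> Q (\<lambda>x. c * of_real (mon k x))"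
    and "\<And>f g. hom_poly j f \<Longrightarrow> hom_poly j g \<Longrightarrow> Q f \<Longrightarrow> Q g \<Longrightarrow> Q (\<lambda>x. f x + g x)"
  shows "Q (f :: real^'n \<Rightarrow> complex)"
proof -
  obtain i0 :: 'n where True by simp
  have z: "Q (\<lambda>x. 0)"
    using assms(2)[of "\<lambda>i. if i = i0 then j else 0" 0] by simp
  obtain c where f: "f = (\<lambda>x. \<Sum>k | sum k UNIV = j. c k * of_real (mon k x))"
    using assms(1) by (auto simp: hom_poly_altdef)
  have "Q (\<lambda>x. \<Sum>k\<in>K. c k * of_real (mon k x))" if "finite K" "\<forall>k\<in>K. sum k UNIV = j" for K
    using that
  proof (induction K rule: finite_induct)
    case (insert k K)
    have "hom_poly j (\<lambda>x. \<Sum>k\<in>K. c k * of_real (mon k x))"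
      using insert by (intro hom_poly_sum hom_poly_mon) auto
    then show ?case using insert by (simp add: assms(2,3) hom_poly_mon)
  qed (simp add: z)
  then show ?thesis unfolding f by (auto simp: finite_multiindex)
qed

lemma mon_add: "mon k x * mon l x = mon (\<lambda>i. k i + l i) x"
  by (simp add: mon_def power_add prod.distrib)

lemma hom_poly_mult:
  assumes "hom_poly i f" "hom_poly j g"
  shows "hom_poly (i + j) (\<lambda>x. f x * g x)"
  using assms(1)
proof (induction rule: hom_poly_induct)
  case (mon c k)
  note k = mon
  show ?case using assms(2)
  proof (induction rule: hom_poly_induct)
    case (mon e l)
    have "hom_poly (i + j) (\<lambda>x. (c * e) * of_real (mon (\<lambda>i. k i + l i) x))"
      using mon k by (intro hom_poly_mon) (simp add: sum.distrib)
    then show ?case by (simp add: ac_simps flip: mon_add)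
  next
    case (add f g)
    then show ?case using hom_poly_add[OF add(3,4)] by (simp add: algebra_simps)
  qed
next
  case (add f g)
  then show ?case using hom_poly_add[OF add(3,4)] by (simp add: algebra_simps)
qed

lemma hom_poly_const: "hom_poly 0 (\<lambda>x. c)"
  using hom_poly_mon[of "\<lambda>_. 0" 0 c] by (simp add: mon_def)

lemma hom_poly_cmult: "hom_poly j f \<Longrightarrow> hom_poly j (\<lambda>x. c * f x)"
  using hom_poly_mult[OF hom_poly_const] by simp

lemma hom_poly_diff: "hom_poly j f \<Longrightarrow> hom_poly j g \<Longrightarrow> hom_poly j (\<lambda>x. f x - g x)"
  using hom_poly_add[of j f "\<lambda>x. -1 * g x"] hom_poly_cmult[of j g "-1"] by simp

lemma hom_poly_power: "hom_poly j f \<Longrightarrow> hom_poly (j * n) (\<lambda>x. f x ^ n)"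
  by (induction n) (auto intro: hom_poly_const dest: hom_poly_mult)

lemma mon_single: "mon (\<lambda>l. if l = i then 1 else 0) x = x $ i"
  unfolding mon_def by (subst prod.remove[of _ i]) auto

lemma hom_poly_coord: "hom_poly 1 (\<lambda>x. of_real (x $ i))"
  using hom_poly_mon[of "\<lambda>l. if l = i then 1 else 0" 1 1] by (simp add: mon_single[simplified])

lemma hom_poly_inner: "hom_poly 1 (\<lambda>x. of_real (y \<bullet> x))"
proof -
  have "hom_poly 1 (\<lambda>x. \<Sum>i\<in>UNIV. of_real (y $ i) * of_real (x $ i))"
    by (intro hom_poly_sum hom_poly_cmult hom_poly_coord)
  then show ?thesis by (simp add: inner_vec_def)
qed

lemma hom_poly_inner_self: "hom_poly 2 (\<lambda>x. of_real (x \<bullet> x))"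
proof -
  have "hom_poly (1+1) (\<lambda>x. \<Sum>i\<in>UNIV. of_real (x $ i) * of_real (x $ i))"
    by (intro hom_poly_sum hom_poly_mult hom_poly_coord)
  then show ?thesis by (simp add: inner_vec_def numeral_2_eq_2)
qed

lemma hom_poly_scaleR:
  assumes "hom_poly j f" shows "f (a *\<^sub>R x) = of_real (a ^ j) * f x"
  using assms
  by (induction rule: hom_poly_induct)
    (auto simp: mon_def power_mult_distrib prod.distrib power_sum[symmetric] algebra_simps)

lemma hom_poly_continuous: "hom_poly j f \<Longrightarrow> continuous_on A f"
  by (induction rule: hom_poly_induct) (auto simp: mon_def intro!: continuous_intros)

text \<open>A relational form of \<open>partial_deriv\<close> that carries differentiability with
  it, so that the sum and product rules compose; \<open>has_pd_imp_eq\<close> returns to the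
  function.\<close>

definition has_pd :: "'n::finite \<Rightarrow> (real^'n \<Rightarrow> complex) \<Rightarrow> (real^'n \<Rightarrow> complex) \<Rightarrow> bool" where
  "has_pd i f f' \<longleftrightarrow> (\<forall>x. ((\<lambda>t. f (x + t *\<^sub>R axis i 1)) has_vector_derivative f' x) (at 0))"

lemma has_pd_imp_eq: "has_pd i f f' \<Longrightarrow> partial_deriv i f = f'"
  by (auto simp: has_pd_def partial_deriv_def vector_derivative_at fun_eq_iff)

lemma has_pd_add: "has_pd i f f' \<Longrightarrow> has_pd i g g' \<Longrightarrow> has_pd i (\<lambda>x. f x + g x) (\<lambda>x. f' x + g' x)"
  by (auto simp: has_pd_def intro!: has_vector_derivative_add)

lemma has_pd_mult:
  "has_pd i f f' \<Longrightarrow> has_pd i g g' \<Longrightarrow> has_pd i (\<lambda>x. f x * g x) (\<lambda>x. f' x * g x + f x * g' x)"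
  unfolding has_pd_def
  by (auto intro!: derivative_eq_intros)

lemma has_pd_const: "has_pd i (\<lambda>x. c) (\<lambda>x. 0)"
  by (auto simp: has_pd_def)

lemma has_pd_cmult: "has_pd i f f' \<Longrightarrow> has_pd i (\<lambda>x. c * f x) (\<lambda>x. c * f' x)"
  using has_pd_mult[OF has_pd_const] by simp

lemma has_pd_sum:
  "(\<And>l. l \<in> I \<Longrightarrow> has_pd i (f l) (f' l)) \<Longrightarrow> has_pd i (\<lambda>x. \<Sum>l\<in>I. f l x) (\<lambda>x. \<Sum>l\<in>I. f' l x)"
  by (induction I rule: infinite_finite_induct) (auto intro: has_pd_const has_pd_add)

lemma has_pd_of_real:
  assumes "\<And>x. ((\<lambda>t. f (x + t *\<^sub>R axis i 1)) has_real_derivative f' x) (at 0)"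
  shows "has_pd i (\<lambda>x. of_real (f x)) (\<lambda>x. of_real (f' x))"
  using assms unfolding has_pd_def
  by (auto intro!: has_vector_derivative_of_real simp: has_real_derivative_iff_has_vector_derivative)

lemma mon_upd: "mon (k(i := n)) x = (x $ i) ^ n * (\<Prod>l\<in>UNIV - {i}. (x $ l) ^ k l)"
  unfolding mon_def by (subst prod.remove[of _ i]) (auto intro!: prod.cong)

lemma mon_remove: "mon k x = (x $ i) ^ k i * (\<Prod>l\<in>UNIV - {i}. (x $ l) ^ k l)"
  using mon_upd[of k i "k i"] by simp

lemma sum_upd_pred:
  fixes k :: "'n::finite \<Rightarrow> nat"
  assumes "k i \<noteq> 0" shows "sum (k(i := k i - 1)) UNIV = sum k UNIV - 1"
proof -
  have "sum k UNIV = k i + sum k (UNIV - {i})" by (subst sum.remove[of _ i]) auto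
  moreover have "sum (k(i := k i - 1)) UNIV = (k i - 1) + sum k (UNIV - {i})"
    by (subst sum.remove[of _ i]) auto
  ultimately show ?thesis using assms by simp
qed

lemma has_pd_mon:
  "has_pd i (\<lambda>x. of_real (mon k x)) (\<lambda>x. of_real (real (k i) * mon (k(i := k i - 1)) x))"
proof (rule has_pd_of_real)
  fix x :: "real^'a"
  let ?p = "\<Prod>l\<in>UNIV - {i}. (x $ l) ^ k l"
  have "mon k (x + t *\<^sub>R axis i 1) = (x $ i + t) ^ k i * ?p" for t
    unfolding mon_remove[of k _ i] by (auto simp: axis_def intro!: prod.cong)
  moreover have "((\<lambda>t. (x $ i + t) ^ k i * ?p) has_real_derivative
      real (k i) * ((x $ i) ^ (k i - 1) * ?p)) (at 0)"
    by (auto intro!: derivative_eq_intros)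
  ultimately show "((\<lambda>t. mon k (x + t *\<^sub>R axis i 1)) has_real_derivative
      real (k i) * mon (k(i := k i - 1)) x) (at 0)" by (simp add: mon_upd)
qed

lemma partial_deriv_mon:
  "partial_deriv i (\<lambda>x. c * of_real (mon k x)) = (\<lambda>x. (c * of_nat (k i)) * of_real (mon (k(i := k i - 1)) x))"
  using has_pd_imp_eq[OF has_pd_cmult[OF has_pd_mon]] by (simp add: mult.assoc)

text \<open>Proved as a conjunction because differentiability of the summands is what computes the
  derivative of a sum. In degree 0 the derivative is zero, which is homogeneous of every degree, so
  the truncated \<open>j - 1\<close> is harmless.\<close>

lemma hom_poly_pd:
  assumes "hom_poly j f"
  shows "has_pd i f (partial_deriv i f) \<and> hom_poly (j - 1) (partial_deriv i f)"
  using assms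
proof (induction rule: hom_poly_induct)
  case (mon c k)
  have "hom_poly (j - 1) (\<lambda>x. (c * of_nat (k i)) * of_real (mon (k(i := k i - 1)) x))"
  proof (cases "k i = 0")
    case False
    then show ?thesis using sum_upd_pred[of k i, OF False] mon by (intro hom_poly_mon) simp
  qed (simp add: hom_poly_zero)
  then show ?case
    using has_pd_cmult[OF has_pd_mon, of i c k] by (simp add: partial_deriv_mon mult.assoc)
next
  case (add f g)
  then have "has_pd i (\<lambda>x. f x + g x) (\<lambda>x. partial_deriv i f x + partial_deriv i g x)"
    by (intro has_pd_add) auto
  note has_pd_imp_eq[OF this] this
  with add show ?case by (simp add: hom_poly_add)
qed

lemmas has_pd_hom_poly = hom_poly_pd[THEN conjunct1]
lemmas hom_poly_partial_deriv = hom_poly_pd[THEN conjunct2]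

lemma partial_deriv_add:
  "hom_poly j f \<Longrightarrow> hom_poly j' g \<Longrightarrow>
    partial_deriv i (\<lambda>x. f x + g x) = (\<lambda>x. partial_deriv i f x + partial_deriv i g x)"
  by (intro has_pd_imp_eq has_pd_add has_pd_hom_poly)

lemma partial_deriv_cmult:
  "hom_poly j f \<Longrightarrow> partial_deriv i (\<lambda>x. c * f x) = (\<lambda>x. c * partial_deriv i f x)"
  by (intro has_pd_imp_eq has_pd_cmult has_pd_hom_poly)

lemma partial_deriv_sum:
  "(\<And>l. l \<in> I \<Longrightarrow> hom_poly j (f l)) \<Longrightarrow>
    partial_deriv i (\<lambda>x. \<Sum>l\<in>I. f l x) = (\<lambda>x. \<Sum>l\<in>I. partial_deriv i (f l) x)"
  by (intro has_pd_imp_eq has_pd_sum has_pd_hom_poly)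

lemma partial_deriv_commute:
  assumes "hom_poly j f"
  shows "partial_deriv i (partial_deriv l f) = partial_deriv l (partial_deriv i f)"
  using assms
proof (induction rule: hom_poly_induct)
  case (mon c k)
  then show ?case by (cases "i = l") (auto simp: partial_deriv_mon fun_upd_twist fun_eq_iff)
next
  case (add f g)
  then show ?case
    by (simp add: partial_deriv_add[OF add(1,2)]
      partial_deriv_add[OF hom_poly_partial_deriv[OF add(1)] hom_poly_partial_deriv[OF add(2)]])
qed

lemma euler_hom_poly:
  assumes "hom_poly j f"
  shows "(\<Sum>i\<in>UNIV. of_real (x $ i) * partial_deriv i f x) = of_nat j * f x"
  using assms
proof (induction rule: hom_poly_induct)
  case (mon c k)
  have *: "x $ i * (real (k i) * mon (k(i := k i - 1)) x) = real (k i) * mon k x" for i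
  proof (cases "k i")
    case (Suc n)
    then show ?thesis unfolding mon_upd mon_remove[of k x i] by simp
  qed simp
  have "(\<Sum>i\<in>UNIV. of_real (x $ i) * ((c * of_nat (k i)) * of_real (mon (k(i := k i - 1)) x))) =
      (\<Sum>i\<in>UNIV. c * of_real (x $ i * (real (k i) * mon (k(i := k i - 1)) x)))"
    by (intro sum.cong refl) (simp add: ac_simps)
  also have "\<dots> = (\<Sum>i\<in>UNIV. of_nat (k i) * (c * of_real (mon k x)))"
    unfolding * by (intro sum.cong refl) (simp add: ac_simps)
  also have "\<dots> = of_nat (sum k UNIV) * (c * of_real (mon k x))"
    by (simp add: sum_distrib_right)
  finally show ?case using mon by (simp add: partial_deriv_mon)
next
  case (add f g)
  then show ?case by (simp add: partial_deriv_add[OF add(1,2)] algebra_simps sum.distrib)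
qed

lemma laplacian_partial_deriv:
  assumes "hom_poly j f"
  shows "laplacian (partial_deriv i f) x = partial_deriv i (laplacian f) x"
proof -
  have *: "hom_poly (j - 1 - 1) (partial_deriv l (partial_deriv m f))" for l m
    using assms by (intro hom_poly_partial_deriv)
  have "partial_deriv i (laplacian f) x = (\<Sum>l\<in>UNIV. partial_deriv i (partial_deriv l (partial_deriv l f)) x)"
    unfolding laplacian_def[abs_def] by (subst partial_deriv_sum[OF *]) auto
  also have "\<dots> = laplacian (partial_deriv i f) x"
    unfolding laplacian_def
    by (intro sum.cong refl) (metis partial_deriv_commute assms hom_poly_partial_deriv)
  finally show ?thesis by simp
qed

text \<open>This operator appears when a factor \<open>y \<bullet> x\<close> is integrated by parts.
  Evaluated at \<open>y\<close> itself, it gives \<open>j * h y\<close> by Euler's identity.\<close>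

definition dir_deriv :: "real^'n \<Rightarrow> (real^'n \<Rightarrow> complex) \<Rightarrow> real^'n \<Rightarrow> complex" where
  "dir_deriv y h x = (\<Sum>i\<in>UNIV. of_real (y $ i) * partial_deriv i h x)"

lemma hom_poly_dir_deriv: "hom_poly j h \<Longrightarrow> hom_poly (j - 1) (dir_deriv y h)"
  unfolding dir_deriv_def[abs_def] by (intro hom_poly_sum hom_poly_cmult hom_poly_partial_deriv)

text \<open>Derivatives with constant coefficients commute with the Laplacian. This keeps the
  induction for the Gaussian moments inside the harmonic polynomials, one degree lower.\<close>

lemma harmonic_dir_deriv:
  assumes h: "hom_poly j h" and "harmonic h"
  shows "harmonic (dir_deriv y h)"
proof -
  have L: "laplacian h = (\<lambda>x. 0)" using assms by (auto simp: harmonic_def)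
  have p: "hom_poly (j - 1) (partial_deriv i h)" for i using h by (rule hom_poly_partial_deriv)
  have pp: "hom_poly (j - 1 - 1) (partial_deriv l (partial_deriv i h))" for i l
    using p by (rule hom_poly_partial_deriv)
  have "laplacian (dir_deriv y h) x = 0" for x
  proof -
    have "partial_deriv l (dir_deriv y h) = (\<lambda>x. \<Sum>i\<in>UNIV. of_real (y $ i) * partial_deriv l (partial_deriv i h) x)" for l
      unfolding dir_deriv_def[abs_def]
      by (subst partial_deriv_sum[OF hom_poly_cmult[OF p]]) (auto simp: partial_deriv_cmult[OF p])
    then have "partial_deriv l (partial_deriv l (dir_deriv y h)) =
        (\<lambda>x. \<Sum>i\<in>UNIV. of_real (y $ i) * partial_deriv l (partial_deriv l (partial_deriv i h)) x)" for l
      by (simp add: partial_deriv_sum[OF hom_poly_cmult[OF pp]] partial_deriv_cmult[OF pp])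
    then have "laplacian (dir_deriv y h) x = (\<Sum>i\<in>UNIV. of_real (y $ i) * laplacian (partial_deriv i h) x)"
      unfolding laplacian_def by (simp add: sum_distrib_left) (rule sum.swap)
    also have "\<dots> = 0"
      by (simp add: laplacian_partial_deriv[OF h] L has_pd_imp_eq[OF has_pd_const])
    finally show ?thesis .
  qed
  then show ?thesis by (simp add: harmonic_def)
qed

lemma has_pd_inner_power:
  "has_pd i (\<lambda>x. of_real ((y \<bullet> x) ^ m)) (\<lambda>x. of_real (real m * y $ i * (y \<bullet> x) ^ (m - 1)))"
  by (rule has_pd_of_real) (auto intro!: derivative_eq_intros simp: inner_add_right inner_axis)

section \<open>Gaussian moments of harmonic polynomials\<close>

lemma
  fixes f :: "'a::euclidean_space \<Rightarrow> real \<Rightarrow> real"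
  assumes int: "\<And>b. b \<in> Basis \<Longrightarrow> integrable lborel (f b)"
  shows integrable_lborel_prod: "integrable lborel (\<lambda>x. \<Prod>b\<in>Basis. f b (x \<bullet> b))"
    and integral_lborel_prod:
      "(LINT x|lborel. (\<Prod>b\<in>Basis. f b (x \<bullet> b))) = (\<Prod>b\<in>Basis. LINT t|lborel. f b t)"
proof -
  interpret product_sigma_finite "\<lambda>_::'a. lborel :: real measure" ..
  let ?T = "\<lambda>g. \<Sum>b\<in>Basis. g b *\<^sub>R b :: 'a" and ?P = "\<Pi>\<^sub>M b\<in>(Basis :: 'a set). (lborel :: real measure)"
  have T: "?T \<in> ?P \<rightarrow>\<^sub>M borel" by measurable
  have [measurable]: "f b \<in> borel_measurable borel" if "b \<in> Basis" for b
    using borel_measurable_integrable[OF int[OF that]] by simp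
  have m: "(\<lambda>x. \<Prod>b\<in>Basis. f b (x \<bullet> b)) \<in> borel_measurable borel" by measurable
  have eq: "(\<Prod>b\<in>Basis. f b (?T g \<bullet> b)) = (\<Prod>b\<in>Basis. f b (g b))" for g
    by (intro prod.cong refl) (simp add: inner_sum_left_Basis)
  have "integrable ?P (\<lambda>g. \<Prod>b\<in>Basis. f b (g b))"
    using int by (intro product_integrable_prod) auto
  then show "integrable lborel (\<lambda>x. \<Prod>b\<in>Basis. f b (x \<bullet> b))"
    by (subst lborel_eq, subst integrable_distr_eq[OF T m]) (simp add: eq)
  show "(LINT x|lborel. (\<Prod>b\<in>Basis. f b (x \<bullet> b))) = (\<Prod>b\<in>Basis. LINT t|lborel. f b t)"
    by (subst lborel_eq, subst integral_distr[OF T m], simp only: eq, intro product_integral_prod)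
      (use int in auto)
qed

lemma
  fixes g :: "'n::finite \<Rightarrow> real \<Rightarrow> real"
  assumes int: "\<And>i. integrable lborel (g i)"
  shows integrable_lborel_prod_vec: "integrable lborel (\<lambda>x::real^'n. \<Prod>i\<in>UNIV. g i (x $ i))"
    and integral_lborel_prod_vec:
      "(LINT x|lborel. (\<Prod>i\<in>UNIV. g i ((x::real^'n) $ i))) = (\<Prod>i\<in>UNIV. LINT t|lborel. g i t)"
proof -
  let ?e = "\<lambda>i::'n. axis i (1::real)"
  have inj: "inj ?e" by (auto simp: inj_def axis_eq_axis)
  have B: "(Basis :: (real^'n) set) = range ?e" by (auto simp: Basis_vec_def)
  define f where "f b = g (inv ?e b)" for b
  have f: "f (?e i) = g i" for i using inv_f_f[OF inj, of i] by (simp add: f_def)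
  have "(\<Prod>b\<in>Basis. f b (x \<bullet> b)) = (\<Prod>i\<in>UNIV. g i (x $ i))" for x :: "real^'n"
    unfolding B by (subst prod.reindex[OF inj]) (simp add: f inner_axis)
  moreover have "(\<Prod>b\<in>Basis. LINT t|lborel. f b t) = (\<Prod>i\<in>UNIV. LINT t|lborel. g i t)"
    unfolding B by (subst prod.reindex[OF inj]) (simp add: f)
  moreover have "integrable lborel (f b)" for b unfolding f_def by (rule int)
  ultimately show "integrable lborel (\<lambda>x::real^'n. \<Prod>i\<in>UNIV. g i (x $ i))"
    "(LINT x|lborel. (\<Prod>i\<in>UNIV. g i ((x::real^'n) $ i))) = (\<Prod>i\<in>UNIV. LINT t|lborel. g i t)"
    using integrable_lborel_prod[of f] integral_lborel_prod[of f] by simp_all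
qed

text \<open>The product form lets monomial moments factor over the coordinates;
  \<open>gauss_eq\<close> supplies the radial form for polar coordinates.\<close>

definition gauss :: "real^'n \<Rightarrow> real" where
  "gauss x = (\<Prod>i\<in>UNIV. std_normal_density (x $ i))"

abbreviation gauss_expectation :: "(real^'n \<Rightarrow> complex) \<Rightarrow> complex" (binder "EG " 10) where
  "gauss_expectation F \<equiv> LINT x|lborel. of_real (gauss x) * F x"

lemma gauss_eq: "gauss (x :: real^'n) = exp (- (norm x)\<^sup>2 / 2) / (2 * pi) powr (CARD('n) / 2)"
proof -
  have "gauss x = (\<Prod>i\<in>(UNIV::'n set). 1 / sqrt (2 * pi)) * (\<Prod>i\<in>UNIV. exp (- (x $ i)\<^sup>2 / 2))"
    unfolding gauss_def std_normal_density_def by (simp only: prod.distrib)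
  also have "(\<Prod>i\<in>UNIV. exp (- (x $ i)\<^sup>2 / 2)) = exp (\<Sum>i\<in>UNIV. - (x $ i)\<^sup>2 / 2)"
    by (simp add: exp_sum)
  also have "(\<Sum>i\<in>UNIV. - (x $ i)\<^sup>2 / 2) = - (norm x)\<^sup>2 / 2"
    by (simp add: norm_vec_def L2_set_def sum_nonneg sum_negf sum_divide_distrib)
  also have "(\<Prod>i\<in>(UNIV::'n set). 1 / sqrt (2 * pi)) = 1 / (2 * pi) powr (CARD('n) / 2)"
    by (simp add: powr_half_sqrt[symmetric] power_divide powr_powr flip: powr_realpow)
  finally show ?thesis by simp
qed

definition nmom :: "nat \<Rightarrow> real" where
  "nmom n = (LINT t|lborel. std_normal_density t * t ^ n)"

text \<open>One-dimensional Gaussian integration by parts, read off the closed formulas for the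
  moments. For \<open>n = 0\<close> the factor \<open>n\<close> vanishes, so the truncated index
  does not matter.\<close>

lemma nmom_rec: "nmom (Suc n) = n * nmom (n - 1)"
proof (cases "even n")
  case True
  then obtain k where k: "n = 2 * k" by auto
  have "nmom (Suc n) = 0" using integral_std_normal_moment_odd[of k] by (simp add: nmom_def k)
  moreover have "n = 0 \<or> nmom (n - 1) = 0"
    using integral_std_normal_moment_odd[of "k - 1"] k by (cases k) (auto simp: nmom_def)
  ultimately show ?thesis by auto
next
  case False
  then obtain k where k: "n = 2 * k + 1" by (elim oddE)
  have "nmom (Suc n) = fact (2 * Suc k) / (2 ^ Suc k * fact (Suc k))"
    using integral_std_normal_moment_even[of "Suc k"] by (simp add: nmom_def k)
  also have "\<dots> = n * (fact (2 * k) / (2 ^ k * fact k))"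
    using k by (simp add: divide_simps)
  also have "\<dots> = n * nmom (n - 1)"
    using integral_std_normal_moment_even[of k] by (simp add: nmom_def k)
  finally show ?thesis .
qed

lemma nmom_0 [simp]: "nmom 0 = 1"
  using integral_std_normal_moment_even[of 0] by (simp add: nmom_def)

lemma
  shows integrable_gauss_mon: "integrable lborel (\<lambda>x. gauss x * mon k x)"
    and integral_gauss_mon: "(LINT x|lborel. gauss x * mon k x) = (\<Prod>i\<in>UNIV. nmom (k i))"
proof -
  have eq: "gauss x * mon k x = (\<Prod>i\<in>UNIV. std_normal_density (x $ i) * (x $ i) ^ k i)" for x
    by (simp add: gauss_def mon_def prod.distrib)
  show "integrable lborel (\<lambda>x. gauss x * mon k x)"
    unfolding eq by (rule integrable_lborel_prod_vec) (rule integrable_std_normal_moment)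
  show "(LINT x|lborel. gauss x * mon k x) = (\<Prod>i\<in>UNIV. nmom (k i))"
    unfolding eq nmom_def by (rule integral_lborel_prod_vec) (rule integrable_std_normal_moment)
qed

lemma
  shows integrable_gauss_mon_complex: "integrable lborel (\<lambda>x. of_real (gauss x) * (c * complex_of_real (mon k x)))"
    and integral_gauss_mon_complex:
      "(EG x. (c * complex_of_real (mon k x))) = c * of_real (\<Prod>i\<in>UNIV. nmom (k i))"
proof -
  have eq: "of_real (gauss x) * (c * complex_of_real (mon k x)) = c * of_real (gauss x * mon k x)" for x
    by simp
  show "integrable lborel (\<lambda>x. of_real (gauss x) * (c * complex_of_real (mon k x)))"
    unfolding eq by (intro integrable_mult_right integrable_of_real integrable_gauss_mon)
  show "(EG x. (c * complex_of_real (mon k x))) = c * of_real (\<Prod>i\<in>UNIV. nmom (k i))"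
    unfolding eq by (simp only: integral_mult_right_zero integral_complex_of_real integral_gauss_mon)
qed

lemma integrable_gauss_hom_poly:
  assumes "hom_poly j F" shows "integrable lborel (\<lambda>x. of_real (gauss x) * F x)"
  using assms
proof (induction rule: hom_poly_induct)
  case (mon c k)
  show ?case by (rule integrable_gauss_mon_complex)
next
  case (add f g)
  from LINT_integrable_add[OF add(3,4)] show ?case by (simp add: algebra_simps)
qed

text \<open>On a monomial only the factor of coordinate \<open>i\<close> changes, and there the
  claim is \<open>nmom_rec\<close>.\<close>

lemma gauss_integration_by_parts:
  assumes "hom_poly j F"
  shows "(EG x. (of_real (x $ i) * F x)) =
    (EG x. partial_deriv i F x)"
  using assms
proof (induction rule: hom_poly_induct)
  case (mon c k)
  let ?k = "k(i := Suc (k i))" and ?p = "\<Prod>l\<in>UNIV - {i}. nmom (k l)"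
  have "of_real (x $ i) * (c * of_real (mon k x)) = c * of_real (mon ?k x)" for x
    unfolding mon_upd mon_remove[of k x i] by simp
  then have "(EG x. (of_real (x $ i) * (c * of_real (mon k x)))) =
      c * of_real (\<Prod>l\<in>UNIV. nmom (?k l))"
    by (simp only: integral_gauss_mon_complex)
  also have "(\<Prod>l\<in>UNIV. nmom (?k l)) = nmom (Suc (k i)) * ?p"
    by (subst prod.remove[of _ i]) (auto intro!: prod.cong)
  also have "\<dots> = k i * (nmom (k i - 1) * ?p)" by (simp add: nmom_rec)
  also have "nmom (k i - 1) * ?p = (\<Prod>l\<in>UNIV. nmom ((k(i := k i - 1)) l))"
    by (subst prod.remove[of _ i]) (auto intro!: prod.cong)
  finally show ?case
    unfolding partial_deriv_mon integral_gauss_mon_complex by (simp add: ac_simps)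
next
  case (add f g)
  have "hom_poly (1 + j) (\<lambda>x. of_real (x $ i) * f x)" "hom_poly (1 + j) (\<lambda>x. of_real (x $ i) * g x)"
    using hom_poly_mult[OF hom_poly_coord] add by blast+
  note * = this[THEN integrable_gauss_hom_poly] add(1,2)[THEN hom_poly_partial_deriv, THEN integrable_gauss_hom_poly]
  show ?case
    using add(3,4) * by (simp add: partial_deriv_add[OF add(1,2)] algebra_simps)
qed

lemma integral_gauss_cmult_sum:
  assumes "\<And>i. i \<in> I \<Longrightarrow> hom_poly j (F i)" 
  shows "(EG x. (\<Sum>i\<in>I. c i * F i x)) =
    (\<Sum>i\<in>I. c i * (EG x. F i x))"
proof -
  have "(EG x. (\<Sum>i\<in>I. c i * F i x)) =
     (LINT x|lborel. (\<Sum>i\<in>I. c i * (of_real (gauss x) * F i x)))"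
    by (simp add: sum_distrib_left ac_simps)
  also have "\<dots> = (\<Sum>i\<in>I. LINT x|lborel. c i * (of_real (gauss x) * F i x))"
    using assms by (intro LINT_sum integrable_mult_right) (rule integrable_gauss_hom_poly)
  finally show ?thesis by simp
qed

text \<open>Euler's identity writes \<open>j * h\<close> as a sum of terms \<open>x $ i\<close>
  times a first derivative; integrating each by parts assembles the Laplacian, which is
  zero.\<close>

lemma gauss_harmonic_zero:
  assumes h: "hom_poly j h" "harmonic h" and j: "j > 0"
  shows "(EG x. h x) = 0"
proof -
  have p: "hom_poly (j - 1) (partial_deriv i h)" for i using h by (intro hom_poly_partial_deriv)
  have xp: "hom_poly (1 + (j - 1)) (\<lambda>x. of_real (x $ i) * partial_deriv i h x)" for i
    by (intro hom_poly_mult hom_poly_coord p)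
  have pp: "hom_poly (j - 1 - 1) (partial_deriv i (partial_deriv i h))" for i
    using p by (rule hom_poly_partial_deriv)
  have "of_nat j * (EG x. h x) =
      (EG x. (of_nat j * h x))"
    by (simp add: mult.left_commute[of _ "of_nat j"])
  also have "\<dots> = (EG x. (\<Sum>i\<in>UNIV. 1 * (of_real (x $ i) * partial_deriv i h x)))"
    by (simp add: euler_hom_poly[OF h(1)])
  also have "\<dots> = (\<Sum>i\<in>UNIV. 1 * (EG x. (of_real (x $ i) * partial_deriv i h x)))"
    by (rule integral_gauss_cmult_sum[OF xp])
  also have "\<dots> = (\<Sum>i\<in>UNIV. 1 * (EG x. partial_deriv i (partial_deriv i h) x))"
    by (simp add: gauss_integration_by_parts[OF p])
  also have "\<dots> = (EG x. (\<Sum>i\<in>UNIV. 1 * partial_deriv i (partial_deriv i h) x))"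
    by (rule integral_gauss_cmult_sum[OF pp, symmetric])
  also have "\<dots> = 0" using h(2) by (simp add: harmonic_def laplacian_def)
  finally show ?thesis using j by simp
qed

text \<open>The Gaussian moment of \<open>t ^ m\<close> against the Hermite polynomial of degree
  \<open>j\<close> (leading coefficient 1), that is, the one-dimensional instance of the moments
  below.\<close>

definition gcoef :: "nat \<Rightarrow> nat \<Rightarrow> real" where
  "gcoef m j = (if j \<le> m \<and> even (m - j) then fact m / (2 ^ ((m - j) div 2) * fact ((m - j) div 2)) else 0)"

text \<open>Mirrors integration by parts: the derivative falls on the harmonic factor (first term)
  or on the power (second term).\<close>

lemma gcoef_rec:
  assumes "m > 0"
  shows "gcoef (Suc m) j = (if j = 0 then 0 else j * gcoef m (j - 1)) + m * gcoef (m - 1) j"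
proof -
  consider "j > Suc m" | "j = Suc m" | "odd (Suc m - j)" | k where "Suc m = j + 2 * Suc k"
  proof (cases "j < Suc m \<and> even (Suc m - j)")
    case True
    then obtain l where l: "Suc m - j = 2 * l" by (elim conjE evenE)
    with True obtain k where "l = Suc k" by (cases l) auto
    with l that(4)[of k] True show ?thesis by auto
  next
    case False
    then show ?thesis using that(1,2,3) by (cases "j < Suc m") (auto simp: not_less dest: le_imp_less_or_eq)
  qed
  then show ?thesis
  proof cases
    case 3
    then have "odd (m - (j - 1))" if "j > 0" using that by (simp add: Suc_diff_Suc)
    moreover have "odd (m - 1 - j)" if "j \<le> m - 1" using 3 that assms by (auto simp: even_diff_nat)
    ultimately show ?thesis using 3 by (auto simp: gcoef_def)
  next
    case (4 k)
    then have m: "m = j + 2 * k + 1" by simp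
    have 1: "gcoef (Suc m) j = fact (Suc m) / (2 ^ Suc k * fact (Suc k))"
      using 4 by (simp add: gcoef_def)
    have 2: "gcoef m (j - 1) = fact m / (2 ^ Suc k * fact (Suc k))" if "j > 0"
      using that m by (simp add: gcoef_def)
    have 3: "gcoef (m - 1) j = fact (m - 1) / (2 ^ k * fact k)"
      using m by (simp add: gcoef_def)
    have f: "fact (Suc m) = (real m + 1) * fact m" "fact m = real m * fact (m - 1)" "fact (Suc k) = (real k + 1) * fact k"
      using assms by (simp_all add: fact_reduce)
    define T :: real where "T = fact (m - 1) / (2 ^ k * fact k)"
    \<comment> \<open>The factor \<open>s\<close> is the ratio of the denominators
      \<open>2 ^ Suc k * fact (Suc k)\<close> and \<open>2 ^ k * fact k\<close>; splitting
      \<open>m + 1\<close> as \<open>j + s\<close> yields the two terms of the recursion.\<close>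
    define s where "s = 2 * (real k + 1)"
    have s: "s > 0" "real m + 1 = real j + s" using m by (simp_all add: s_def)
    have e: "fact m / (2 ^ Suc k * fact (Suc k)) = m * T / s"
      unfolding T_def s_def f by (simp add: field_simps)
    have "fact (Suc m) / (2 ^ Suc k * fact (Suc k)) = (real m + 1) * (fact m / (2 ^ Suc k * fact (Suc k)))"
      unfolding f(1) by simp
    also have "\<dots> = j * (m * T / s) + m * T"
      unfolding e s(2) using s(1) by (simp add: field_simps)
    finally have r1: "gcoef (Suc m) j = j * (m * T / s) + m * T" unfolding 1 .
    have r2: "gcoef m (j - 1) = m * T / s" if "j > 0" using 2[OF that] unfolding e .
    have r3: "gcoef (m - 1) j = T" unfolding 3 T_def ..
    show ?thesis unfolding r1 r3 using r2 by (cases "j = 0") simp_all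
  qed (use assms in \<open>auto simp: gcoef_def\<close>)
qed

lemma gcoef_rec0: "gcoef (Suc 0) j = (if j = 0 then 0 else j * gcoef 0 (j - 1))"
  by (auto simp: gcoef_def)

text \<open>One factor \<open>y \<bullet> x\<close> is split off and integrated by parts. The
  derivative either falls on \<open>h\<close>, giving the harmonic polynomial
  \<open>dir_deriv y h\<close>, or on the remaining power, giving \<open>y \<bullet> y\<close> and a
  power lower by one more. Hence the induction is strong and general in \<open>h\<close> and
  \<open>j\<close>.\<close>

theorem gauss_harmonic_moment:
  fixes h :: "real^'n \<Rightarrow> complex"
  assumes "hom_poly j h" "harmonic h"
  shows "(EG x. (h x * of_real ((y \<bullet> x) ^ m))) =
    of_real (gcoef m j * norm y ^ (m - j)) * h y"
  using assms
proof (induction m arbitrary: j h rule: less_induct)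
  case (less m)
  note h = less.prems
  show ?case
  proof (cases m)
    case 0
    show ?thesis
    proof (cases "j = 0")
      case True
      \<comment> \<open>In degree 0, scaling by \<open>0\<close> multiplies by
        \<open>0 ^ 0 = 1\<close>, so both values equal the value at the origin.\<close>
      have hc: "h x = h y" for x
        using hom_poly_scaleR[OF h(1), of 0 x] hom_poly_scaleR[OF h(1), of 0 y] True by simp
      have "(EG x. h x) =
          (EG x. (h y * of_real (mon (\<lambda>_::'n. 0) x)))"
      proof (intro LINT_cong refl)
        fix x show "of_real (gauss x) * h x = of_real (gauss x) * (h y * of_real (mon (\<lambda>_. 0) x))"
          using hc[of x] by (simp add: mon_def)
      qed
      also have "\<dots> = h y"
        by (subst integral_gauss_mon_complex) simp
      finally have "(EG x. h x) = h y" .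
      then show ?thesis using True 0 by (simp add: gcoef_def)
    next
      case False
      then show ?thesis using gauss_harmonic_zero[OF h] 0 by (simp add: gcoef_def)
    qed
  next
    case (Suc n)
    let ?h' = "dir_deriv y h"
    have ip: "hom_poly k (\<lambda>x. of_real ((y \<bullet> x) ^ k))" for k
      using hom_poly_power[OF hom_poly_inner[of y], of k] by simp
    have F: "hom_poly (j + n) (\<lambda>x. h x * of_real ((y \<bullet> x) ^ n))"
      by (intro hom_poly_mult h ip)
    have xF: "hom_poly (1 + (j + n)) (\<lambda>x. of_real (x $ i) * (h x * of_real ((y \<bullet> x) ^ n)))" for i
      by (intro hom_poly_mult[OF hom_poly_coord] F)
    have dF: "partial_deriv i (\<lambda>x. h x * of_real ((y \<bullet> x) ^ n)) =
       (\<lambda>x. partial_deriv i h x * of_real ((y \<bullet> x) ^ n) + h x * of_real (real n * y $ i * (y \<bullet> x) ^ (n - 1)))" for i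
      by (intro has_pd_imp_eq has_pd_mult has_pd_hom_poly[OF h(1)] has_pd_inner_power)
    have dF': "hom_poly (j + n - 1) (partial_deriv i (\<lambda>x. h x * of_real ((y \<bullet> x) ^ n)))" for i
      using F by (rule hom_poly_partial_deriv)
    have hn: "hom_poly (j + (n - 1)) (\<lambda>x. h x * of_real ((y \<bullet> x) ^ (n - 1)))"
      by (intro hom_poly_mult h ip)
    have h'n: "hom_poly (j - 1 + n) (\<lambda>x. ?h' x * of_real ((y \<bullet> x) ^ n))"
      by (intro hom_poly_mult hom_poly_dir_deriv h ip)
    have "(EG x. (h x * of_real ((y \<bullet> x) ^ m))) =
        (EG x. (\<Sum>i\<in>UNIV. of_real (y $ i) * (of_real (x $ i) * (h x * of_real ((y \<bullet> x) ^ n)))))"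
      by (simp add: Suc inner_vec_def sum_distrib_right sum_distrib_left ac_simps)
    also have "\<dots> = (\<Sum>i\<in>UNIV. of_real (y $ i) * (EG x. (of_real (x $ i) * (h x * of_real ((y \<bullet> x) ^ n)))))"
      by (rule integral_gauss_cmult_sum[OF xF])
    also have "\<dots> = (\<Sum>i\<in>UNIV. of_real (y $ i) * (EG x. partial_deriv i (\<lambda>x. h x * of_real ((y \<bullet> x) ^ n)) x))"
      by (simp only: gauss_integration_by_parts[OF F])
    also have "\<dots> = (EG x. (\<Sum>i\<in>UNIV. of_real (y $ i) * partial_deriv i (\<lambda>x. h x * of_real ((y \<bullet> x) ^ n)) x))"
      by (rule integral_gauss_cmult_sum[OF dF', symmetric])
    also have "\<dots> = (LINT x|lborel. of_real (gauss x) * (?h' x * of_real ((y \<bullet> x) ^ n)) +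
        of_real (real n * (norm y)\<^sup>2) * (of_real (gauss x) * (h x * of_real ((y \<bullet> x) ^ (n - 1)))))"
    proof (intro LINT_cong refl)
      fix x
      have "(\<Sum>i\<in>UNIV. complex_of_real (y $ i) * (partial_deriv i h x * of_real ((y \<bullet> x) ^ n) + h x * of_real (real n * y $ i * (y \<bullet> x) ^ (n - 1)))) =
         ?h' x * of_real ((y \<bullet> x) ^ n) + (\<Sum>i\<in>UNIV. complex_of_real (y $ i) * of_real (y $ i)) * (h x * of_real (real n * (y \<bullet> x) ^ (n - 1)))"
        by (simp add: dir_deriv_def sum.distrib sum_distrib_right sum_distrib_left algebra_simps)
      also have "(\<Sum>i\<in>UNIV. complex_of_real (y $ i) * of_real (y $ i)) = of_real ((norm y)\<^sup>2)"
        unfolding power2_norm_eq_inner by (simp add: inner_vec_def)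
      finally show "of_real (gauss x) * (\<Sum>i\<in>UNIV. of_real (y $ i) * partial_deriv i (\<lambda>x. h x * of_real ((y \<bullet> x) ^ n)) x) =
        of_real (gauss x) * (?h' x * of_real ((y \<bullet> x) ^ n)) +
        of_real (real n * (norm y)\<^sup>2) * (of_real (gauss x) * (h x * of_real ((y \<bullet> x) ^ (n - 1))))"
        unfolding dF by (simp add: algebra_simps)
    qed
    also have "\<dots> = (EG x. (?h' x * of_real ((y \<bullet> x) ^ n))) +
        of_real (real n * (norm y)\<^sup>2) * (EG x. (h x * of_real ((y \<bullet> x) ^ (n - 1))))"
      by (subst LINT_add[OF integrable_gauss_hom_poly[OF h'n]
            integrable_mult_right[OF integrable_gauss_hom_poly[OF hn]]])
        (simp only: integral_mult_right_zero)
    also have "(EG x. (?h' x * of_real ((y \<bullet> x) ^ n))) =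
        of_real (gcoef n (j - 1) * norm y ^ (n - (j - 1))) * ?h' y"
      using Suc by (intro less.IH[OF _ hom_poly_dir_deriv[OF h(1)] harmonic_dir_deriv[OF h]]) auto
    also have "?h' y = of_nat j * h y"
      unfolding dir_deriv_def by (rule euler_hom_poly[OF h(1)])
    also have "of_real (real n * (norm y)\<^sup>2) * (EG x. (h x * of_real ((y \<bullet> x) ^ (n - 1)))) =
        of_real (real n * (norm y)\<^sup>2) * (of_real (gcoef (n - 1) j * norm y ^ (n - 1 - j)) * h y)"
    proof (cases "n = 0")
      case False
      then show ?thesis using Suc less.IH[OF _ h, of "n - 1"] by simp
    qed simp
    also have "of_real (gcoef n (j - 1) * norm y ^ (n - (j - 1))) * (of_nat j * h y) +
       of_real (real n * (norm y)\<^sup>2) * (of_real (gcoef (n - 1) j * norm y ^ (n - 1 - j)) * h y) =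
       of_real (real j * gcoef n (j - 1) * norm y ^ (n - (j - 1)) +
         real n * gcoef (n - 1) j * (norm y)\<^sup>2 * norm y ^ (n - 1 - j)) * h y"
      by (simp add: algebra_simps)
    also have "real j * gcoef n (j - 1) * norm y ^ (n - (j - 1)) = real j * gcoef n (j - 1) * norm y ^ (m - j)"
      using Suc by (cases j) auto
    also have "real n * gcoef (n - 1) j * (norm y)\<^sup>2 * norm y ^ (n - 1 - j) = real n * gcoef (n - 1) j * norm y ^ (m - j)"
    proof (cases "j \<le> n - 1 \<and> n \<noteq> 0")
      case True
      then have "m - j = 2 + (n - 1 - j)" using Suc by auto
      then show ?thesis by (simp add: power_add power2_eq_square)
    next
      case False
      then show ?thesis by (auto simp: gcoef_def)
    qed
    also have "real j * gcoef n (j - 1) * norm y ^ (m - j) + real n * gcoef (n - 1) j * norm y ^ (m - j) =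
       gcoef m j * norm y ^ (m - j)"
      using gcoef_rec[of n j] gcoef_rec0[of j] Suc by (cases "n = 0") (auto simp: algebra_simps)
    finally show ?thesis .
  qed
qed

section \<open>Polar decomposition of the Gaussian\<close>

interpretation sphere: finite_measure "\<omega> :: (real^'n) measure"
  by (rule finite_sphere_measure)

lemma measurable_sphere_continuous:
  fixes F :: "real^'n \<Rightarrow> 'b::{banach, second_countable_topology}"
  assumes "continuous_on (sphere 0 1) F"
  shows "F \<in> borel_measurable \<omega>"
  using borel_measurable_continuous_on_restrict[OF assms]
  by (simp cong: measurable_cong_sets add: sets_sphere_measure)

lemma integrable_sphere_continuous:
  fixes F :: "real^'n \<Rightarrow> 'b::{banach, second_countable_topology}"
  assumes "continuous_on (sphere 0 1) F"
  shows "integrable \<omega> F"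
proof -
  have "bounded (F ` sphere 0 1)"
    using assms by (intro compact_imp_bounded compact_continuous_image) auto
  then obtain B where "\<And>v. v \<in> sphere 0 1 \<Longrightarrow> norm (F v) \<le> B" unfolding bounded_iff by blast
  then show ?thesis
    by (intro sphere.integrable_const_bound[of _ B] measurable_sphere_continuous assms)
      (auto intro!: AE_I2)
qed

text \<open>Never evaluated directly: it is enough to know its positivity and, for even
  \<open>m\<close>, its product with the total mass of the sphere.\<close>

definition radial_gauss :: "nat \<Rightarrow> nat \<Rightarrow> real" where
  "radial_gauss d m = (LINT r|radial_measure d. exp (- r\<^sup>2 / 2) / (2 * pi) powr (d / 2) * r ^ m)"

text \<open>By homogeneity the integrand separates in polar coordinates into a radial factor and the
  restriction of \<open>F\<close> to the sphere. Integrability on the product is inherited from the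
  Gaussian integral, so Fubini applies.\<close>

lemma
  fixes F :: "real^'n \<Rightarrow> complex"
  assumes F: "hom_poly m F"
  shows gauss_polar: "(EG x. F x) =
      of_real (radial_gauss CARD('n) m) * (SI v. F v)"
proof -
  let ?w = "\<omega> :: (real^'n) measure" and ?R = "radial_measure CARD('n)"
  let ?\<phi> = "\<lambda>r. exp (- r\<^sup>2 / 2) / (2 * pi) powr (CARD('n) / 2) * r ^ m"
  let ?g = "\<lambda>(r, v). of_real (?\<phi> r) * F v"
  interpret R: sigma_finite_measure ?R by (rule sigma_finite_radial)
  interpret P: pair_sigma_finite ?R ?w ..
  have [measurable]: "F \<in> borel_measurable ?w"
    using F by (intro measurable_sphere_continuous hom_poly_continuous)
  have T: "(\<lambda>x. (norm x, dir x)) \<in> lborel \<rightarrow>\<^sub>M borel \<Otimes>\<^sub>M ?w"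
    using dir_measurable_lborel by (auto cong: measurable_cong_sets simp: sets_sphere_measure intro!: measurable_Pair)
  have g [measurable]: "?g \<in> borel_measurable (borel \<Otimes>\<^sub>M ?w)" by measurable
  have eq: "of_real (gauss x) * F x = ?g (norm x, dir x)" for x
    using hom_poly_scaleR[OF F, of "norm x" "dir x"] by (simp add: norm_scaleR_dir gauss_eq)
  have int: "integrable (?R \<Otimes>\<^sub>M ?w) ?g"
    unfolding polar_coordinates using integrable_gauss_hom_poly[OF F]
    by (subst integrable_distr_eq[OF T g]) (simp add: eq)
  have "(EG x. F x) = (LINT z|(?R \<Otimes>\<^sub>M ?w). ?g z)"
    unfolding polar_coordinates by (subst integral_distr[OF T g]) (simp add: eq)
  also have "\<dots> = (LINT r|?R. LINT v|?w. ?g (r, v))"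
    by (rule P.integral_fst'[OF int, symmetric])
  also have "\<dots> = (LINT r|?R. of_real (?\<phi> r) * (LINT v|?w. F v))"
    by simp
  also have "\<dots> = (LINT r|?R. complex_of_real (?\<phi> r)) * (LINT v|?w. F v)"
    by (rule integral_mult_left_zero)
  also have "(LINT r|?R. complex_of_real (?\<phi> r)) = of_real (radial_gauss CARD('n) m)"
    unfolding radial_gauss_def by (rule integral_complex_of_real)
  finally show ?thesis .
qed

section \<open>Normalisation: total mass of the sphere and the radial factor\<close>

lemma measure_sphere:
  "measure (\<omega> :: (real^'n) measure) (sphere 0 1) = 2 * pi powr (CARD('n) / 2) / Gamma (CARD('n) / 2)"
proof -
  have "{x::real^'n. norm x \<le> 1 \<and> dir x \<in> sphere 0 1} = cball 0 1" by auto
  then have "emeasure (\<omega> :: (real^'n) measure) (sphere 0 1) =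
      ennreal (real CARD('n)) * ennreal (unit_ball_vol (CARD('n)))"
    by (subst emeasure_sphere_measure)
      (auto simp: sets_sphere_measure sets_restrict_space ennreal_of_nat_eq_real_of_nat emeasure_cball)
  also have "\<dots> = ennreal (CARD('n) * unit_ball_vol (CARD('n)))"
    by (simp add: ennreal_mult' [symmetric])
  finally have "measure (\<omega> :: (real^'n) measure) (sphere 0 1) = CARD('n) * unit_ball_vol (CARD('n))"
    by (simp add: measure_def)
  also have "\<dots> = 2 * pi powr (CARD('n) / 2) / Gamma (CARD('n) / 2)"
  proof -
    have "Gamma (real CARD('n) / 2 + 1) = real CARD('n) / 2 * Gamma (CARD('n) / 2)"
      by (intro Gamma_plus1) auto
    then show ?thesis unfolding unit_ball_vol_def by (simp only:) simp
  qed
  finally show ?thesis .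
qed

text \<open>Chi-square moments. Writing one factor \<open>x \<bullet> x\<close> in coordinates and
  integrating by parts contributes \<open>d + 2 * n\<close>, twice the next Pochhammer
  factor.\<close>

lemma gauss_norm_moment:
  "(EG x. complex_of_real (((x::real^'n) \<bullet> x) ^ n)) =
    of_real (2 ^ n * pochhammer (CARD('n) / 2) n)"
proof (induction n)
  case 0
  have "(EG x. (1 * complex_of_real (mon (\<lambda>_::'n. 0) x))) = 1"
    by (subst integral_gauss_mon_complex) simp
  then show ?case by (simp add: mon_def)
next
  case (Suc n)
  let ?q = "\<lambda>x::real^'n. complex_of_real ((x \<bullet> x) ^ n)"
  have q: "hom_poly (2 * n) ?q"
    using hom_poly_power[OF hom_poly_inner_self, of n] by simp
  have xq: "hom_poly (1 + 2 * n) (\<lambda>x. of_real (x $ i) * ?q x)" for i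
    by (intro hom_poly_mult[OF hom_poly_coord] q)
  have xxq: "hom_poly (1 + (1 + 2 * n)) (\<lambda>x. of_real (x $ i) * (of_real (x $ i) * ?q x))" for i
    by (intro hom_poly_mult[OF hom_poly_coord] xq)
  have dq: "hom_poly (1 + 2 * n - 1) (partial_deriv i (\<lambda>x. of_real (x $ i) * ?q x))" for i
    using xq by (rule hom_poly_partial_deriv)
  have pd: "partial_deriv i (\<lambda>x. of_real (x $ i) * ?q x) =
      (\<lambda>x. 1 * ?q x + of_real (x $ i) * of_real (real n * (2 * x $ i) * (x \<bullet> x) ^ (n - 1)))" for i
  proof (intro has_pd_imp_eq has_pd_mult has_pd_of_real)
    have "has_pd i (\<lambda>x. complex_of_real (x $ i)) (\<lambda>x. of_real 1)"
      by (rule has_pd_of_real) (auto intro!: derivative_eq_intros)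
    then show "has_pd i (\<lambda>x. complex_of_real (x $ i)) (\<lambda>x. 1)" by simp
    show "((\<lambda>t. ((x + t *\<^sub>R axis i 1) \<bullet> (x + t *\<^sub>R axis i 1)) ^ n) has_real_derivative
        real n * (2 * x $ i) * (x \<bullet> x) ^ (n - 1)) (at 0)" for x :: "real^'n"
      by (auto intro!: derivative_eq_intros simp: inner_add_left inner_add_right inner_axis inner_axis')
  qed
  have "(EG x. complex_of_real (((x::real^'n) \<bullet> x) ^ Suc n)) =
      (EG x. (\<Sum>i\<in>UNIV. 1 * (of_real (x $ i) * (of_real (x $ i) * ?q x))))"
    by (intro LINT_cong refl)
      (simp add: inner_vec_def sum_distrib_right mult.assoc)
  also have "\<dots> = (\<Sum>i\<in>UNIV. 1 * (EG x. (of_real (x $ i) * (of_real (x $ i) * ?q x))))"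
    by (rule integral_gauss_cmult_sum[OF xxq])
  also have "\<dots> = (\<Sum>i\<in>UNIV. 1 * (EG x. partial_deriv i (\<lambda>x. of_real (x $ i) * ?q x) x))"
    by (simp only: gauss_integration_by_parts[OF xq])
  also have "\<dots> = (EG x. (\<Sum>i\<in>UNIV. 1 * partial_deriv i (\<lambda>x. of_real (x $ i) * ?q x) x))"
    by (rule integral_gauss_cmult_sum[OF dq, symmetric])
  also have "\<dots> = (LINT x|lborel. of_real (CARD('n) + 2 * n) * (of_real (gauss x) * ?q x))"
  proof (intro LINT_cong refl)
    fix x :: "real^'n"
    have "(\<Sum>i\<in>UNIV. 1 * partial_deriv i (\<lambda>x. of_real (x $ i) * ?q x) x) =
        of_real (\<Sum>i\<in>UNIV. (x \<bullet> x) ^ n + (x $ i * x $ i) * (2 * real n * (x \<bullet> x) ^ (n - 1)))"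
      unfolding pd by (simp add: ac_simps)
    also have "(\<Sum>i\<in>UNIV. (x \<bullet> x) ^ n + (x $ i * x $ i) * (2 * real n * (x \<bullet> x) ^ (n - 1))) =
        CARD('n) * (x \<bullet> x) ^ n + (x \<bullet> x) * (2 * real n * (x \<bullet> x) ^ (n - 1))"
      by (simp add: sum.distrib inner_vec_def sum_distrib_right)
    also have "\<dots> = (CARD('n) + 2 * n) * (x \<bullet> x) ^ n"
      by (cases n) (simp_all add: algebra_simps)
    finally show "of_real (gauss x) * (\<Sum>i\<in>UNIV. 1 * partial_deriv i (\<lambda>x. of_real (x $ i) * ?q x) x) =
       of_real (CARD('n) + 2 * n) * (of_real (gauss x) * ?q x)" by simp
  qed
  also have "\<dots> = of_real (CARD('n) + 2 * n) * of_real (2 ^ n * pochhammer (CARD('n) / 2) n)"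
    by (simp only: integral_mult_right_zero Suc.IH)
  also have "\<dots> = of_real (2 ^ Suc n * pochhammer (CARD('n) / 2) (Suc n))"
    unfolding of_real_mult[symmetric] of_real_eq_iff by (simp add: pochhammer_Suc algebra_simps)
  finally show ?case .
qed

text \<open>Polar coordinates for \<open>(x \<bullet> x) ^ n\<close>, which is 1 on the sphere, so
  that its spherical integral is the total mass.\<close>

lemma radial_gauss_even:
  "radial_gauss CARD('n::finite) (2 * n) * measure (\<omega> :: (real^'n) measure) (sphere 0 1) =
    2 ^ n * pochhammer (CARD('n) / 2) n"
proof -
  let ?q = "\<lambda>x::real^'n. complex_of_real ((x \<bullet> x) ^ n)"
  have q: "hom_poly (2 * n) ?q"
    using hom_poly_power[OF hom_poly_inner_self, of n] by simp
  have "(SI v. ?q v) = (LINT v|(\<omega> :: (real^'n) measure). 1)"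
    by (intro LINT_cong) (auto simp: dot_square_norm)
  also have "\<dots> = of_real (measure (\<omega> :: (real^'n) measure) (sphere 0 1))"
    by (simp add: scaleR_conv_of_real)
  finally have "complex_of_real (2 ^ n * pochhammer (CARD('n) / 2) n) =
     of_real (radial_gauss CARD('n) (2 * n) * measure (\<omega> :: (real^'n) measure) (sphere 0 1))"
    using gauss_polar[OF q] unfolding gauss_norm_moment by simp
  then show ?thesis unfolding of_real_eq_iff by simp
qed

text \<open>Allows division by the radial factor for odd exponents, where its value is not
  known.\<close>

lemma radial_gauss_pos: "radial_gauss CARD('n::finite) m > 0"
proof -
  let ?d = "CARD('n)"
  let ?\<phi> = "\<lambda>r. exp (- r\<^sup>2 / 2) / (2 * pi) powr (?d / 2) * r ^ m"
  let ?\<psi> = "\<lambda>r. (indicator {0<..} r * r ^ (?d - 1)) *\<^sub>R ?\<phi> r"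
  have eq: "radial_gauss ?d m = (LINT r|lborel. ?\<psi> r)"
    unfolding radial_gauss_def radial_measure_def
    by (subst integral_density) (auto intro!: AE_I2 simp: indicator_def)
  \<comment> \<open>A lower bound for the radial integrand on \<open>{1..2}\<close>: there the
    Gaussian exponent is at least \<open>- 2\<close> and the powers of \<open>r\<close> are at least
    1.\<close>
  define c where "c = exp (- 2) / (2 * pi) powr (?d / 2)"
  have c: "c > 0" by (simp add: c_def)
  have int: "integrable lborel ?\<psi>"
  proof (rule LINT_integrable_bound)
    show "integrable lborel (\<lambda>r. (sqrt (2 * pi) / (2 * pi) powr (?d / 2)) * (std_normal_density r * \<bar>r\<bar> ^ (?d - 1 + m)))"
      by (intro integrable_mult_right integrable_std_normal_moment_abs)
    show "AE r in lborel. norm (?\<psi> r) \<le> norm ((sqrt (2 * pi) / (2 * pi) powr (?d / 2)) * (std_normal_density r * \<bar>r\<bar> ^ (?d - 1 + m)))"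
      unfolding power_add
      by (auto simp: std_normal_density_def abs_mult indicator_def power_abs ac_simps intro!: AE_I2)
  qed measurable
  note c
  also have "c = (LINT r|lborel. indicator {1..2::real} r *\<^sub>R c)" by simp
  also have "\<dots> \<le> (LINT r|lborel. ?\<psi> r)"
  proof (rule integral_mono[OF _ int])
    show "indicator {1..2::real} r *\<^sub>R c \<le> ?\<psi> r" for r
    proof (cases "r \<in> {1..2}")
      case True
      then have "r\<^sup>2 \<le> 2\<^sup>2" by (intro power_mono) auto
      then have "c \<le> exp (- r\<^sup>2 / 2) / (2 * pi) powr (?d / 2)"
        unfolding c_def by (intro divide_right_mono) auto
      moreover have "1 \<le> r ^ (?d - 1)" "1 \<le> r ^ m" using True by (auto intro: one_le_power)
      ultimately have "1 * (c * 1) \<le> r ^ (?d - 1) * (exp (- r\<^sup>2 / 2) / (2 * pi) powr (?d / 2) * r ^ m)"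
        using c by (intro mult_mono) auto
      then show ?thesis using True by simp
    qed (auto simp: indicator_def)
  qed simp
  finally show ?thesis by (simp add: eq)
qed

section \<open>The Funk-Hecke formula for monomials\<close>

lemma w_coef_nat:
  assumes "even (m + j)"
  shows "w_coef d j (real m) =
    (if j \<le> m then fact m * pi powr (d / 2) * rGamma ((real j + m + d) / 2) / (fact ((m - j) div 2) * 2 powr (real m - 1)) else 0)"
proof (cases "j \<le> m")
  case True
  with assms have "\<exists>k. m = j + 2 * k" by presburger
  then obtain k where k: "m = j + 2 * k" by blast
  have "(real m - real j) / 2 + 1 = 1 + of_nat k" using k by simp
  then have "rGamma ((real m - real j) / 2 + 1) = 1 / fact k"
    by (simp only: rGamma_inverse_Gamma Gamma_fact inverse_eq_divide)
  moreover have "Gamma (real m + 1) = fact m" by (simp add: Gamma_fact add.commute)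
  ultimately show ?thesis using True k unfolding w_coef_def by simp
next
  case False
  with assms have "\<exists>k. j = m + 2 * Suc k" by presburger
  then obtain k where k: "j = m + 2 * Suc k" by blast
  \<comment> \<open>A nonpositive integer argument is a zero of the reciprocal Gamma function; this
    is why low powers are orthogonal to harmonics of higher degree.\<close>
  have "(real m - real j) / 2 + 1 = - of_nat k" using k by (simp add: field_simps)
  then have "rGamma ((real m - real j) / 2 + 1) = 0" by (simp only: rGamma_eq_zero_iff) simp
  then show ?thesis using False unfolding w_coef_def by simp
qed

text \<open>The Funk-Hecke coefficient of \<open>t ^ m\<close>. The case distinction is essential:
  for odd \<open>m + j\<close> the integral vanishes by parity although \<open>w_coef\<close> need
  not.\<close>

definition mcoef :: "nat \<Rightarrow> nat \<Rightarrow> nat \<Rightarrow> real" where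
  "mcoef d m j = (if even (m + j) then w_coef d j (real m) else 0)"

text \<open>The bookkeeping that turns Gaussian into spherical coefficients: the total mass of the
  sphere stands on the left, the norm moment of order \<open>m + j\<close> on the right. With
  \<open>m = j + 2 * k\<close> and \<open>n = j + k\<close>, the power \<open>2 ^ m\<close> splits
  as \<open>2 ^ k * 2 ^ n\<close> and \<open>Gamma (d / 2 + n)\<close> yields the Pochhammer symbol.
  In the remaining cases both sides are 0.\<close>

lemma mcoef_eq:
  assumes "d > 0"
  shows "gcoef m j * (2 * pi powr (d / 2) / Gamma (d / 2)) = mcoef d m j * (if even (m + j) then 2 ^ ((m + j) div 2) * pochhammer (d / 2) ((m + j) div 2) else 1)"
proof (cases "j \<le> m \<and> even (m - j)")
  case True
  then have "\<exists>k. m = j + 2 * k" by presburger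
  then obtain k where k: "m = j + 2 * k" by blast
  let ?n = "j + k"
  have n: "(m + j) div 2 = ?n" "even (m + j)" "(m - j) div 2 = k" "j \<le> m" by (simp_all add: k)
  have Gp: "Gamma (real d / 2) > 0" "pochhammer (real d / 2) ?n > 0"
    using assms by (auto intro!: Gamma_real_pos pochhammer_pos)
  have "real d / 2 \<notin> \<int>\<^sub>\<le>\<^sub>0" using assms nonpos_Ints_nonpos[of "real d / 2"] by auto
  from pochhammer_Gamma[OF this, of ?n]
  have G: "Gamma (real d / 2 + of_nat ?n) = pochhammer (d / 2) ?n * Gamma (d / 2)"
    using Gp by simp
  have e: "(real j + real m + real d) / 2 = real d / 2 + of_nat ?n" by (simp add: k field_simps)
  have p: "2 powr (real m - 1) * 2 = 2 ^ k * 2 ^ (?n)"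
  proof -
    have "2 powr (real m - 1) * 2 = 2 powr (real m)" by (simp add: powr_diff)
    also have "\<dots> = 2 ^ m" by (rule powr_realpow) simp
    also have "(2::real) ^ m = 2 ^ k * 2 ^ ?n" unfolding k by (simp add: power_add mult_2)
    finally show ?thesis .
  qed
  have "mcoef d m j = fact m * pi powr (d / 2) * rGamma ((real j + m + d) / 2) / (fact k * 2 powr (real m - 1))"
    using n(2,3,4) by (simp only: mcoef_def w_coef_nat if_True)
  also have "\<dots> = fact m * pi powr (d / 2) / (pochhammer (d / 2) ?n * Gamma (d / 2)) / (fact k * 2 powr (real m - 1))"
    unfolding e rGamma_inverse_Gamma G by (simp only: divide_inverse)
  finally have "mcoef d m j = fact m * pi powr (d / 2) / (pochhammer (d / 2) ?n * Gamma (d / 2)) / (fact k * (2 ^ k * 2 ^ ?n / 2))"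
    unfolding p[symmetric] by simp
  moreover have "gcoef m j = fact m / (2 ^ k * fact k)" using True by (simp only: gcoef_def n if_True simp_thms)
  moreover have "A / (a * K) * (2 * B / g) = A * B / (p * g) / (K * (a * b / 2)) * (b * p)"
    if "a > 0" "b > 0" "g > 0" "p > 0" "K > 0" for A B K a b g p :: real
    using that by (simp add: ac_simps)
  ultimately show ?thesis using Gp by (simp only: n if_True) (auto intro!: fact_gt_zero)
next
  case False
  then have "gcoef m j = 0" by (auto simp: gcoef_def)
  moreover have "mcoef d m j = 0"
    using False by (auto simp: mcoef_def w_coef_nat)
  ultimately show ?thesis by simp
qed

text \<open>The Gaussian moment divided by its radial factor. For even \<open>m + j\<close> that
  factor is known up to the mass of the sphere; for odd \<open>m + j\<close> the Gaussian moment is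
  0 and positivity of the factor makes the spherical integral vanish.\<close>

theorem sphere_harmonic_moment:
  fixes h :: "real^'n \<Rightarrow> complex"
  assumes h: "hom_poly j h" "harmonic h" and y: "norm y = 1"
  shows "(SI v. h v * of_real ((y \<bullet> v) ^ m)) = of_real (mcoef CARD('n) m j) * h y"
proof -
  let ?d = "CARD('n)" and ?W = "measure (\<omega> :: (real^'n) measure) (sphere 0 1)"
  let ?I = "LINT v|\<omega>. h v * of_real ((y \<bullet> v) ^ m)"
  have F: "hom_poly (j + m) (\<lambda>x. h x * of_real ((y \<bullet> x) ^ m))"
    using hom_poly_mult[OF h(1) hom_poly_power[OF hom_poly_inner[of y], of m]] by simp
  have K: "of_real (gcoef m j) * h y = of_real (radial_gauss ?d (j + m)) * ?I"
    using gauss_harmonic_moment[OF h, of y m] gauss_polar[OF F] y by simp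
  have W: "?W = 2 * pi powr (?d / 2) / Gamma (?d / 2)" by (rule measure_sphere)
  have Wp: "?W > 0" unfolding W by (auto intro!: divide_pos_pos Gamma_real_pos)
  show ?thesis
  proof (cases "even (m + j)")
    case True
    then obtain n where n: "m + j = 2 * n" by (elim evenE)
    have R: "radial_gauss ?d (j + m) * ?W = 2 ^ n * pochhammer (?d / 2) n"
      using radial_gauss_even[where 'n='n, of n] n by (simp add: add.commute)
    have p: "2 ^ n * pochhammer (real ?d / 2) n > 0" by (intro mult_pos_pos pochhammer_pos) auto
    have "complex_of_real (2 ^ n * pochhammer (?d / 2) n) * ?I = of_real (gcoef m j * ?W) * h y"
      unfolding R[symmetric] using K by (simp add: ac_simps)
    also have "gcoef m j * ?W = 2 ^ n * pochhammer (?d / 2) n * mcoef ?d m j"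
      using mcoef_eq[of ?d m j] True n unfolding W by (simp add: ac_simps)
    finally show ?thesis using p by (auto simp: mult.assoc)
  next
    case False
    then have "gcoef m j = 0" "mcoef ?d m j = 0" by (auto simp: gcoef_def mcoef_def)
    then show ?thesis using K radial_gauss_pos[where 'n='n, of "j + m"] by simp
  qed
qed

section \<open>Zonal harmonics\<close>

text \<open>Up to normalisation these are the Gegenbauer coefficients: the recursion makes \<open>zonal\<close> harmonic, and the
  leading coefficient makes it reproducing.\<close>

primrec zcoef :: "nat \<Rightarrow> nat \<Rightarrow> nat \<Rightarrow> real" where
  "zcoef d j 0 = 1 / w_coef d j (real j)"
| "zcoef d j (Suc k) = - zcoef d j k * (real j - 2 * real k) * (real j - 2 * real k - 1) /
     (2 * (real k + 1) * (2 * real j - 2 * real k - 4 + real d))"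

text \<open>The powers of \<open>x \<bullet> x\<close> and \<open>y \<bullet> y\<close> make this
  homogeneous of degree \<open>j\<close> in each argument, a polynomial extension of
  \<open>zpoly\<close> off the sphere.\<close>

definition zonal :: "nat \<Rightarrow> real^'n \<Rightarrow> real^'n \<Rightarrow> real" where
  "zonal j x y = (\<Sum>k\<le>j div 2. zcoef CARD('n) j k * (y \<bullet> y) ^ k * ((y \<bullet> x) ^ (j - 2 * k) * (x \<bullet> x) ^ k))"

definition zpoly :: "nat \<Rightarrow> nat \<Rightarrow> real \<Rightarrow> real" where
  "zpoly d j t = (\<Sum>k\<le>j div 2. zcoef d j k * t ^ (j - 2 * k))"

lemma zonal_sphere: "norm x = 1 \<Longrightarrow> norm y = 1 \<Longrightarrow> zonal j x (y :: real^'n) = zpoly CARD('n) j (x \<bullet> y)"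
  by (simp add: zonal_def zpoly_def dot_square_norm inner_commute)

text \<open>The truncated exponents \<open>m - 2\<close> and \<open>k - 1\<close> are harmless:
  whenever truncation occurs, the factor \<open>m * (m - 1)\<close> or \<open>k\<close> is
  0.\<close>

lemma laplacian_inner_norm:
  fixes y :: "real^'n"
  defines "T \<equiv> \<lambda>m k x. (y \<bullet> x) ^ m * (x \<bullet> x) ^ k"
  shows "laplacian (\<lambda>x. of_real (T m k x)) x =
    of_real (real m * (real m - 1) * (y \<bullet> y) * T (m - 2) k x + 2 * real k * (2 * real m + CARD('n) + 2 * real k - 2) * T m (k - 1) x)"
proof -
  have d1: "((\<lambda>t. (y \<bullet> (x + t *\<^sub>R axis i 1)) ^ m) has_real_derivative real m * y $ i * (y \<bullet> x) ^ (m - 1)) (at 0)" for m x i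
    by (auto intro!: derivative_eq_intros simp: inner_add_right inner_axis)
  have d2: "((\<lambda>t. ((x + t *\<^sub>R axis i 1) \<bullet> (x + t *\<^sub>R axis i 1)) ^ k) has_real_derivative
        real k * (2 * x $ i) * (x \<bullet> x) ^ (k - 1)) (at 0)" for x :: "real^'n" and k i
      by (auto intro!: derivative_eq_intros simp: inner_add_left inner_add_right inner_axis inner_axis')
  have d3: "((\<lambda>t. (x + t *\<^sub>R axis i 1) $ i) has_real_derivative 1) (at 0)" for x :: "real^'n" and i
    by (auto intro!: derivative_eq_intros)
  let ?D = "\<lambda>i x. real m * y $ i * T (m - 1) k x + 2 * real k * (x $ i * T m (k - 1) x)"
  let ?E = "\<lambda>i x. real m * y $ i * (real (m - 1) * y $ i * T (m - 1 - 1) k x + real k * (2 * x $ i) * T (m - 1) (k - 1) x)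
     + 2 * real k * (T m (k - 1) x + x $ i * (real m * y $ i * T (m - 1) (k - 1) x + real (k - 1) * (2 * x $ i) * T m (k - 1 - 1) x))"
  have T': "((\<lambda>t. T m k (x + t *\<^sub>R axis i 1)) has_real_derivative
      real m * y $ i * T (m - 1) k x + real k * (2 * x $ i) * T m (k - 1) x) (at 0)" for x m k i
    unfolding T_def using DERIV_mult[OF d1[of x i m] d2[of x i k]] by (simp add: algebra_simps)
  have p1: "partial_deriv i (\<lambda>x. complex_of_real (T m k x)) = (\<lambda>x. of_real (?D i x))" for i
    by (intro has_pd_imp_eq has_pd_of_real) (rule DERIV_cong[OF T'], simp)
  have p2: "partial_deriv i (\<lambda>x. complex_of_real (?D i x)) = (\<lambda>x. of_real (?E i x))" for i
    by (intro has_pd_imp_eq has_pd_of_real DERIV_add DERIV_cmult, rule T',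
        rule DERIV_cong[OF DERIV_mult[OF d3 T']], simp add: algebra_simps)
  have "laplacian (\<lambda>x. of_real (T m k x)) x = of_real (\<Sum>i\<in>UNIV. ?E i x)"
    unfolding laplacian_def p1 p2 by simp
  also have "(\<Sum>i\<in>UNIV. ?E i x) = (\<Sum>i\<in>UNIV. (y $ i * y $ i) * (real m * real (m - 1) * T (m - 1 - 1) k x)
     + (y $ i * x $ i) * (4 * real k * real m * T (m - 1) (k - 1) x) + 2 * real k * T m (k - 1) x
     + (x $ i * x $ i) * (4 * real k * real (k - 1) * T m (k - 1 - 1) x))"
    by (intro sum.cong refl) (simp add: algebra_simps)
  also have "\<dots> = (y \<bullet> y) * (real m * real (m - 1) * T (m - 1 - 1) k x)
     + (y \<bullet> x) * (4 * real k * real m * T (m - 1) (k - 1) x) + CARD('n) * (2 * real k * T m (k - 1) x)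
     + (x \<bullet> x) * (4 * real k * real (k - 1) * T m (k - 1 - 1) x)"
    by (simp add: sum.distrib inner_vec_def sum_distrib_right)
  also have "(y \<bullet> x) * (4 * real k * real m * T (m - 1) (k - 1) x) = 4 * real k * real m * T m (k - 1) x"
    by (cases m) (simp_all add: T_def)
  also have "(x \<bullet> x) * (4 * real k * real (k - 1) * T m (k - 1 - 1) x) = 4 * real k * (real k - 1) * T m (k - 1) x"
  proof (cases k)
    case (Suc l) then show ?thesis by (cases l) (simp_all add: T_def)
  qed simp
  also have "real m * real (m - 1) = real m * (real m - 1)" by (cases m) simp_all
  finally show ?thesis by (simp add: algebra_simps numeral_2_eq_2)
qed

lemma hom_poly_inner_norm: "hom_poly (m + 2 * k) (\<lambda>x. of_real ((y \<bullet> x) ^ m * (x \<bullet> x) ^ k))"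
  using hom_poly_mult[OF hom_poly_power[OF hom_poly_inner[of y], of m] hom_poly_power[OF hom_poly_inner_self, of k]]
  by simp

lemma laplacian_cmult_sum:
  assumes "\<And>i. i \<in> I \<Longrightarrow> hom_poly j (f i)"
  shows "laplacian (\<lambda>x. \<Sum>i\<in>I. c i * f i x) x = (\<Sum>i\<in>I. c i * laplacian (f i) x)"
proof -
  have p: "hom_poly (j - 1) (partial_deriv l (f i))" if "i \<in> I" for i l using assms[OF that] by (rule hom_poly_partial_deriv)
  have "partial_deriv l (\<lambda>x. \<Sum>i\<in>I. c i * f i x) = (\<lambda>x. \<Sum>i\<in>I. c i * partial_deriv l (f i) x)" for l
    by (subst partial_deriv_sum[OF hom_poly_cmult[OF assms]]) (auto simp: partial_deriv_cmult[OF assms])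
  moreover have "partial_deriv l (\<lambda>x. \<Sum>i\<in>I. c i * partial_deriv l (f i) x) =
      (\<lambda>x. \<Sum>i\<in>I. c i * partial_deriv l (partial_deriv l (f i)) x)" for l
    by (subst partial_deriv_sum[OF hom_poly_cmult[OF p]]) (auto simp: partial_deriv_cmult[OF p])
  ultimately show ?thesis
    unfolding laplacian_def by (simp add: sum_distrib_left) (rule sum.swap)
qed

text \<open>The Laplacian of the term with index \<open>k\<close> has two parts, and the recursion
  of \<open>zcoef\<close> makes the second cancel the first part \<open>A (k - 1)\<close> of its
  predecessor. The sum telescopes to its last part.\<close>

lemma zonal_sph_harm:
  fixes y :: "real^'n"
  assumes d: "CARD('n) \<ge> 2"
  shows "(\<lambda>x. complex_of_real (zonal j x y)) \<in> sph_harm j"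
proof -
  let ?c = "zcoef CARD('n) j"
  let ?T = "\<lambda>k x. (y \<bullet> x) ^ (j - 2 * k) * (x \<bullet> x) ^ k"
  have T: "hom_poly j (\<lambda>x. complex_of_real (?T k x))" if "k \<in> {..j div 2}" for k
    using hom_poly_inner_norm[of "j - 2 * k" k y] that by simp
  have eq: "(\<lambda>x. complex_of_real (zonal j x y)) = (\<lambda>x. \<Sum>k\<le>j div 2. of_real (?c k * (y \<bullet> y) ^ k) * of_real (?T k x))"
    by (simp add: zonal_def)
  define A where "A k x = ?c k * (real j - 2 * real k) * (real j - 2 * real k - 1) * (y \<bullet> y) ^ Suc k * ((y \<bullet> x) ^ (j - 2 * k - 2) * (x \<bullet> x) ^ k)" for k x
  have L: "of_real (?c k * (y \<bullet> y) ^ k) * laplacian (\<lambda>x. of_real (?T k x)) x =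
     complex_of_real (A k x - (if k = 0 then 0 else A (k - 1) x))" if k: "k \<le> j div 2" for k x
  proof (cases k)
    case 0
    then show ?thesis using laplacian_inner_norm[of y j 0 x] by (simp add: A_def algebra_simps)
  next
    case (Suc l)
    \<comment> \<open>From \<open>2 * (l + 1) \<le> j\<close> the denominator in the recursion is at
      least \<open>j - 2 + d\<close>, hence positive.\<close>
    have D: "2 * real j - 2 * real l - 4 + real CARD('n) > 0" using k Suc d by linarith
    have r: "real (j - 2 * k) = real j - 2 * real k" using k by (simp add: of_nat_diff)
    have e: "j - 2 * l - 2 = j - 2 * k" using Suc by simp
    have "?c k * (2 * real k * (2 * real (j - 2 * k) + CARD('n) + 2 * real k - 2)) =
       - ?c l * (real j - 2 * real l) * (real j - 2 * real l - 1)"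
    proof -
      have "2 * real k * (2 * real (j - 2 * k) + CARD('n) + 2 * real k - 2) = 2 * (real l + 1) * (2 * real j - 2 * real l - 4 + CARD('n))"
        unfolding r by (simp add: Suc algebra_simps)
      moreover have "2 * (real l + 1) * (2 * real j - 2 * real l - 4 + CARD('n)) \<noteq> 0" using D by simp
      ultimately show ?thesis unfolding Suc zcoef.simps by simp
    qed
    then have "(?c k * (2 * real k * (2 * real (j - 2 * k) + CARD('n) + 2 * real k - 2))) * ((y \<bullet> y) ^ k * ((y \<bullet> x) ^ (j - 2 * k) * (x \<bullet> x) ^ (k - 1)))
      = - A l x"
      unfolding A_def e by (simp add: Suc)
    then have "?c k * (y \<bullet> y) ^ k * (real (j - 2 * k) * (real (j - 2 * k) - 1) * (y \<bullet> y) * ((y \<bullet> x) ^ (j - 2 * k - 2) * (x \<bullet> x) ^ k) +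
        2 * real k * (2 * real (j - 2 * k) + CARD('n) + 2 * real k - 2) * ((y \<bullet> x) ^ (j - 2 * k) * (x \<bullet> x) ^ (k - 1))) = A k x - A l x"
      unfolding A_def[of k] r by (simp add: algebra_simps)
    then show ?thesis unfolding laplacian_inner_norm of_real_mult[symmetric] of_real_eq_iff using Suc by simp
  qed
  have tele: "(\<Sum>k\<le>n. A k x - (if k = 0 then 0 else A (k - 1) x)) = A n x" for n x
    by (induction n) auto
  have "laplacian (\<lambda>x. complex_of_real (zonal j x y)) x = 0" for x
  proof -
    have "laplacian (\<lambda>x. complex_of_real (zonal j x y)) x =
        (\<Sum>k\<le>j div 2. of_real (?c k * (y \<bullet> y) ^ k) * laplacian (\<lambda>x. of_real (?T k x)) x)"
      unfolding eq by (rule laplacian_cmult_sum[OF T])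
    also have "\<dots> = (\<Sum>k\<le>j div 2. complex_of_real (A k x - (if k = 0 then 0 else A (k - 1) x)))"
      by (intro sum.cong refl L) auto
    also have "\<dots> = of_real (A (j div 2) x)" unfolding of_real_sum[symmetric] tele ..
    \<comment> \<open>At the last index the exponent \<open>j - 2 * k\<close> is 0 or 1, and two
      derivatives annihilate the power.\<close>
    also have "A (j div 2) x = 0"
    proof -
      have "j = 2 * (j div 2) \<or> j = 2 * (j div 2) + 1" by presburger
      then have "real j - 2 * real (j div 2) = 0 \<or> real j - 2 * real (j div 2) - 1 = 0" by linarith
      then show ?thesis unfolding A_def by auto
    qed
    finally show ?thesis by simp
  qed
  moreover have "hom_poly j (\<lambda>x. complex_of_real (zonal j x y))"
    unfolding eq by (intro hom_poly_sum hom_poly_cmult T)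
  ultimately show ?thesis by (simp add: sph_harm_def harmonic_def)
qed

lemma w_coef_diag_pos: "d > 0 \<Longrightarrow> w_coef d j (real j) > 0"
  unfolding w_coef_def rGamma_inverse_Gamma
  by (intro divide_pos_pos mult_pos_pos) (auto intro!: Gamma_real_pos)

lemma mcoef_eq_0: "m < j \<Longrightarrow> mcoef d m j = 0"
  by (auto simp: mcoef_def w_coef_nat)

lemma integrable_sphere_hom_poly: "hom_poly j h \<Longrightarrow> integrable \<omega> h"
  by (intro integrable_sphere_continuous hom_poly_continuous)

lemma integrable_sphere_harmonic_poly:
  assumes "hom_poly j h"
  shows "integrable \<omega> (\<lambda>v. h v * complex_of_real ((y \<bullet> v) ^ m))"
  using hom_poly_mult[OF assms hom_poly_power[OF hom_poly_inner[of y], of m]]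
  by (intro integrable_sphere_hom_poly) simp

text \<open>Orthogonality and the reproducing property at once: powers below \<open>j\<close>
  integrate to 0 against \<open>h\<close>, so only the leading power for \<open>i = j\<close>
  survives, and its coefficient was chosen as the reciprocal of the Funk-Hecke coefficient.\<close>

lemma sphere_zpoly_harmonic:
  fixes h :: "real^'n \<Rightarrow> complex"
  assumes h: "h \<in> sph_harm j" and u: "norm u = 1" and ij: "i \<le> j"
  shows "(SI v. h v * of_real (zpoly CARD('n) i (u \<bullet> v))) = (if i = j then h u else 0)"
proof -
  let ?d = "CARD('n)"
  have h': "hom_poly j h" "harmonic h" using h by (auto simp: sph_harm_def)
  have "(SI v. h v * of_real (zpoly ?d i (u \<bullet> v))) =
      (SI v. (\<Sum>k\<le>i div 2. of_real (zcoef ?d i k) * (h v * of_real ((u \<bullet> v) ^ (i - 2 * k)))))"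
    unfolding zpoly_def by (simp add: sum_distrib_left ac_simps)
  also have "\<dots> = (\<Sum>k\<le>i div 2. of_real (zcoef ?d i k) * (SI v. h v * of_real ((u \<bullet> v) ^ (i - 2 * k))))"
    by (subst LINT_sum[OF integrable_mult_right[OF integrable_sphere_harmonic_poly[OF h'(1)]]])
       (simp only: integral_mult_right_zero)
  also have "\<dots> = (\<Sum>k\<le>i div 2. of_real (zcoef ?d i k) * (of_real (mcoef ?d (i - 2 * k) j) * h u))"
    by (simp only: sphere_harmonic_moment[OF h' u])
  also have "\<dots> = (\<Sum>k\<in>{0}. of_real (zcoef ?d i k) * (of_real (mcoef ?d (i - 2 * k) j) * h u))"
  proof (rule sum.mono_neutral_right)
    show "\<forall>k\<in>{..i div 2} - {0}. complex_of_real (zcoef ?d i k) * (of_real (mcoef ?d (i - 2 * k) j) * h u) = 0"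
      using ij by (auto simp: mcoef_eq_0)
  qed auto
  also have "\<dots> = (if i = j then h u else 0)"
  proof (cases "i = j")
    case True
    have "w_coef ?d j (real j) \<noteq> 0" using w_coef_diag_pos[of ?d j] by simp
    then show ?thesis using True by (simp add: mcoef_def)
  next
    case False
    then show ?thesis using ij by (simp add: mcoef_eq_0)
  qed
  finally show ?thesis .
qed

text \<open>One of the two factors is read as the harmonic polynomial \<open>zonal j v u\<close>,
  the other as the reproducing kernel. The squared norm is therefore the value at
  \<open>v = u\<close>.\<close>

lemma zpoly_orthogonal:
  fixes u :: "real^'n"
  assumes d: "CARD('n) \<ge> 2" and u: "norm u = 1"
  shows "(SI v. zpoly CARD('n) i (u \<bullet> v) * zpoly CARD('n) j (u \<bullet> v)) =
    (if i = j then zpoly CARD('n) j 1 else 0)"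
proof -
  let ?z = "zpoly CARD('n)"
  have *: "(SI v. ?z i (u \<bullet> v) * ?z j (u \<bullet> v)) = (if i = j then ?z j 1 else 0)" if "i \<le> j" for i j
  proof -
    have "complex_of_real (SI v. ?z i (u \<bullet> v) * ?z j (u \<bullet> v)) =
        (SI v. complex_of_real (?z i (u \<bullet> v) * ?z j (u \<bullet> v)))"
      by (rule integral_complex_of_real[symmetric])
    also have "\<dots> = (SI v. of_real (zonal j v u) * of_real (?z i (u \<bullet> v)))"
      using u by (intro LINT_cong) (auto simp: zonal_sphere inner_commute)
    also have "\<dots> = (if i = j then of_real (zonal j u u) else 0)"
      by (rule sphere_zpoly_harmonic[OF zonal_sph_harm[OF d] u that])
    also have "zonal j u u = ?z j 1" using u by (simp add: zonal_sphere dot_square_norm)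
    finally have "complex_of_real (SI v. ?z i (u \<bullet> v) * ?z j (u \<bullet> v)) =
        of_real (if i = j then ?z j 1 else 0)" by simp
    then show ?thesis unfolding of_real_eq_iff .
  qed
  show ?thesis
  proof (cases "i \<le> j")
    case False
    then show ?thesis using *[of j i] by (auto simp: mult.commute)
  qed (rule *)
qed

section \<open>The projection as an integral operator\<close>

text \<open>Polynomials in \<open>x\<close>, homogeneous of degree \<open>j\<close>, whose coefficients are continuous functions of \<open>v\<close>.
  On these, integration over \<open>v\<close> commutes with derivatives in \<open>x\<close> by linearity alone.\<close>

inductive kpoly :: "nat \<Rightarrow> (real^'n \<Rightarrow> real^'n \<Rightarrow> complex) \<Rightarrow> bool" where
  mon: "continuous_on UNIV c \<Longrightarrow> sum k UNIV = j \<Longrightarrow> kpoly j (\<lambda>x v. c v * of_real (mon k x))"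
| add: "kpoly j Q \<Longrightarrow> kpoly j R \<Longrightarrow> kpoly j (\<lambda>x v. Q x v + R x v)"

lemma kpoly_zero: "kpoly j (\<lambda>(x :: real^'n) v. 0)"
proof -
  obtain i0 :: 'n where True by simp
  show ?thesis using kpoly.mon[of "\<lambda>_. 0" "\<lambda>i. if i = i0 then j else 0" j] by simp
qed

lemma kpoly_sum: "(\<And>i. i \<in> I \<Longrightarrow> kpoly j (Q i)) \<Longrightarrow> kpoly j (\<lambda>x v. \<Sum>i\<in>I. Q i x v)"
  by (induction I rule: infinite_finite_induct) (auto intro: kpoly_zero kpoly.add)

lemma kpoly_cmult:
  assumes c: "continuous_on UNIV c" and "kpoly j Q"
  shows "kpoly j (\<lambda>x v. c v * Q x v)"
  using assms(2)
proof induction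
  case (mon e k j)
  then have "kpoly j (\<lambda>x v. (c v * e v) * of_real (mon k x))"
    by (intro kpoly.mon continuous_on_mult c)
  then show ?case by (simp add: mult.assoc)
next
  case (add j Q R)
  from kpoly.add[OF add.IH] show ?case by (simp add: algebra_simps)
qed

lemma hom_poly_imp_kpoly: "hom_poly j f \<Longrightarrow> kpoly j (\<lambda>x v. f x)"
  by (induction rule: hom_poly_induct) (auto intro: kpoly.intros)

lemma kpoly_mult:
  assumes "kpoly i Q" "kpoly j R"
  shows "kpoly (i + j) (\<lambda>x v. Q x v * R x v)"
  using assms(1)
proof induction
  case (mon c k i)
  note c = mon
  show ?case using assms(2)
  proof induction
    case (mon e l j)
    have "kpoly (i + j) (\<lambda>x v. (c v * e v) * of_real (mon (\<lambda>i. k i + l i) x))"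
      using mon c by (intro kpoly.mon continuous_on_mult) (auto simp: sum.distrib)
    then show ?case by (simp add: ac_simps flip: mon_add)
  next
    case (add j Q R)
    from kpoly.add[OF add.IH] show ?case by (simp add: algebra_simps)
  qed
next
  case (add j Q R)
  from kpoly.add[OF add.IH] show ?case by (simp add: algebra_simps)
qed

lemma kpoly_inner: "kpoly 1 (\<lambda>x v. of_real (v \<bullet> x))"
proof -
  have "kpoly 1 (\<lambda>x v. \<Sum>i\<in>UNIV. of_real (v $ i) * of_real (x $ i))"
    by (intro kpoly_sum kpoly_cmult hom_poly_imp_kpoly hom_poly_coord continuous_intros)
  then show ?thesis by (simp add: inner_vec_def)
qed

lemma kpoly_inner_power: "kpoly n (\<lambda>x v. of_real ((v \<bullet> x) ^ n))"
proof (induction n)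
  case 0
  show ?case using hom_poly_imp_kpoly[OF hom_poly_const[of 1]] by simp
next
  case (Suc n)
  then show ?case using kpoly_mult[OF kpoly_inner Suc] by simp
qed

lemma kpoly_zonal: "kpoly j (\<lambda>x v. of_real (zonal j x (v :: real^'n)))"
proof -
  have *: "kpoly j (\<lambda>x v::real^'n. of_real (zcoef CARD('n) j k * (v \<bullet> v) ^ k) * (of_real ((v \<bullet> x) ^ (j - 2 * k)) * of_real ((x \<bullet> x) ^ k)))"
    if "k \<le> j div 2" for k
  proof -
    have "kpoly (j - 2 * k + 2 * k) (\<lambda>x v::real^'n. of_real (zcoef CARD('n) j k * (v \<bullet> v) ^ k) * (of_real ((v \<bullet> x) ^ (j - 2 * k)) * of_real ((x \<bullet> x) ^ k)))"
      using hom_poly_power[OF hom_poly_inner_self, of k]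
      by (intro kpoly_cmult kpoly_mult kpoly_inner_power hom_poly_imp_kpoly) (auto intro!: continuous_intros)
    then show ?thesis using that by simp
  qed
  then have "kpoly j (\<lambda>x v::real^'n. \<Sum>k\<le>j div 2. of_real (zcoef CARD('n) j k * (v \<bullet> v) ^ k) * (of_real ((v \<bullet> x) ^ (j - 2 * k)) * of_real ((x \<bullet> x) ^ k)))"
    by (intro kpoly_sum) auto
  then show ?thesis by (simp add: zonal_def)
qed

lemma kpoly_section: "kpoly j Q \<Longrightarrow> hom_poly j (\<lambda>x. Q x v)"
  by (induction rule: kpoly.induct) (auto intro: hom_poly_mon hom_poly_add)

lemma kpoly_partial_deriv:
  assumes "kpoly j Q"
  shows "kpoly (j - 1) (\<lambda>x v. partial_deriv i (\<lambda>x. Q x v) x)"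
  using assms
proof induction
  case (mon c k j)
  have "kpoly (j - 1) (\<lambda>x v. (c v * of_nat (k i)) * of_real (mon (k(i := k i - 1)) x))"
  proof (cases "k i = 0")
    case False
    then show ?thesis using sum_upd_pred[of k i, OF False] mon by (intro kpoly.mon continuous_intros) auto
  qed (simp add: kpoly_zero)
  then show ?case by (simp add: partial_deriv_mon)
next
  case (add j Q R)
  then show ?case
    by (simp add: partial_deriv_add[OF kpoly_section kpoly_section, OF add(1,2)] kpoly.add)
qed

lemma integrable_sphere_cont_mult:
  fixes c P :: "real^'n \<Rightarrow> 'b::{banach, second_countable_topology, real_normed_field}"
  assumes c: "continuous_on (sphere 0 1) c" and P: "integrable \<omega> P"
  shows "integrable \<omega> (\<lambda>v. c v * P v)"
proof -
  have "bounded (c ` sphere 0 1)"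
    using c by (intro compact_imp_bounded compact_continuous_image) auto
  then obtain B where B: "\<And>v. v \<in> sphere 0 1 \<Longrightarrow> norm (c v) \<le> B" unfolding bounded_iff by blast
  show ?thesis
  proof (rule LINT_integrable_bound)
    show "integrable \<omega> (\<lambda>v. B * norm (P v))"
      using P by (intro integrable_mult_right integrable_norm)
    show "(\<lambda>v. c v * P v) \<in> borel_measurable \<omega>"
      using P by (intro borel_measurable_times[OF measurable_sphere_continuous[OF c]]) auto
    show "AE v in \<omega>. norm (c v * P v) \<le> norm (B * norm (P v))"
    proof (rule AE_I2)
      fix v :: "real^'n" assume "v \<in> space \<omega>"
      then have "norm (c v) * norm (P v) \<le> B * norm (P v)" by (intro mult_right_mono B) auto
      also have "\<dots> \<le> norm (B * norm (P v))" by simp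
      finally show "norm (c v * P v) \<le> norm (B * norm (P v))" by (simp add: norm_mult)
    qed
  qed
qed

context
  fixes P :: "real^'n \<Rightarrow> complex"
  assumes P: "integrable \<omega> P"
begin

lemma integrable_kpoly: "kpoly j Q \<Longrightarrow> integrable \<omega> (\<lambda>v. Q x v * P v)"
proof (induction rule: kpoly.induct)
  case (mon c k j)
  then have "integrable \<omega> (\<lambda>v. of_real (mon k x) * (c v * P v))"
    by (intro integrable_mult_right integrable_sphere_cont_mult P) (auto intro: continuous_on_subset)
  then show ?case by (simp add: ac_simps)
next
  case (add j Q R)
  from LINT_integrable_add[OF add.IH] show ?case by (simp add: algebra_simps)
qed

lemma integral_kpoly_add:
  "kpoly j Q \<Longrightarrow> kpoly j R \<Longrightarrow>
    (SI v. (Q x v + R x v) * P v) = (SI v. Q x v * P v) + (SI v. R x v * P v)"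
  by (simp add: distrib_right integrable_kpoly)

lemma integral_mult_mid:
  "(SI v. c v * a * P v) = (SI v. c v * P v) * a"
proof -
  have "(SI v. c v * a * P v) = (SI v. (c v * P v) * a)"
    by (simp add: ac_simps)
  also have "\<dots> = (SI v. c v * P v) * a"
    by (rule integral_mult_left_zero)
  finally show ?thesis .
qed

lemma hom_poly_integral: "kpoly j Q \<Longrightarrow> hom_poly j (\<lambda>x. LINT v|\<omega>. Q x v * P v)"
  by (induction rule: kpoly.induct)
    (auto simp: integral_mult_mid integral_kpoly_add intro!: hom_poly_mon hom_poly_add)

lemma partial_deriv_integral:
  "kpoly j Q \<Longrightarrow> partial_deriv i (\<lambda>x. LINT v|\<omega>. Q x v * P v) =
    (\<lambda>x. LINT v|\<omega>. partial_deriv i (\<lambda>x. Q x v) x * P v)"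
proof (induction rule: kpoly.induct)
  case (mon c k j)
  show ?case unfolding integral_mult_mid partial_deriv_mon ..
next
  case (add j Q R)
  show ?case
    unfolding integral_kpoly_add[OF add(1,2)]
      partial_deriv_add[OF hom_poly_integral hom_poly_integral, OF add(1,2)]
      partial_deriv_add[OF kpoly_section kpoly_section, OF add(1,2)]
      integral_kpoly_add[OF kpoly_partial_deriv kpoly_partial_deriv, OF add(1,2)] add.IH ..
qed

lemma laplacian_integral:
  assumes Q: "kpoly j Q"
  shows "laplacian (\<lambda>x. LINT v|\<omega>. Q x v * P v) x =
    (SI v. laplacian (\<lambda>x. Q x v) x * P v)"
proof -
  have Q1: "kpoly (j - 1) (\<lambda>x v. partial_deriv i (\<lambda>x. Q x v) x)" for i
    using Q by (rule kpoly_partial_deriv)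
  have Q2: "kpoly (j - 1 - 1) (\<lambda>x v. partial_deriv i (partial_deriv i (\<lambda>x. Q x v)) x)" for i
    using kpoly_partial_deriv[OF Q1[of i], of i] by simp
  have "laplacian (\<lambda>x. LINT v|\<omega>. Q x v * P v) x =
      (\<Sum>i\<in>UNIV. LINT v|\<omega>. partial_deriv i (partial_deriv i (\<lambda>x. Q x v)) x * P v)"
    unfolding laplacian_def partial_deriv_integral[OF Q] partial_deriv_integral[OF Q1] ..
  also have "\<dots> = (SI v. (\<Sum>i\<in>UNIV. partial_deriv i (partial_deriv i (\<lambda>x. Q x v)) x * P v))"
    by (rule LINT_sum[symmetric]) (rule integrable_kpoly[OF Q2])
  finally show ?thesis by (simp add: laplacian_def sum_distrib_right)
qed

text \<open>The kernel is a finite sum of products of a function of \<open>v\<close> and a monomial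
  in \<open>u\<close>, so exchanging the integrals is linearity rather than Fubini.\<close>

lemma integral_kpoly_swap:
  assumes Q: "kpoly j Q" and g: "continuous_on (sphere 0 1) g"
  shows "(SI u. (SI v. Q u v * P v) * g u) =
    (SI v. (SI u. Q u v * g u) * P v)"
  using Q
proof (induction rule: kpoly.induct)
  case (mon c k j)
  have "(SI u. (SI v. c v * of_real (mon k u) * P v) * g u) =
     (SI v. c v * P v) * (SI u. complex_of_real (mon k u) * g u)"
    unfolding integral_mult_mid unfolding mult.assoc by (rule integral_mult_right_zero)
  also have "\<dots> = (SI v. (c v * P v) * (SI u. complex_of_real (mon k u) * g u))"
    by (rule integral_mult_left_zero[symmetric])
  also have "\<dots> = (SI v. (c v * (SI u. complex_of_real (mon k u) * g u)) * P v)"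
    by (simp add: ac_simps)
  also have "\<dots> = (SI v. (SI u. c v * of_real (mon k u) * g u) * P v)"
    by (simp only: mult.assoc integral_mult_right_zero)
  finally show ?case .
next
  case (add j Q R)
  have int1: "integrable \<omega> (\<lambda>u. (SI v. Q u v * P v) * g u)" if "kpoly j Q" for Q
    using that by (intro integrable_sphere_continuous continuous_on_mult g hom_poly_continuous hom_poly_integral)
  have int0: "integrable \<omega> (\<lambda>u. Q u v * g u)" if "kpoly j Q" for Q v j
    using that by (intro integrable_sphere_continuous continuous_on_mult g hom_poly_continuous kpoly_section)
  have int2: "integrable \<omega> (\<lambda>v. (SI u. Q u v * g u) * P v)" if "kpoly j Q" for Q
    using that
  proof (induction rule: kpoly.induct)
    case (mon c k j)
    have "integrable \<omega> (\<lambda>v. (c v * (SI u. complex_of_real (mon k u) * g u)) * P v)"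
      using mon by (intro integrable_sphere_cont_mult P continuous_intros) (auto intro: continuous_on_subset)
    then show ?case by (simp only: mult.assoc integral_mult_right_zero)
  next
    case (add j Q R)
    from LINT_integrable_add[OF add.IH] show ?case
      by (simp add: distrib_right LINT_add[OF int0[OF add.hyps(1)] int0[OF add.hyps(2)]])
  qed
  show ?case
    unfolding integral_kpoly_add[OF add(1,2)] unfolding distrib_right
      LINT_add[OF int0[OF add(1)] int0[OF add(2)]]
      LINT_add[OF int1[OF add(1)] int1[OF add(2)]]
      LINT_add[OF int2[OF add(1)] int2[OF add(2)]] add.IH ..
qed

end

lemma sph_harm_diff: "f \<in> sph_harm j \<Longrightarrow> g \<in> sph_harm j \<Longrightarrow> (\<lambda>x. f x - g x) \<in> sph_harm j"
proof -
  assume *: "f \<in> sph_harm j" "g \<in> sph_harm j"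
  then have f: "hom_poly j f" and g: "hom_poly j g" by (auto simp: sph_harm_def)
  have "laplacian (\<lambda>x. \<Sum>i\<in>UNIV. (if i then 1 else -1) * (if i then f else g) x) x = 0" for x
    using * by (subst laplacian_cmult_sum[of _ j]) (auto simp: sph_harm_def harmonic_def UNIV_bool)
  then have "harmonic (\<lambda>x. f x - g x)" by (simp add: harmonic_def UNIV_bool)
  then show ?thesis using hom_poly_diff[OF f g] by (simp add: sph_harm_def)
qed

text \<open>The definition by \<open>THE\<close> demands existence and uniqueness. The integral
  operator lies in \<open>sph_harm j\<close> because its kernel is harmonic in \<open>x\<close>;
  exchanging the integrals and using the reproducing property of the kernel (\<open>rep\<close>)
  gives orthogonality. Uniqueness comes from testing with the kernel itself.\<close>

theorem sph_proj_eq: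
  fixes P :: "real^'n \<Rightarrow> complex"
  assumes d: "CARD('n) \<ge> 2" and P: "integrable \<omega> P"
  shows "sph_proj j P = (\<lambda>x. LINT v|\<omega>. of_real (zonal j x v) * P v)"
proof -
  let ?h = "\<lambda>x. LINT v|\<omega>. of_real (zonal j x v) * P v"
  have Z: "(\<lambda>x. complex_of_real (zonal j x y)) \<in> sph_harm j" for y :: "real^'n" by (rule zonal_sph_harm[OF d])
  have rep: "(SI u. of_real (zonal j u v) * f u) = f v" if "f \<in> sph_harm j" "norm v = 1" for f and v :: "real^'n"
  proof -
    have "(SI u. of_real (zonal j u v) * f u) = (SI u. f u * of_real (zpoly CARD('n) j (v \<bullet> u)))"
      using that(2) by (intro LINT_cong) (auto simp: zonal_sphere inner_commute)
    then show ?thesis using sphere_zpoly_harmonic[OF that order_refl] by simp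
  qed
  have intg: "integrable \<omega> (\<lambda>v. P v * cnj (g v))" if "g \<in> sph_harm j" for g
  proof -
    have "continuous_on (sphere 0 1) (\<lambda>v. cnj (g v))"
      using that by (intro continuous_intros hom_poly_continuous) (auto simp: sph_harm_def)
    from integrable_sphere_cont_mult[OF this P] show ?thesis by (simp add: mult.commute)
  qed
  have inth: "integrable \<omega> (\<lambda>v. h v * cnj (g v))" if "g \<in> sph_harm j" "h \<in> sph_harm j" for g h
    using that by (intro integrable_sphere_continuous continuous_intros hom_poly_continuous) (auto simp: sph_harm_def)
  have "hom_poly j ?h" by (rule hom_poly_integral[OF P kpoly_zonal])
  moreover have "harmonic ?h"
    using Z by (auto simp: harmonic_def laplacian_integral[OF P kpoly_zonal] sph_harm_def)
  ultimately have h: "?h \<in> sph_harm j" by (simp add: sph_harm_def)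
  have orth: "(SI v. (P v - ?h v) * cnj (g v)) = 0" if g: "g \<in> sph_harm j" for g
  proof -
    have c: "continuous_on (sphere 0 1) (\<lambda>v. cnj (g v))"
      using that by (intro continuous_intros hom_poly_continuous) (auto simp: sph_harm_def)
    have "(SI v. ?h v * cnj (g v)) =
        (SI v. (SI u. of_real (zonal j u v) * cnj (g u)) * P v)"
      by (rule integral_kpoly_swap[OF P kpoly_zonal c])
    also have "\<dots> = (SI v. P v * cnj (g v))"
    proof (intro LINT_cong refl)
      fix v :: "real^'n" assume "v \<in> space \<omega>"
      then have v: "norm v = 1" by simp
      have "(SI u. of_real (zonal j u v) * cnj (g u)) = (SI u. cnj (of_real (zonal j u v) * g u))"
        by simp
      also have "\<dots> = cnj (SI u. of_real (zonal j u v) * g u)" by (rule Bochner_Integration.integral_cnj)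
      also have "\<dots> = cnj (g v)" by (simp only: rep[OF g v])
      finally show "(SI u. of_real (zonal j u v) * cnj (g u)) * P v = P v * cnj (g v)"
        by (simp add: mult.commute)
    qed
    finally show ?thesis by (simp add: left_diff_distrib intg[OF g] inth[OF g h])
  qed
  show ?thesis unfolding sph_proj_def
  proof (rule the_equality)
    show "?h \<in> sph_harm j \<and> (\<forall>g\<in>sph_harm j. (SI v. (P v - ?h v) * cnj (g v)) = 0)"
      using h orth by blast
    fix f assume f: "f \<in> sph_harm j \<and> (\<forall>g\<in>sph_harm j. (SI v. (P v - f v) * cnj (g v)) = 0)"
    have D: "(\<lambda>x. f x - ?h x) \<in> sph_harm j" using f h by (intro sph_harm_diff) auto
    have 0: "f v - ?h v = 0" if "norm v = 1" for v
    proof -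
      \<comment> \<open>The kernel centred at \<open>v\<close> is an admissible test function;
        pairing with it evaluates the difference of two candidates at \<open>v\<close>.\<close>
      let ?z = "\<lambda>x. complex_of_real (zonal j x v)"
      have "f v - ?h v = (SI u. ?z u * (f u - ?h u))" using rep[OF D that] by simp
      also have "\<dots> = (SI u. (P u - ?h u) * cnj (?z u) - (P u - f u) * cnj (?z u))"
        by (simp add: algebra_simps)
      also have "\<dots> = (SI u. (P u - ?h u) * cnj (?z u)) - (SI u. (P u - f u) * cnj (?z u))"
        using f h Z by (intro LINT_diff)
          (simp_all only: left_diff_distrib LINT_integrable_diff intg inth)
      also have "\<dots> = 0" using f orth[OF Z, of v] bspec[OF conjunct2[OF f] Z, of v] by simp
      finally show ?thesis .
    qed
    show "f = ?h"
    proof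
      fix x
      \<comment> \<open>Homogeneity extends equality from the sphere to all of space, including the
        origin since \<open>dir\<close> is total.\<close>
      have "f x - ?h x = of_real (norm x ^ j) * (f (dir x) - ?h (dir x))"
        using hom_poly_scaleR[of j "\<lambda>x. f x - ?h x" "norm x" "dir x"] D
        by (simp only: sph_harm_def mem_Collect_eq norm_scaleR_dir)
      then show "f x = ?h x" using 0[of "dir x"] by simp
    qed
  qed
qed

corollary sph_proj_real:
  fixes P :: "real^'n \<Rightarrow> real"
  assumes "CARD('n) \<ge> 2" "integrable \<omega> P" "norm u = 1"
  shows "sph_proj j (\<lambda>v. complex_of_real (P v)) u = of_real (SI v. zpoly CARD('n) j (u \<bullet> v) * P v)"
proof -
  have "sph_proj j (\<lambda>v. complex_of_real (P v)) u = (SI v. complex_of_real (zonal j u v * P v))"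
    using assms by (simp add: sph_proj_eq)
  also have "\<dots> = (SI v. complex_of_real (zpoly CARD('n) j (u \<bullet> v) * P v))"
    using assms by (intro LINT_cong) (auto simp: zonal_sphere)
  finally show ?thesis unfolding integral_complex_of_real .
qed

section \<open>Zonal moments of the surface measure\<close>

text \<open>Continuity of \<open>q\<close> is assumed only on the interval; composing with the clamp
  to it gives a globally continuous function without changing values along \<open>X\<close>.\<close>

lemma borel_measurable_clamp:
  fixes q :: "real \<Rightarrow> real"
  assumes q: "continuous_on {-1..1} q" and X: "X \<in> borel_measurable M"
    and b: "\<And>x. x \<in> space M \<Longrightarrow> X x \<in> {-1..1}"
  shows "(\<lambda>x. q (X x)) \<in> borel_measurable M"
proof -
  have "continuous_on UNIV (\<lambda>x. q (max (-1) (min 1 x)))"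
    by (rule continuous_on_compose2[OF q]) (auto intro!: continuous_intros)
  then have "(\<lambda>x. q (max (-1) (min 1 x))) \<in> borel_measurable borel"
    by (rule borel_measurable_continuous_onI)
  from measurable_compose[OF X this] show ?thesis
  proof (rule measurable_cong[THEN iffD1, rotated])
    fix x assume "x \<in> space M"
    from b[OF this] have "max (-1) (min 1 (X x)) = X x" by auto
    then show "q (max (-1) (min 1 (X x))) = q (X x)" by simp
  qed
qed

lemma integrable_clamp:
  fixes q :: "real \<Rightarrow> real"
  assumes "finite_measure M" and q: "continuous_on {-1..1} q" and X: "X \<in> borel_measurable M"
    and b: "\<And>x. x \<in> space M \<Longrightarrow> X x \<in> {-1..1}"
  shows "integrable M (\<lambda>x. q (X x))"
proof -
  interpret finite_measure M by fact
  have "bounded (q ` {-1..1})"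
    using q by (intro compact_imp_bounded compact_continuous_image) auto
  then obtain B where "\<And>t. t \<in> {-1..1} \<Longrightarrow> norm (q t) \<le> B" unfolding bounded_iff by blast
  with b show ?thesis
    by (intro integrable_const_bound[of _ B] borel_measurable_clamp[OF q X] AE_I2) auto
qed

text \<open>Moments determine a measure on a compact interval, by Weierstrass approximation. Stated
  for functions on two measure spaces, it compares distributions without forming them.\<close>

lemma integral_eq_if_moments_eq:
  fixes q :: "real \<Rightarrow> real"
  assumes M: "finite_measure M" and N: "finite_measure N"
    and X: "X \<in> borel_measurable M" "\<And>x. x \<in> space M \<Longrightarrow> X x \<in> {-1..1}"
    and Y: "Y \<in> borel_measurable N" "\<And>x. x \<in> space N \<Longrightarrow> Y x \<in> {-1..1}"
    and mom: "\<And>n. (LINT x|M. X x ^ n) = (LINT x|N. Y x ^ n)"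
    and q: "continuous_on {-1..1} q"
  shows "(LINT x|M. q (X x)) = (LINT x|N. q (Y x))"
proof -
  define c where "c = measure M (space M) + measure N (space N)"
  have c: "c \<ge> 0" by (simp add: c_def)
  have approx: "\<bar>(LINT x|M. q (X x)) - (LINT x|M. g (X x))\<bar> \<le> e * measure M (space M)"
    if M: "finite_measure M" and X: "X \<in> borel_measurable M" "\<And>x. x \<in> space M \<Longrightarrow> X x \<in> {-1..1}"
      and g: "continuous_on {-1..1} g" "\<And>t. t \<in> {-1..1} \<Longrightarrow> \<bar>q t - g t\<bar> \<le> e" for M :: "'c measure" and X g e
  proof -
    interpret finite_measure M by (rule M)
    have i: "integrable M (\<lambda>x. q (X x))" "integrable M (\<lambda>x. g (X x))"
      by (intro integrable_clamp M q g X; assumption)+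
    have "\<bar>(LINT x|M. q (X x)) - (LINT x|M. g (X x))\<bar> = \<bar>LINT x|M. q (X x) - g (X x)\<bar>"
      using i by simp
    also have "\<dots> \<le> (LINT x|M. \<bar>q (X x) - g (X x)\<bar>)" by (rule integral_abs_bound)
    also have "\<dots> \<le> (LINT x|M. e)"
      using i g(2) X(2) by (intro integral_mono) auto
    finally show ?thesis by (simp add: mult.commute)
  qed
  have "\<bar>(LINT x|M. q (X x)) - (LINT x|N. q (Y x))\<bar> \<le> 0 + e" if e: "e > 0" for e
  proof -
    \<comment> \<open>The sup-norm error is multiplied by the two total masses, which add up to
      \<open>c\<close>; the \<open>1\<close> covers \<open>c = 0\<close>.\<close>
    define e' where "e' = e / (c + 1)"
    have e': "e' > 0" "e' * c \<le> e" using e c by (auto simp: e'_def field_simps)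
    obtain g where g: "real_polynomial_function g" "\<And>t. t \<in> {-1..1} \<Longrightarrow> \<bar>q t - g t\<bar> < e'"
      using Stone_Weierstrass_real_polynomial_function[OF compact_Icc q e'(1)] by auto
    obtain a n where ga: "g = (\<lambda>x. \<Sum>i\<le>n. a i * x ^ i)"
      using real_polynomial_function_imp_sum[OF g(1)] by blast
    have gc: "continuous_on {-1..1} g" unfolding ga by (intro continuous_intros)
    have le: "\<bar>q t - g t\<bar> \<le> e'" if "t \<in> {-1..1}" for t using g(2)[OF that] by simp
    have "(LINT x|M. g (X x)) = (\<Sum>i\<le>n. a i * (LINT x|M. X x ^ i))"
      unfolding ga
      by (subst LINT_sum)
        (simp_all add: integrable_clamp[OF M _ X, where q="\<lambda>t. t ^ _"] continuous_intros)
    moreover have "(LINT x|N. g (Y x)) = (\<Sum>i\<le>n. a i * (LINT x|N. Y x ^ i))"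
      unfolding ga
      by (subst LINT_sum)
        (simp_all add: integrable_clamp[OF N _ Y, where q="\<lambda>t. t ^ _"] continuous_intros)
    ultimately have "(LINT x|M. g (X x)) = (LINT x|N. g (Y x))" by (simp add: mom)
    moreover have "\<bar>(LINT x|M. q (X x)) - (LINT x|M. g (X x))\<bar> \<le> e' * measure M (space M)"
      by (rule approx[OF M X gc le])
    moreover have "\<bar>(LINT x|N. q (Y x)) - (LINT x|N. g (Y x))\<bar> \<le> e' * measure N (space N)"
      by (rule approx[OF N Y gc le])
    ultimately have "\<bar>(LINT x|M. q (X x)) - (LINT x|N. q (Y x))\<bar> \<le> e' * c"
      by (simp add: c_def distrib_left)
    then show ?thesis using e' by simp
  qed
  then have "\<bar>(LINT x|M. q (X x)) - (LINT x|N. q (Y x))\<bar> \<le> 0" by (rule field_le_epsilon)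
  then show ?thesis by simp
qed

text \<open>The value of \<open>\<integral> \<bar>\<langle>u, v\<rangle>\<bar>^\<beta> \<omega>(dv)\<close> for a unit vector \<open>u\<close>; see \<open>sphere_abs_moment\<close>.\<close>

definition abs_mom :: "nat \<Rightarrow> real \<Rightarrow> real" where
  "abs_mom d \<beta> = 2 * pi powr ((real d - 1) / 2) * Gamma ((\<beta> + 1) / 2) / Gamma ((\<beta> + d) / 2)"

section \<open>Gamma identities relating \<open>w_coef\<close> to absolute moments\<close>

lemma real_not_nonpos_Int: "x > 0 \<Longrightarrow> (x::real) \<notin> \<int>\<^sub>\<le>\<^sub>0"
  using nonpos_Ints_nonpos[of x] by auto

lemma Gamma_duplication_real:
  fixes x :: real
  assumes "x > 0"
  shows "Gamma x * Gamma (x + 1/2) = 2 powr (1 - 2 * x) * sqrt pi * Gamma (2 * x)"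
proof -
  have "complex_of_real x \<notin> \<int>\<^sub>\<le>\<^sub>0" "complex_of_real (x + 1/2) \<notin> \<int>\<^sub>\<le>\<^sub>0"
    using assms by (auto simp only: of_real_in_nonpos_Ints_iff real_not_nonpos_Int)
  then have "Gamma (complex_of_real x) * Gamma (complex_of_real x + 1/2) =
     exp ((1 - 2 * complex_of_real x) * of_real (ln 2)) * of_real (sqrt pi) * Gamma (2 * complex_of_real x)"
    by (intro Gamma_legendre_duplication) simp_all
  also have "Gamma (complex_of_real x) * Gamma (complex_of_real x + 1/2) = of_real (Gamma x * Gamma (x + 1/2))"
    by (simp flip: Gamma_complex_of_real)
  also have "exp ((1 - 2 * complex_of_real x) * of_real (ln 2)) * of_real (sqrt pi) * Gamma (2 * complex_of_real x) =
     of_real (exp ((1 - 2 * x) * ln 2) * sqrt pi * Gamma (2 * x))"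
    by (simp flip: Gamma_complex_of_real exp_of_real)
  finally show ?thesis unfolding of_real_eq_iff by (simp add: powr_def)
qed

lemma Gamma_shift:
  assumes z: "z > 0" shows "Gamma (z + real i) = pochhammer z i * Gamma (z::real)"
proof -
  have "Gamma z \<noteq> 0" using Gamma_real_pos[OF z] by simp
  with pochhammer_Gamma[OF real_not_nonpos_Int[OF z], of i] show ?thesis by simp
qed

lemma abs_mom_shift:
  assumes "\<beta> \<ge> 0" "d > 0"
  shows "abs_mom d (\<beta> + 2 * real i) = abs_mom d \<beta> * pochhammer ((\<beta> + 1) / 2) i / pochhammer ((\<beta> + d) / 2) i"
proof -
  have "Gamma ((\<beta> + 2 * real i + 1) / 2) = pochhammer ((\<beta> + 1) / 2) i * Gamma ((\<beta> + 1) / 2)"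
    using Gamma_shift[of "(\<beta> + 1) / 2" i] assms by (simp add: add_divide_distrib ac_simps)
  moreover have "Gamma ((\<beta> + 2 * real i + d) / 2) = pochhammer ((\<beta> + d) / 2) i * Gamma ((\<beta> + d) / 2)"
    using Gamma_shift[of "(\<beta> + d) / 2" i] assms by (simp add: add_divide_distrib ac_simps)
  ultimately show ?thesis unfolding abs_mom_def by (simp add: ac_simps)
qed

text \<open>Stated for the reciprocal, the functional equation iterates without excluding the poles
  of Gamma.\<close>

lemma rGamma_falling: "rGamma (x - real l + 1) = (\<Prod>i<l. x - real i) * rGamma (x + 1)" for x :: real
proof (induction l)
  case (Suc l)
  have "rGamma (x - real (Suc l) + 1) = rGamma (x - real l)" by (simp add: algebra_simps)
  also have "\<dots> = (x - real l) * rGamma (x - real l + 1)" by (rule rGamma_plus1[symmetric])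
  finally show ?case by (simp add: Suc)
qed simp

text \<open>With \<open>j = 2 * l + e\<close>, all transcendental dependence on \<alpha> is
  collected in one absolute moment; the rest is rational. This is the shape in which
  \<open>w_coef\<close> can be compared with the integral against \<open>zpoly\<close>.\<close>

lemma w_coef_prod:
  assumes \<alpha>: "\<alpha> \<ge> 0" and e: "e = 0 \<or> e = 1" and d: "d > 0"
  shows "w_coef d (2 * l + e) \<alpha> =
    abs_mom d (\<alpha> + e) * (\<Prod>i<l. (\<alpha> + e) / 2 - real e - real i) / pochhammer ((\<alpha> + e + d) / 2) l"
proof -
  define x where "x = (\<alpha> - real e) / 2"
  have x: "x + 1 > 0" "x + real e + 1/2 > 0" using \<alpha> e by (auto simp: x_def field_simps)
  have G1: "rGamma ((real (2 * l + e) + \<alpha> + d) / 2) = 1 / (pochhammer ((\<alpha> + e + d) / 2) l * Gamma ((\<alpha> + e + d) / 2))"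
  proof -
    have "(real (2 * l + e) + \<alpha> + d) / 2 = (\<alpha> + e + d) / 2 + real l" by (simp add: field_simps)
    moreover have "(\<alpha> + e + d) / 2 > 0" using \<alpha> d by simp
    ultimately show ?thesis
      by (simp only: rGamma_inverse_Gamma inverse_eq_divide Gamma_shift)
  qed
  have "(\<alpha> - real (2 * l + e)) / 2 + 1 = x - real l + 1" by (simp add: x_def field_simps)
  then have G2: "rGamma ((\<alpha> - real (2 * l + e)) / 2 + 1) = (\<Prod>i<l. x - real i) / Gamma (x + 1)"
    by (simp only: rGamma_falling rGamma_inverse_Gamma[of "x + 1"] divide_inverse)
  have xx: "(\<alpha> + e) / 2 - real e - real i = x - real i" for i by (simp add: x_def field_simps)
  \<comment> \<open>Legendre duplication: the two arguments differ by one half, and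
    \<open>x + 1\<close> is the larger one for \<open>e = 0\<close>, the smaller one for
    \<open>e = 1\<close>.\<close>
  have G3: "Gamma (x + 1) * Gamma ((\<alpha> + e + 1) / 2) = 2 powr (- \<alpha>) * sqrt pi * Gamma (\<alpha> + 1)"
    using e
  proof
    assume e: "e = 0"
    have *: "x + 1/2 + 1/2 = x + 1" "1 - (\<alpha> + 1) = - \<alpha>" "2 * (x + 1/2) = \<alpha> + 1" "(\<alpha> + e + 1) / 2 = x + 1/2"
      unfolding x_def e by (simp_all add: field_simps)
    have "x + 1/2 > 0" using x e by simp
    from Gamma_duplication_real[OF this] show ?thesis unfolding * by (simp only: mult.commute)
  next
    assume e: "e = 1"
    have *: "1 - (\<alpha> + 1) = - \<alpha>" "2 * (x + 1) = \<alpha> + 1" "(\<alpha> + e + 1) / 2 = x + 1 + 1/2"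
      unfolding x_def e by (simp_all add: field_simps)
    from Gamma_duplication_real[OF x(1)] show ?thesis unfolding * .
  qed
  have Gp: "Gamma (x + 1) > 0" "Gamma ((\<alpha> + e + d) / 2) > 0" "pochhammer ((\<alpha> + e + d) / 2) l > 0"
    using x \<alpha> d by (auto intro!: Gamma_real_pos pochhammer_pos)
  have p: "pi powr (real d / 2) = pi powr ((real d - 1) / 2) * sqrt pi"
    by (simp add: powr_half_sqrt[symmetric] diff_divide_distrib flip: powr_add)
  have "w_coef d (2 * l + e) \<alpha> * (2 powr (\<alpha> - 1)) = pi powr (real d / 2) * Gamma (\<alpha> + 1)
      * (1 / (pochhammer ((\<alpha> + e + d) / 2) l * Gamma ((\<alpha> + e + d) / 2))) * ((\<Prod>i<l. x - real i) / Gamma (x + 1))"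
    unfolding w_coef_def G1 G2 by simp
  also have "\<dots> = pi powr ((real d - 1) / 2) * (sqrt pi * Gamma (\<alpha> + 1))
      * (1 / (pochhammer ((\<alpha> + e + d) / 2) l * Gamma ((\<alpha> + e + d) / 2))) * ((\<Prod>i<l. x - real i) / Gamma (x + 1))"
    unfolding p by simp
  also have "sqrt pi * Gamma (\<alpha> + 1) = 2 powr \<alpha> * (Gamma (x + 1) * Gamma ((\<alpha> + e + 1) / 2))"
    unfolding G3 by (simp add: powr_minus)
  also have "2 powr \<alpha> = 2 * 2 powr (\<alpha> - 1)" by (simp add: powr_diff)
  finally have "w_coef d (2 * l + e) \<alpha> * (2 powr (\<alpha> - 1)) = 2 * pi powr ((real d - 1) / 2) * Gamma ((\<alpha> + e + 1) / 2)
      * (1 / (pochhammer ((\<alpha> + e + d) / 2) l * Gamma ((\<alpha> + e + d) / 2))) * (\<Prod>i<l. x - real i) * (2 powr (\<alpha> - 1))"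
    using Gp(1) by (simp add: ac_simps)
  moreover have "2 powr (\<alpha> - 1) \<noteq> 0" by simp
  ultimately have "w_coef d (2 * l + e) \<alpha> = 2 * pi powr ((real d - 1) / 2) * Gamma ((\<alpha> + e + 1) / 2)
      * (1 / (pochhammer ((\<alpha> + e + d) / 2) l * Gamma ((\<alpha> + e + d) / 2))) * (\<Prod>i<l. x - real i)"
    by (rule mult_right_cancel[THEN iffD1, rotated])
  then show ?thesis unfolding abs_mom_def xx by (simp add: ac_simps)
qed

lemma w_coef_0: "\<alpha> \<ge> 0 \<Longrightarrow> d > 0 \<Longrightarrow> w_coef d 0 \<alpha> = abs_mom d \<alpha>"
  using w_coef_prod[of \<alpha> 0 d 0] by simp

section \<open>The distribution of \<open>u \<bullet> v\<close> under the surface measure\<close>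

context
  fixes u :: "real^'n"
  assumes u: "norm u = 1"
begin

lemma sphere_inner_bound: "v \<in> space \<omega> \<Longrightarrow> u \<bullet> v \<in> {-1..1}"
  using Cauchy_Schwarz_ineq2[of u v] u by (auto simp: abs_le_iff)

lemma sphere_inner_measurable: "(\<lambda>v. u \<bullet> v) \<in> borel_measurable \<omega>"
  by (intro measurable_sphere_continuous continuous_intros)

lemma integrable_sphere_inner:
  fixes q :: "real \<Rightarrow> real"
  shows "continuous_on {-1..1} q \<Longrightarrow> integrable \<omega> (\<lambda>v. q (u \<bullet> v))"
  by (rule integrable_clamp[OF finite_sphere_measure _ sphere_inner_measurable sphere_inner_bound])

lemma sphere_moment: "(SI v. (u \<bullet> v) ^ m) = mcoef CARD('n) m 0"
proof -
  have "hom_poly 0 (\<lambda>x::real^'n. 1)" by (rule hom_poly_const)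
  moreover have "harmonic (\<lambda>x::real^'n. 1)"
    by (simp add: harmonic_def laplacian_def has_pd_imp_eq[OF has_pd_const])
  ultimately have "(SI v. 1 * complex_of_real ((u \<bullet> v) ^ m)) = of_real (mcoef CARD('n) m 0) * 1"
    using u by (rule sphere_harmonic_moment)
  then have "complex_of_real (SI v. (u \<bullet> v) ^ m) = of_real (mcoef CARD('n) m 0)"
    unfolding integral_complex_of_real[symmetric] by simp
  then show ?thesis unfolding of_real_eq_iff .
qed

text \<open>Odd moments vanish, so \<open>u \<bullet> v\<close> and its negative have equal moments
  and hence equal distributions.\<close>

lemma sphere_inner_odd:
  fixes q :: "real \<Rightarrow> real"
  assumes q: "continuous_on {-1..1} q" and odd: "\<And>t. q (- t) = - q t"
  shows "(SI v. q (u \<bullet> v)) = 0"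
proof -
  have "(SI v. q (u \<bullet> v)) = (SI v. q (- (u \<bullet> v)))"
  proof (rule integral_eq_if_moments_eq[OF finite_sphere_measure finite_sphere_measure _ _ _ _ _ q,
        where X="\<lambda>v. u \<bullet> v" and Y="\<lambda>v. - (u \<bullet> v)"])
    show "(SI v. (u \<bullet> v) ^ n) = (SI v. (- (u \<bullet> v)) ^ n)" for n
      by (cases "even n") (simp_all add: sphere_moment power_minus_odd mcoef_def)
  qed (use sphere_inner_bound sphere_inner_measurable in \<open>simp_all add: minus_le_iff\<close>)
  then show ?thesis by (simp add: odd)
qed

text \<open>The integer moments of \<open>(u \<bullet> v)\<^sup>2\<close> are those of a scaled Beta
  distribution with parameters \<open>1/2\<close> and \<open>(d - 1) / 2\<close>. Equality of
  moments carries over to real exponents, where the Beta integral is explicit.\<close>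

lemma sphere_abs_moment:
  assumes d: "CARD('n) \<ge> 2" and \<beta>: "\<beta> > 0"
  shows "(SI v. \<bar>u \<bullet> v\<bar> powr \<beta>) = abs_mom CARD('n) \<beta>"
proof -
  define b where "b = (real CARD('n) - 1) / 2"
  have b: "b > 0" using d by (simp add: b_def)
  \<comment> \<open>The area of the unit sphere one dimension lower, which is what integrating out
    the directions orthogonal to \<open>u\<close> produces.\<close>
  define C where "C = 2 * pi powr b / Gamma b"
  have C: "C \<ge> 0" using b by (simp add: C_def Gamma_real_pos less_imp_le)
  define N where "N = density lborel (\<lambda>s. ennreal (C * (indicator {0..1} s * (s powr (-1/2) * (1 - s) powr (b - 1)))))"
  have beta: "integrable lborel (\<lambda>s. indicator {0..1} s * (s powr (a - 1/2) * (1 - s) powr (b - 1)))"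
    "(LINT s|lborel. indicator {0..1} s * (s powr (a - 1/2) * (1 - s) powr (b - 1))) = Beta (a + 1/2) b" if a: "a \<ge> 0" for a
  proof -
    have "set_integrable lborel {0..1} (\<lambda>t. t powr (a + 1/2 - 1) * (1 - t) powr (b - 1))"
      using a b by (intro integrable_Beta) auto
    moreover from set_borel_integral_eq_integral(2)[OF this]
    have "(LINT t:{0..1}|lborel. t powr (a + 1/2 - 1) * (1 - t) powr (b - 1)) = Beta (a + 1/2) b"
      using has_integral_Beta_real[of "a + 1/2" b] a b by (auto simp: integral_unique)
    ultimately show "integrable lborel (\<lambda>s. indicator {0..1} s * (s powr (a - 1/2) * (1 - s) powr (b - 1)))"
     "(LINT s|lborel. indicator {0..1} s * (s powr (a - 1/2) * (1 - s) powr (b - 1))) = Beta (a + 1/2) b"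
      by (simp_all add: set_integrable_def set_lebesgue_integral_def)
  qed
  have NB: "(LINT s|N. g s) = C * Beta (a + 1/2) b"
    if a: "a \<ge> 0" and g: "\<And>s. 0 < s \<Longrightarrow> s \<le> 1 \<Longrightarrow> g s = s powr a" and [measurable]: "g \<in> borel_measurable borel" for g a
  proof -
    have "(LINT s|N. g s) = (LINT s|lborel. (C * (indicator {0..1} s * (s powr (-1/2) * (1 - s) powr (b - 1)))) *\<^sub>R g s)"
      unfolding N_def using C by (subst integral_density) (auto intro!: AE_I2 mult_nonneg_nonneg)
    also have "\<dots> = (LINT s|lborel. C * (indicator {0..1} s * (s powr (a - 1/2) * (1 - s) powr (b - 1))))"
    proof (rule integral_cong_AE)
      show "AE s in lborel. (C * (indicator {0..1} s * (s powr (-1/2) * (1 - s) powr (b - 1)))) *\<^sub>R g s =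
        C * (indicator {0..1} s * (s powr (a - 1/2) * (1 - s) powr (b - 1)))"
        using AE_lborel_singleton[of 0]
      proof eventually_elim
        case (elim s)
        show ?case
        proof (cases "s \<in> {0..1}")
          case True
          then have "g s = s powr a" using elim by (intro g) auto
          then have "s powr (-1/2) * g s = s powr (a - 1/2)" by (simp flip: powr_add)
          then show ?thesis using True by (simp add: ac_simps)
        qed (simp add: indicator_def)
      qed
    qed measurable
    also have "\<dots> = C * Beta (a + 1/2) b" using beta(2)[OF a] by simp
    finally show ?thesis .
  qed
  have finN: "finite_measure N"
  proof
    have "emeasure N (space N) = (\<integral>\<^sup>+s. ennreal (C * (indicator {0..1} s * (s powr (-1/2) * (1 - s) powr (b - 1)))) \<partial>lborel)"
      unfolding N_def by (subst emeasure_density) (auto simp del: ennreal_mult'')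
    also have "\<dots> < \<infinity>"
      using integrable_mult_right[OF beta(1)[of 0], of C] C
      unfolding integrable_iff_bounded by (simp add: abs_mult abs_of_nonneg)
    finally show "emeasure N (space N) \<noteq> \<infinity>" by simp
  qed
  \<comment> \<open>The space of \<open>N\<close> is the whole line although its mass sits on
    \<open>{0..1}\<close>; the clamped identity meets the range condition of the moment lemma
    everywhere.\<close>
  define Y :: "real \<Rightarrow> real" where "Y s = max 0 (min 1 s)" for s
  have [measurable]: "Y \<in> borel_measurable borel" unfolding Y_def[abs_def] by measurable
  have Y: "Y \<in> borel_measurable N" "Y s \<in> {-1..1}" "0 < s \<Longrightarrow> s \<le> 1 \<Longrightarrow> Y s = s" for s
    by (auto simp: N_def) (auto simp: Y_def)
  have CB: "C * Beta (a + 1/2) b = abs_mom CARD('n) (2 * a)" if "a \<ge> 0" for a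
  proof -
    have "Gamma b \<noteq> 0" using Gamma_real_pos[OF b] by simp
    moreover have "a + 1 / 2 + b = (2 * a + CARD('n)) / 2" "(2 * a + 1) / 2 = a + 1/2"
      by (simp_all add: b_def field_simps)
    ultimately show ?thesis unfolding C_def Beta_def abs_mom_def b_def[symmetric] by (simp only:) simp
  qed
  have "\<bar>u \<bullet> v\<bar> powr \<beta> = ((u \<bullet> v)\<^sup>2) powr (\<beta> / 2)" for v
  proof -
    have "((u \<bullet> v)\<^sup>2) powr (\<beta> / 2) = (\<bar>u \<bullet> v\<bar> powr 2) powr (\<beta> / 2)" by simp
    then show ?thesis by (simp only: powr_powr) simp
  qed
  then have "(SI v. \<bar>u \<bullet> v\<bar> powr \<beta>) = (SI v. ((u \<bullet> v)\<^sup>2) powr (\<beta> / 2))"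
    by (simp only:)
  also have "\<dots> = (LINT s|N. (Y s) powr (\<beta> / 2))"
  proof -
    \<comment> \<open>The \<open>max\<close> extends the power continuously to negative arguments;
      the values of both functions compared are nonnegative.\<close>
    let ?q = "\<lambda>t::real. (max 0 t) powr (\<beta> / 2)"
    have "(SI v. ?q ((u \<bullet> v)\<^sup>2)) = (LINT s|N. ?q (Y s))"
    proof (rule integral_eq_if_moments_eq[OF finite_sphere_measure finN,
          where q="?q" and X="\<lambda>v. (u \<bullet> v)\<^sup>2" and Y=Y])
      show "(\<lambda>v. (u \<bullet> v)\<^sup>2) \<in> borel_measurable \<omega>"
        by (intro measurable_sphere_continuous continuous_intros)
      show "(u \<bullet> v)\<^sup>2 \<in> {-1..1}" if "v \<in> space \<omega>" for v
      proof -
        have "(u \<bullet> v)\<^sup>2 \<le> 1" using sphere_inner_bound[OF that] by (auto simp: abs_square_le_1 abs_le_iff)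
        moreover have "0 \<le> (u \<bullet> v)\<^sup>2" by (rule zero_le_power2)
        ultimately show ?thesis unfolding atLeastAtMost_iff by linarith
      qed
      show "Y \<in> borel_measurable N" "\<And>s. Y s \<in> {-1..1}" by (rule Y)+
      show "continuous_on {-1..1} ?q"
        using \<beta> by (intro continuous_on_powr' continuous_intros) auto
      show "(SI v. ((u \<bullet> v)\<^sup>2) ^ n) = (LINT s|N. Y s ^ n)" for n
      proof -
        have "(SI v. ((u \<bullet> v)\<^sup>2) ^ n) = abs_mom CARD('n) (2 * real n)"
          by (simp add: sphere_moment mcoef_def w_coef_0 flip: power_mult)
        also have "\<dots> = (LINT s|N. Y s ^ n)"
          by (subst NB[where a="real n"]) (auto simp: CB Y(3) powr_realpow)
        finally show ?thesis .
      qed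
    qed
    then show ?thesis by (simp add: Y_def)
  qed
  also have "\<dots> = C * Beta (\<beta> / 2 + 1/2) b"
    using \<beta> by (intro NB) (auto simp: Y(3))
  also have "\<dots> = abs_mom CARD('n) \<beta>" using CB[of "\<beta> / 2"] \<beta> by simp
  finally show ?thesis .
qed

end

section \<open>Funk-Hecke coefficients of signed powers\<close>

lemma real_polynomial_function_eq_0:
  fixes p :: "real \<Rightarrow> real"
  assumes p: "real_polynomial_function p" and "infinite {x. p x = 0}"
  shows "p x = 0"
proof -
  obtain a n where pa: "p = (\<lambda>x. \<Sum>i\<le>n. a i * x ^ i)"
    using real_polynomial_function_imp_sum[OF p] by blast
  have "a i = 0" if "i \<le> n" for i
  proof (rule ccontr)
    assume "a i \<noteq> 0"
    then have "finite {z. (\<Sum>i\<le>n. a i * z ^ i) = 0}"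
      using that by (intro polyfun_rootbound_finite) blast
    then show False using assms(2) by (simp add: pa)
  qed
  then show ?thesis by (simp add: pa)
qed

lemma real_polynomial_function_pochhammer:
  assumes "real_polynomial_function f"
  shows "real_polynomial_function (\<lambda>x. pochhammer (f x) n)"
  unfolding pochhammer_prod using assms
  by (intro real_polynomial_function_prod real_polynomial_function.intros(3)) auto

text \<open>Only the parity of \<open>j\<close> enters: this is the even or odd extension of the
  power from the positive half-line, with the parity of \<open>zpoly d j\<close>.\<close>

definition sgn_powr :: "nat \<Rightarrow> real \<Rightarrow> real \<Rightarrow> real" where
  "sgn_powr j \<alpha> t = \<bar>t\<bar> powr \<alpha> * (if even j then 1 else sgn t)"

lemma sgn_powr_times_power:
  assumes "even (m + j)"
  shows "sgn_powr j \<alpha> t * t ^ m = \<bar>t\<bar> powr (\<alpha> + real m)"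
proof (cases "t = 0")
  case False
  have "(if even j then 1 else sgn t) * t ^ m = \<bar>t\<bar> ^ m"
  proof (cases "even j")
    case True
    with assms show ?thesis by (simp add: power_even_abs)
  next
    case odd: False
    with assms obtain k where "m = Suc k" "even k" by (cases m) auto
    then show ?thesis using odd by (simp add: power_even_abs flip: mult.assoc) (simp add: abs_sgn mult.commute)
  qed
  then have "sgn_powr j \<alpha> t * t ^ m = \<bar>t\<bar> powr \<alpha> * \<bar>t\<bar> ^ m"
    by (simp add: sgn_powr_def)
  also have "\<dots> = \<bar>t\<bar> powr (\<alpha> + real m)" using False by (simp add: powr_add powr_realpow)
  finally show ?thesis .
qed (simp add: sgn_powr_def)

text \<open>For \<open>m = 0\<close> the claim would fail at \<open>t = 0\<close>, since
  \<open>0 powr 0 = 0\<close> but \<open>0 ^ 0 = 1\<close>.\<close>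

lemma sgn_powr_nat:
  assumes "even (m + j)" "m > 0"
  shows "sgn_powr j (real m) t = t ^ m"
proof (cases "t = 0")
  case False
  then have "sgn_powr j (real m) t = \<bar>t\<bar> ^ m * (if even j then 1 else sgn t)"
    by (simp add: sgn_powr_def powr_realpow)
  also have "\<dots> = t ^ m"
  proof (cases "even j")
    case True
    with assms show ?thesis by (simp add: power_even_abs)
  next
    case odd: False
    with assms obtain k where k: "m = Suc k" "even k" by (cases m) auto
    have "\<bar>t\<bar> ^ m * sgn t = (\<bar>t\<bar> * sgn t) * \<bar>t\<bar> ^ k" by (simp add: k)
    then show ?thesis using odd k by (simp add: power_even_abs mult.commute[of "\<bar>t\<bar>"] sgn_mult_abs)
  qed
  finally show ?thesis .
qed (use assms in \<open>simp add: sgn_powr_def\<close>)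

lemma continuous_sgn_powr:
  assumes "\<alpha> > 0" shows "continuous_on A (sgn_powr j \<alpha>)"
proof (cases "even j")
  case True
  then have "sgn_powr j \<alpha> = (\<lambda>t. \<bar>t\<bar> powr \<alpha>)" by (auto simp: sgn_powr_def)
  then show ?thesis using assms by (simp only:) (intro continuous_on_powr' continuous_intros; simp)
next
  case False
  \<comment> \<open>Writing the odd power through positive and negative parts removes the
    discontinuous sign.\<close>
  have "sgn_powr j \<alpha> = (\<lambda>t. (max 0 t) powr \<alpha> - (max 0 (- t)) powr \<alpha>)"
    using False by (auto simp: sgn_powr_def sgn_if max_def)
  then show ?thesis using assms by (simp only:) (intro continuous_on_diff continuous_on_powr' continuous_intros; simp)
qed

lemma continuous_zpoly: "continuous_on A (zpoly d j)"
  unfolding zpoly_def[abs_def] by (intro continuous_intros)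

context
  fixes u :: "real^'n"
  assumes u: "norm u = 1" and d: "CARD('n) \<ge> 2"
begin

lemma zpoly_moment: "(SI v. (u \<bullet> v) ^ m * zpoly CARD('n) j (u \<bullet> v)) = mcoef CARD('n) m j * zpoly CARD('n) j 1"
proof -
  have h: "hom_poly j (\<lambda>x. complex_of_real (zonal j x u))" "harmonic (\<lambda>x. complex_of_real (zonal j x u))"
    using zonal_sph_harm[OF d, of j u] by (auto simp: sph_harm_def)
  have "complex_of_real (SI v. (u \<bullet> v) ^ m * zpoly CARD('n) j (u \<bullet> v)) =
      (SI v. complex_of_real ((u \<bullet> v) ^ m * zpoly CARD('n) j (u \<bullet> v)))"
    by (rule integral_complex_of_real[symmetric])
  also have "\<dots> = (SI v. complex_of_real (zonal j v u) * of_real ((u \<bullet> v) ^ m))"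
    using u by (intro LINT_cong) (auto simp: zonal_sphere inner_commute)
  also have "\<dots> = of_real (mcoef CARD('n) m j) * of_real (zonal j u u)"
    by (rule sphere_harmonic_moment[OF h u])
  also have "zonal j u u = zpoly CARD('n) j 1" using u by (simp add: zonal_sphere dot_square_norm)
  finally show ?thesis unfolding of_real_mult[symmetric] of_real_eq_iff .
qed

lemma sgn_powr_zpoly_eq_sum:
  assumes \<alpha>: "\<alpha> > 0"
  shows "(SI v. sgn_powr j \<alpha> (u \<bullet> v) * zpoly CARD('n) j (u \<bullet> v)) =
    (\<Sum>k\<le>j div 2. zcoef CARD('n) j k * abs_mom CARD('n) (\<alpha> + real (j - 2 * k)))"
proof -
  have "sgn_powr j \<alpha> t * zpoly CARD('n) j t = (\<Sum>k\<le>j div 2. zcoef CARD('n) j k * \<bar>t\<bar> powr (\<alpha> + real (j - 2 * k)))" for t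
    unfolding zpoly_def sum_distrib_left
  proof (intro sum.cong refl)
    fix k assume "k \<in> {..j div 2}"
    then have "even (j - 2 * k + j)" by auto
    from sgn_powr_times_power[OF this, of \<alpha> t]
    show "sgn_powr j \<alpha> t * (zcoef CARD('n) j k * t ^ (j - 2 * k)) = zcoef CARD('n) j k * \<bar>t\<bar> powr (\<alpha> + real (j - 2 * k))"
      by (simp add: ac_simps)
  qed
  moreover have "integrable \<omega> (\<lambda>v. \<bar>u \<bullet> v\<bar> powr (\<alpha> + real i))" for i
    using \<alpha> by (intro integrable_sphere_continuous continuous_on_powr' continuous_intros) auto
  ultimately have "(SI v. sgn_powr j \<alpha> (u \<bullet> v) * zpoly CARD('n) j (u \<bullet> v)) =
      (\<Sum>k\<le>j div 2. zcoef CARD('n) j k * (SI v. \<bar>u \<bullet> v\<bar> powr (\<alpha> + real (j - 2 * k))))"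
    by (simp only: integral_mult_right_zero LINT_sum integrable_mult_right)
  then show ?thesis
    using \<alpha> by (simp only: sphere_abs_moment[OF u d] add_pos_nonneg of_nat_0_le_iff)
qed

text \<open>Each absolute moment is an even shift of the one of order \<open>\<beta>\<close>.
  Bringing the Pochhammer denominators to the common one of length \<open>l\<close> leaves a sum
  that is polynomial in \<open>\<beta>\<close>.\<close>

lemma abs_mom_sum:
  fixes l e :: nat and \<beta> :: real
  assumes \<beta>: "\<beta> > 0" and j: "j = 2 * l + e" and \<alpha>: "\<beta> = \<alpha> + real e"
  shows "(\<Sum>k\<le>l. zcoef CARD('n) j k * abs_mom CARD('n) (\<alpha> + real (j - 2 * k))) =
    abs_mom CARD('n) \<beta> / pochhammer ((\<beta> + CARD('n)) / 2) l * (\<Sum>k\<le>l. zcoef CARD('n) j k *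
      (pochhammer ((\<beta> + 1) / 2) (l - k) * pochhammer ((\<beta> + CARD('n)) / 2 + real (l - k)) k))"
  unfolding sum_distrib_left
proof (intro sum.cong refl)
  let ?d = "CARD('n)" and ?q = "pochhammer ((\<beta> + CARD('n)) / 2)"
  fix k assume k: "k \<in> {..l}"
  have s: "\<alpha> + real (j - 2 * k) = \<beta> + 2 * real (l - k)"
    using k by (simp add: j \<alpha> of_nat_diff algebra_simps)
  have q: "?q l = ?q (l - k) * pochhammer ((\<beta> + ?d) / 2 + real (l - k)) k"
    using pochhammer_product[of "l - k" l "(\<beta> + ?d) / 2"] k by simp
  have "?q l > 0" using \<beta> by (intro pochhammer_pos) auto
  then have qk: "pochhammer ((\<beta> + ?d) / 2 + real (l - k)) k \<noteq> 0" unfolding q by auto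
  have "abs_mom ?d (\<beta> + 2 * real (l - k)) = abs_mom ?d \<beta> * pochhammer ((\<beta> + 1) / 2) (l - k) / ?q (l - k)"
    using \<beta> d by (intro abs_mom_shift) auto
  then show "zcoef ?d j k * abs_mom ?d (\<alpha> + real (j - 2 * k)) = abs_mom ?d \<beta> / ?q l *
      (zcoef ?d j k * (pochhammer ((\<beta> + 1) / 2) (l - k) * pochhammer ((\<beta> + ?d) / 2 + real (l - k)) k))"
    unfolding s q using qk by (simp add: ac_simps)
qed

text \<open>Both sides are polynomials in \<open>\<beta>\<close>. They agree at infinitely many
  points because, for integer exponents of the right parity, the signed power is a monomial whose
  integral against \<open>zpoly\<close> is known.\<close>

lemma funk_hecke_identity:
  fixes l e j :: nat and \<beta> :: real
  assumes e: "e = 0 \<or> e = 1"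
  defines "j \<equiv> 2 * l + e"
  shows "(\<Sum>k\<le>l. zcoef CARD('n) j k * (pochhammer ((\<beta> + 1) / 2) (l - k) * pochhammer ((\<beta> + CARD('n)) / 2 + real (l - k)) k)) =
    zpoly CARD('n) j 1 * (\<Prod>i<l. \<beta> / 2 - real e - real i)" (is "?L \<beta> = ?R \<beta>")
proof -
  let ?d = "CARD('n)"
  have jl: "j div 2 = l" "even (2 * n + e + j)" for n using e by (auto simp: j_def)
  define p where "p \<beta> = ?L \<beta> - ?R \<beta>" for \<beta>
  have lin: "real_polynomial_function (\<lambda>x. (x + a) / 2 + b)" for a b :: real
    by (intro real_polynomial_function.intros real_polynomial_function_divide) auto
  have lin2: "real_polynomial_function (\<lambda>x. x / 2 - a - b)" for a b :: real
    by (intro real_polynomial_function.intros real_polynomial_function_diff real_polynomial_function_divide) auto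
  have "real_polynomial_function p"
    unfolding p_def[abs_def] using lin[of _ 0]
    by (intro real_polynomial_function_diff real_polynomial_function_sum real_polynomial_function.intros(4)
       real_polynomial_function.intros(2) real_polynomial_function_prod real_polynomial_function_pochhammer lin lin2) simp_all
  moreover have "infinite {x. p x = 0}"
  proof
    have "p (real (2 * Suc n + 2 * e)) = 0" for n
    proof -
      \<comment> \<open>The parity of \<open>?m\<close> is that of \<open>j\<close>;
        \<open>Suc\<close> keeps it positive, as \<open>sgn_powr_nat\<close> requires.\<close>
      let ?m = "2 * Suc n + e"
      define \<beta> where "\<beta> = real ?m + real e"
      have \<beta>: "\<beta> > 0" by (simp add: \<beta>_def)
      let ?q = "pochhammer ((\<beta> + ?d) / 2)"
      have qpos: "?q i > 0" for i using \<beta> by (intro pochhammer_pos) auto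
      have "(\<Sum>k\<le>l. zcoef ?d j k * abs_mom ?d (real ?m + real (j - 2 * k))) =
          (SI v. sgn_powr j (real ?m) (u \<bullet> v) * zpoly ?d j (u \<bullet> v))"
        by (subst sgn_powr_zpoly_eq_sum) (simp_all add: jl)
      also have "\<dots> = (SI v. (u \<bullet> v) ^ ?m * zpoly ?d j (u \<bullet> v))"
      proof -
        have "sgn_powr j (real ?m) t = t ^ ?m" for t
          using jl(2)[of "Suc n"] by (intro sgn_powr_nat) auto
        then show ?thesis by (simp only:)
      qed
      also have "(SI v. (u \<bullet> v) ^ ?m * zpoly ?d j (u \<bullet> v)) = w_coef ?d j (real ?m) * zpoly ?d j 1"
        unfolding zpoly_moment mcoef_def using jl(2)[of "Suc n"] by simp
      also have "w_coef ?d j (real ?m) = abs_mom ?d \<beta> * (\<Prod>i<l. \<beta> / 2 - real e - real i) / ?q l"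
        unfolding j_def \<beta>_def using e d by (intro w_coef_prod) auto
      also have "(\<Sum>k\<le>l. zcoef ?d j k * abs_mom ?d (real ?m + real (j - 2 * k))) = abs_mom ?d \<beta> / ?q l * ?L \<beta>"
        by (rule abs_mom_sum[OF \<beta>]) (simp_all add: j_def \<beta>_def)
      finally have "abs_mom ?d \<beta> / ?q l * ?L \<beta> = abs_mom ?d \<beta> / ?q l * ?R \<beta>" by (simp add: ac_simps)
      moreover have "abs_mom ?d \<beta> / ?q l \<noteq> 0"
      proof -
        have "Gamma ((\<beta> + 1) / 2) > 0" "Gamma ((\<beta> + ?d) / 2) > 0"
          using \<beta> by (auto intro!: Gamma_real_pos)
        then have "abs_mom ?d \<beta> > 0" unfolding abs_mom_def by simp
        then show ?thesis using qpos[of l] by simp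
      qed
      ultimately have "?L \<beta> = ?R \<beta>" by (rule mult_left_cancel[THEN iffD1, rotated])
      then show ?thesis by (simp add: p_def \<beta>_def algebra_simps)
    qed
    then have "range (\<lambda>n. real (2 * Suc n + 2 * e)) \<subseteq> {x. p x = 0}" by auto
    moreover assume "finite {x. p x = 0}"
    ultimately have "finite (range (\<lambda>n. real (2 * Suc n + 2 * e)))" by (rule finite_subset)
    moreover have "inj (\<lambda>n. real (2 * Suc n + 2 * e))" by (auto simp: inj_def)
    ultimately show False using finite_imageD infinite_UNIV_nat by blast
  qed
  ultimately have "p \<beta> = 0" by (rule real_polynomial_function_eq_0)
  then show ?thesis by (simp add: p_def)
qed

text \<open>Multiplying the polynomial identity by the common factor of \<open>abs_mom_sum\<close>
  restores the integral on one side and, by \<open>w_coef_prod\<close>, the coefficient on the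
  other.\<close>

theorem funk_hecke_sgn_powr:
  assumes \<alpha>: "\<alpha> > 0"
  shows "(SI v. sgn_powr j \<alpha> (u \<bullet> v) * zpoly CARD('n) j (u \<bullet> v)) =
    w_coef CARD('n) j \<alpha> * zpoly CARD('n) j 1"
proof -
  let ?d = "CARD('n)"
  define l e where "l = j div 2" and "e = j mod 2"
  have j: "j = 2 * l + e" and e: "e = 0 \<or> e = 1" by (auto simp: l_def e_def)
  define \<beta> where "\<beta> = \<alpha> + real e"
  have \<beta>: "\<beta> > 0" using \<alpha> by (simp add: \<beta>_def)
  let ?q = "pochhammer ((\<beta> + ?d) / 2)"
  have "(SI v. sgn_powr j \<alpha> (u \<bullet> v) * zpoly ?d j (u \<bullet> v)) =
      (\<Sum>k\<le>l. zcoef ?d j k * abs_mom ?d (\<alpha> + real (j - 2 * k)))"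
    unfolding sgn_powr_zpoly_eq_sum[OF \<alpha>] l_def ..
  also have "\<dots> = abs_mom ?d \<beta> / ?q l * (zpoly ?d j 1 * (\<Prod>i<l. \<beta> / 2 - real e - real i))"
    unfolding abs_mom_sum[OF \<beta> j \<beta>_def] unfolding j funk_hecke_identity[OF e] ..
  also have "\<dots> = w_coef ?d j \<alpha> * zpoly ?d j 1"
    using w_coef_prod[of \<alpha> e ?d l] \<alpha> e d unfolding j[symmetric] \<beta>_def[symmetric] by simp
  finally show ?thesis .
qed

end

section \<open>The logarithmic kernel\<close>

lemma sum_inverse_odd: "(\<Sum>k<n. 1 / (2 * real k + 1)) = harm (2 * n) - harm n / 2"
proof (induction n)
  case (Suc n)
  have "harm (2 * Suc n) = harm (2 * n) + 1 / (2 * real n + 1) + 1 / (2 * real n + 2)"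
    by (simp add: harm_Suc inverse_eq_divide add.commute)
  moreover have "harm (Suc n) / 2 = harm n / 2 + 1 / (2 * real n + 2)"
    by (simp add: harm_Suc field_simps)
  ultimately show ?case using Suc unfolding sum.lessThan_Suc by linarith
qed (simp add: harm_def)

text \<open>The two parities of \<open>d\<close> are the values of Digamma at integers and
  half-integers. This uniform form is what differentiating \<open>w_coef\<close> produces.\<close>

lemma beta_d_eq: "beta_d d = 1 - euler_mascheroni / 2 - ln 2 - Digamma (real d / 2 + 1) / 2"
proof (cases "even d")
  case True
  then obtain n where n: "d = 2 * n" by (elim evenE)
  have "real d / 2 + 1 = of_nat (Suc n)" by (simp add: n)
  then have "Digamma (real d / 2 + 1) = harm n - euler_mascheroni" by (simp only: Digamma_of_nat)
  then show ?thesis by (simp add: beta_d_def n field_simps)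
next
  case False
  then have "\<exists>n. d + 1 = 2 * n" by presburger
  then obtain n where n: "d + 1 = 2 * n" by blast
  have "real (d + 1) = 2 * real n" unfolding n by simp
  then have "real d / 2 + 1 = of_nat n + 1/2" by simp
  then have "Digamma (real d / 2 + 1) = (\<Sum>k<n. 2 / real (2 * k + 1)) - euler_mascheroni - 2 * ln 2"
    by (simp only: Digamma_half_integer of_real_eq_id id_apply)
  also have "(\<Sum>k<n. 2 / real (2 * k + 1)) = 2 * (\<Sum>k<n. 1 / (2 * real k + 1))"
    by (simp add: sum_distrib_left add.commute)
  finally have "Digamma (real d / 2 + 1) = 2 * (harm (2 * n) - harm n / 2) - euler_mascheroni - 2 * ln 2"
    by (simp only: sum_inverse_odd)
  moreover have "beta_d d = 1 - harm (2 * n) + harm n / 2"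
    using False n by (simp add: beta_d_def)
  ultimately show ?thesis by (simp add: field_simps)
qed

text \<open>The origin of \<open>w_star\<close>: \<open>t * ln \<bar>t\<bar>\<close> is the
  derivative in \<alpha>, at 1, of the odd signed power, so its coefficients are the derivatives of
  \<open>w_coef\<close> there. For \<open>j = 1\<close> every factor depending on \<alpha>
  contributes.\<close>

lemma w_coef_has_derivative:
  assumes j: "odd j"
  shows "(w_coef d j has_real_derivative w_star d j) (at 1)"
proof -
  define z1 where "z1 = (real j + 1 + real d) / 2"
  define z2 where "z2 = (1 - real j) / 2 + 1"
  have z1: "z1 > 0" by (simp add: z1_def)
  have A: "((\<lambda>\<alpha>. Gamma (\<alpha> + 1)) has_real_derivative 1 - euler_mascheroni) (at 1)"
  proof -
    have "Digamma (2::real) = 1 - euler_mascheroni"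
      using Digamma_of_nat[of 1, where 'a=real] by (simp add: harm_def)
    moreover have "Gamma (2::real) = 1" using Gamma_fact[of 1, where 'a=real] by simp
    ultimately have "(Gamma has_real_derivative 1 - euler_mascheroni) (at (1 + 1))"
      using has_field_derivative_Gamma[of "2::real" UNIV] by (simp add: real_not_nonpos_Int)
    then show ?thesis by (subst (asm) DERIV_shift)
  qed
  have B: "((\<lambda>\<alpha>. rGamma ((real j + \<alpha> + real d) / 2)) has_real_derivative (- rGamma z1 * Digamma z1) * (1 / 2)) (at 1)"
  proof (rule DERIV_chain2[where f=rGamma and g="\<lambda>\<alpha>. (real j + \<alpha> + real d) / 2"])
    show "(rGamma has_real_derivative - rGamma z1 * Digamma z1) (at ((real j + 1 + real d) / 2))"
      unfolding z1_def[symmetric] using z1 by (intro has_field_derivative_rGamma_no_nonpos_int real_not_nonpos_Int)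
  qed (auto intro!: derivative_eq_intros)
  have C: "((\<lambda>\<alpha>. rGamma ((\<alpha> - real j) / 2 + 1)) has_real_derivative D * (1 / 2)) (at 1)"
    if "(rGamma has_real_derivative D) (at z2)" for D
  proof (rule DERIV_chain2[where f=rGamma and g="\<lambda>\<alpha>. (\<alpha> - real j) / 2 + 1"])
    show "(rGamma has_real_derivative D) (at ((1 - real j) / 2 + 1))" using that unfolding z2_def .
  qed (auto intro!: derivative_eq_intros)
  have E: "((\<lambda>\<alpha>. 2 powr (1 - \<alpha>)) has_real_derivative - ln 2) (at 1)"
    unfolding powr_def by (auto intro!: derivative_eq_intros)
  have w: "w_coef d j = (\<lambda>\<alpha>. pi powr (real d / 2) * (Gamma (\<alpha> + 1) * (rGamma ((real j + \<alpha> + real d) / 2) *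
      (rGamma ((\<alpha> - real j) / 2 + 1) * 2 powr (1 - \<alpha>)))))"
    by (auto simp: w_coef_def fun_eq_iff powr_diff)
  have G2: "Gamma (2 :: real) = 1" using Gamma_fact[of 1, where 'a=real] by simp
  let ?V = "\<lambda>D. pi powr (real d / 2) * ((1 - euler_mascheroni) * (rGamma z1 * (rGamma z2 * 1)) +
     ((- rGamma z1 * Digamma z1) * (1 / 2) * (rGamma z2 * 1) + (D * (1/2) * 1 + (- ln 2) * rGamma z2) * rGamma z1) * 1)"
  have main: "(w_coef d j has_real_derivative ?V D) (at 1)"
    if "(rGamma has_real_derivative D) (at z2)" for D
    unfolding w
    by (rule DERIV_cong[OF DERIV_cmult[OF DERIV_mult[OF A DERIV_mult[OF B DERIV_mult[OF C[OF that] E]]]]])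
       (simp add: G2 z1_def[symmetric] z2_def[symmetric])
  show ?thesis
  proof (cases "j = 1")
    case True
    have z2: "z2 = 1" by (simp add: z2_def True)
    have "Digamma (1::real) = - euler_mascheroni" using Digamma_of_nat[of 0, where 'a=real] by (simp add: harm_def)
    moreover have r1: "rGamma (1::real) = 1" by simp
    ultimately have "(rGamma has_real_derivative euler_mascheroni) (at z2)"
      unfolding z2 using has_field_derivative_rGamma_no_nonpos_int[of "1::real" UNIV] by (simp add: real_not_nonpos_Int)
    from main[OF this] show ?thesis
    proof (rule DERIV_cong)
      have z1': "z1 = real d / 2 + 1" by (simp add: z1_def True)
      show "?V euler_mascheroni = w_star d j"
      proof -
        have "w_star d j = pi powr (real d / 2) * rGamma z1 * (1 - euler_mascheroni / 2 - ln 2 - Digamma z1 / 2)"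
          unfolding w_star_def beta_d_eq z1' rGamma_inverse_Gamma by (simp only: True simp_thms if_True divide_inverse)
        moreover have "p * ((1 - g) * (i * (1 * 1)) + ((- i * \<psi>) * (1 / 2) * (1 * 1) + (g * (1/2) * 1 + (- L) * 1) * i) * 1) =
            p * i * (1 - g / 2 - L - \<psi> / 2)" for p g i \<psi> L :: real
          by (simp add: field_simps)
        ultimately show ?thesis unfolding z2 r1 by (simp only:)
      qed
    qed
  next
    case False
    with j have "\<exists>n. j = 2 * n + 3" by presburger
    then obtain n where n: "j = 2 * n + 3" by blast
    \<comment> \<open>For odd \<open>j > 1\<close> the second reciprocal Gamma factor vanishes at 1,
      so only the term containing its derivative survives.\<close>
    have z2: "z2 = - of_nat n" by (simp add: z2_def n field_simps)
    have r0: "rGamma z2 = 0" unfolding z2 by (simp add: rGamma_eq_zero_iff)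
    have "(rGamma has_real_derivative (-1) ^ n * fact n) (at z2)"
      unfolding z2 by (rule has_field_derivative_rGamma_nonpos_int)
    from main[OF this] show ?thesis
    proof (rule DERIV_cong)
      have "(real j - 1) / 2 = 1 + of_nat n" by (simp add: n)
      then have "Gamma ((real j - 1) / 2) = fact n" by (simp only: Gamma_fact)
      moreover have "(real d + 1 + real j) / 2 = z1" by (simp add: z1_def)
      moreover have "(j - 3) div 2 = n" by (simp add: n)
      ultimately have w: "w_star d j = (- 1) ^ n * pi powr (real d / 2) * fact n / (2 * Gamma z1)"
        unfolding w_star_def using False by (simp only: if_False)
      have "p * (c * (1 / G * (0 * 1)) + ((- (1 / G) * \<psi>) * (1 / 2) * (0 * 1) + (s * f * (1/2) * 1 + (- L) * 0) * (1 / G)) * 1) =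
          s * p * f / (2 * G)" for p c G \<psi> s f L :: real
        by simp
      then show "?V ((-1) ^ n * fact n) = w_star d j"
        unfolding w r0 rGamma_inverse_Gamma[of z1] inverse_eq_divide .
    qed
  qed
qed

text \<open>Dominated convergence needs a sequence; positive steps keep the exponents above
  1.\<close>

lemma has_derivative_imp_seq:
  assumes "(f has_real_derivative D) (at a)"
  shows "(\<lambda>n. (f (a + inverse (real (Suc n))) - f a) / inverse (real (Suc n))) \<longlonglongrightarrow> D"
proof -
  have "(\<lambda>h. (f (a + h) - f a) / h) \<midarrow>0\<rightarrow> D" using assms by (simp add: DERIV_def)
  moreover have "filterlim (\<lambda>n. inverse (real (Suc n))) (at 0) sequentially"
    using LIMSEQ_inverse_real_of_nat by (auto simp: filterlim_at)
  ultimately show ?thesis by (rule filterlim_compose)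
qed

text \<open>The dominating constant, uniform in the step. For \<open>s = \<bar>t\<bar> > 0\<close>,
  the chain \<open>1 - s powr h \<le> - h * ln s \<le> h * (1 / s - 1)\<close> multiplied by
  \<open>s\<close> gives a bound by \<open>h\<close>.\<close>

lemma powr_quotient_bound:
  fixes t h :: real
  assumes t: "\<bar>t\<bar> \<le> 1" and h: "h > 0"
  shows "\<bar>(\<bar>t\<bar> powr (1 + h) - \<bar>t\<bar>) / h\<bar> \<le> 1"
proof (cases "t = 0")
  case False
  define s where "s = \<bar>t\<bar>"
  have s: "0 < s" "s \<le> 1" using t False by (auto simp: s_def)
  have "1 + h * ln s \<le> s powr h" unfolding powr_def using s exp_ge_add_one_self[of "h * ln s"] by simp
  then have "1 - s powr h \<le> h * (- ln s)" by simp
  also have "\<dots> \<le> h * (1 / s - 1)"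
    using h s ln_le_minus_one[of "1 / s"] by (intro mult_left_mono) (auto simp: ln_div)
  finally have "1 - s powr h \<le> h * (1 / s - 1)" .
  then have "s * (1 - s powr h) \<le> s * (h * (1 / s - 1))" using s by (intro mult_left_mono) auto
  also have "\<dots> = h * (1 - s)" using s by (simp add: field_simps)
  also have "\<dots> \<le> h * 1" using s h by (intro mult_left_mono) auto
  finally have "s * (1 - s powr h) \<le> h" by simp
  moreover have "s powr h \<le> 1" using s h by (simp add: powr_le_one_le powr_le1)
  then have "s * (1 - s powr h) \<ge> 0" using s by simp
  moreover have "s powr (1 + h) - s = - (s * (1 - s powr h))" using s by (simp add: powr_add algebra_simps)
  ultimately show ?thesis using h unfolding s_def[symmetric] by (simp add: abs_divide)
qed (use h in simp)

text \<open>Difference quotients in the exponent pass to the limit on both sides: under the integral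
  by dominated convergence, and in the coefficient by differentiability of
  \<open>w_coef\<close>.\<close>

theorem funk_hecke_log:
  fixes u :: "real^'n"
  assumes u: "norm u = 1" and d: "CARD('n) \<ge> 2" and j: "odd j"
  shows "(SI v. ((u \<bullet> v) * ln \<bar>u \<bullet> v\<bar>) * zpoly CARD('n) j (u \<bullet> v)) =
    w_star CARD('n) j * zpoly CARD('n) j 1"
proof -
  let ?d = "CARD('n)" and ?h = "\<lambda>n. inverse (real (Suc n))"
  let ?z = "\<lambda>v. zpoly ?d j (u \<bullet> v)"
  let ?f = "\<lambda>n t. (sgn_powr j (1 + ?h n) t - sgn_powr j 1 t) / ?h n"
  have c: "continuous_on {-1..1} (?f n)" for n
    by (intro continuous_intros continuous_sgn_powr) (auto simp: add_pos_pos)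
  have cz: "continuous_on {-1..1} (zpoly ?d j)" by (rule continuous_zpoly)
  have lim: "(\<lambda>n. ?f n t) \<longlonglongrightarrow> t * ln \<bar>t\<bar>" for t
  proof (cases "t = 0")
    case False
    have "((\<lambda>\<alpha>. \<bar>t\<bar> powr \<alpha>) has_real_derivative \<bar>t\<bar> powr 1 * ln \<bar>t\<bar>) (at 1)"
      using False by (auto intro!: derivative_eq_intros)
    from DERIV_cmult_right[OF this, of "sgn t"]
    have "((\<lambda>\<alpha>. sgn_powr j \<alpha> t) has_real_derivative \<bar>t\<bar> powr 1 * ln \<bar>t\<bar> * sgn t) (at 1)"
      using j by (simp add: sgn_powr_def)
    then have "((\<lambda>\<alpha>. sgn_powr j \<alpha> t) has_real_derivative t * ln \<bar>t\<bar>) (at 1)"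
      by (rule DERIV_cong) (simp add: sgn_if)
    from has_derivative_imp_seq[OF this] show ?thesis .
  qed (simp add: sgn_powr_def)
  have bound: "\<bar>?f n t\<bar> \<le> 1" if "t \<in> {-1..1}" for n t
  proof -
    have "?f n t = sgn t * ((\<bar>t\<bar> powr (1 + ?h n) - \<bar>t\<bar>) / ?h n)"
      using j by (simp add: sgn_powr_def algebra_simps diff_divide_distrib)
    moreover have "\<bar>sgn t\<bar> \<le> 1" by (simp add: sgn_if)
    moreover have "\<bar>(\<bar>t\<bar> powr (1 + ?h n) - \<bar>t\<bar>) / ?h n\<bar> \<le> 1"
      using that by (intro powr_quotient_bound) auto
    ultimately show ?thesis by (simp only: abs_mult) (intro mult_le_one; simp)
  qed
  have "(\<lambda>n. LINT v|\<omega>. ?f n (u \<bullet> v) * ?z v) \<longlonglongrightarrow> (SI v. ((u \<bullet> v) * ln \<bar>u \<bullet> v\<bar>) * ?z v)"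
  proof (rule integral_dominated_convergence)
    have [measurable]: "(\<lambda>v. u \<bullet> v) \<in> borel_measurable \<omega>" by (rule sphere_inner_measurable[OF u])
    have z [measurable]: "?z \<in> borel_measurable \<omega>"
      using integrable_sphere_inner[OF u cz] by simp
    show "(\<lambda>v. ((u \<bullet> v) * ln \<bar>u \<bullet> v\<bar>) * ?z v) \<in> borel_measurable \<omega>" by measurable
    show "(\<lambda>v. ?f n (u \<bullet> v) * ?z v) \<in> borel_measurable \<omega>" for n
      using integrable_sphere_inner[OF u c[of n]] by (intro borel_measurable_times z) simp
    show "integrable \<omega> (\<lambda>v. \<bar>?z v\<bar>)"
      using integrable_sphere_inner[OF u cz] by simp
    show "AE v in \<omega>. (\<lambda>n. ?f n (u \<bullet> v) * ?z v) \<longlonglongrightarrow> ((u \<bullet> v) * ln \<bar>u \<bullet> v\<bar>) * ?z v"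
      by (intro AE_I2 tendsto_mult lim tendsto_const)
    show "AE v in \<omega>. norm (?f n (u \<bullet> v) * ?z v) \<le> \<bar>?z v\<bar>" for n
    proof (rule AE_I2)
      fix v assume "v \<in> space (\<omega> :: (real^'n) measure)"
      then have "\<bar>?f n (u \<bullet> v)\<bar> \<le> 1" by (intro bound sphere_inner_bound u)
      then have "\<bar>?f n (u \<bullet> v)\<bar> * \<bar>?z v\<bar> \<le> 1 * \<bar>?z v\<bar>" by (intro mult_right_mono) auto
      then show "norm (?f n (u \<bullet> v) * ?z v) \<le> \<bar>?z v\<bar>" by (simp only: real_norm_def abs_mult mult_1)
    qed
  qed
  moreover have "(SI v. ?f n (u \<bullet> v) * ?z v) =
      (w_coef ?d j (1 + ?h n) - w_coef ?d j 1) / ?h n * zpoly ?d j 1" for n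
  proof -
    have i: "integrable \<omega> (\<lambda>v. sgn_powr j \<alpha> (u \<bullet> v) * ?z v)" if "\<alpha> > 0" for \<alpha>
      using that integrable_sphere_inner[OF u, of "\<lambda>t. sgn_powr j \<alpha> t * zpoly ?d j t"]
      by (simp add: continuous_on_mult continuous_sgn_powr continuous_zpoly)
    have h: "1 + ?h n > 0" by (simp add: add_pos_pos)
    have "?f n (u \<bullet> v) * ?z v = (sgn_powr j (1 + ?h n) (u \<bullet> v) * ?z v - sgn_powr j 1 (u \<bullet> v) * ?z v) / ?h n" for v
      by (simp add: algebra_simps)
    then have "(SI v. ?f n (u \<bullet> v) * ?z v) =
       ((SI v. sgn_powr j (1 + ?h n) (u \<bullet> v) * ?z v) - (SI v. sgn_powr j 1 (u \<bullet> v) * ?z v)) / ?h n"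
      using i[OF h] i[of 1] by (simp only: integral_divide_zero LINT_diff zero_less_one)
    also have "\<dots> = (w_coef ?d j (1 + ?h n) - w_coef ?d j 1) / ?h n * zpoly ?d j 1"
      unfolding funk_hecke_sgn_powr[OF u d h] funk_hecke_sgn_powr[OF u d zero_less_one] by (simp add: algebra_simps)
    finally show ?thesis .
  qed
  moreover have "(\<lambda>n. (w_coef ?d j (1 + ?h n) - w_coef ?d j 1) / ?h n * zpoly ?d j 1) \<longlonglongrightarrow> w_star ?d j * zpoly ?d j 1"
    by (intro tendsto_mult tendsto_const has_derivative_imp_seq w_coef_has_derivative j)
  ultimately show ?thesis by (simp only:) (rule LIMSEQ_unique)
qed

section \<open>Expansion of zonal functions\<close>

text \<open>Replaces Cauchy-Schwarz without square roots; the free parameter \<open>t\<close> is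
  chosen at each use.\<close>

lemma integral_mult_young:
  fixes f P :: "'a \<Rightarrow> real"
  assumes "integrable M (\<lambda>x. f x * f x)" "integrable M (\<lambda>x. P x * P x)" "integrable M (\<lambda>x. f x * P x)" and t: "t > 0"
  shows "\<bar>LINT x|M. f x * P x\<bar> \<le> (t * (LINT x|M. f x * f x) + (LINT x|M. P x * P x) / t) / 2"
proof -
  have "\<bar>LINT x|M. f x * P x\<bar> \<le> (LINT x|M. \<bar>f x * P x\<bar>)" by (rule integral_abs_bound)
  also have "\<dots> \<le> (LINT x|M. (t * (f x * f x) + (P x * P x) / t) / 2)"
  proof (rule integral_mono)
    show "\<bar>f x * P x\<bar> \<le> (t * (f x * f x) + (P x * P x) / t) / 2" for x
    proof -
      have "0 \<le> (t * \<bar>f x\<bar> - \<bar>P x\<bar>)\<^sup>2 / t" using t by simp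
      also have "\<dots> = t * (f x * f x) + (P x * P x) / t - 2 * \<bar>f x * P x\<bar>"
        using t by (simp add: power2_eq_square field_simps abs_mult)
      finally show ?thesis by simp
    qed
  qed (use assms in auto)
  also have "\<dots> = (t * (LINT x|M. f x * f x) + (LINT x|M. P x * P x) / t) / 2"
    using assms by simp
  finally show ?thesis .
qed

text \<open>Coefficients enter as \<open>c j * N j\<close>, so nothing is divided by the squared
  norms \<open>N j\<close>. Orthogonality makes the \<open>c\<close>-sum the best approximation,
  hence \<open>dens\<close> forces its error to 0.\<close>

theorem orthogonal_expansion:
  fixes q P :: "'a \<Rightarrow> real" and e :: "nat \<Rightarrow> 'a \<Rightarrow> real" and c N :: "nat \<Rightarrow> real"
  assumes int: "\<And>f g. f \<in> {q, P} \<union> range e \<Longrightarrow> g \<in> {q, P} \<union> range e \<Longrightarrow> integrable M (\<lambda>x. f x * g x)"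
    and orth: "\<And>i j. (LINT x|M. e i x * e j x) = (if i = j then N j else 0)"
    and coef: "\<And>j. (LINT x|M. q x * e j x) = c j * N j"
    and dens: "\<And>\<epsilon>. \<epsilon> > 0 \<Longrightarrow> \<exists>n a. (LINT x|M. (q x - (\<Sum>j<n. a j * e j x))\<^sup>2) < \<epsilon>"
  shows "summable (\<lambda>j. \<bar>c j * (LINT x|M. e j x * P x)\<bar>)"
    and "(\<lambda>j. c j * (LINT x|M. e j x * P x)) sums (LINT x|M. q x * P x)"
proof -
  let ?p = "\<lambda>j. LINT x|M. e j x * P x"
  let ?S = "\<lambda>n a x. \<Sum>j<n. a j * e j x"
  define A B where "A = (LINT x|M. q x * q x)" and "B = (LINT x|M. P x * P x)"
  have B: "B \<ge> 0" unfolding B_def by (rule integral_nonneg_AE) simp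
  have N: "N j \<ge> 0" for j using orth[of j j] integral_nonneg_AE[of "\<lambda>x. e j x * e j x" M] by simp
  have i [simp]: "integrable M (\<lambda>x. e i x * e j x)" "integrable M (\<lambda>x. q x * e j x)" "integrable M (\<lambda>x. e j x * P x)"
    "integrable M (\<lambda>x. q x * q x)" "integrable M (\<lambda>x. P x * P x)" "integrable M (\<lambda>x. q x * P x)" for i j
    by (auto intro: int)
  have SS: "integrable M (\<lambda>x. ?S n a x * ?S n a x)" "(LINT x|M. ?S n a x * ?S n a x) = (\<Sum>j<n. (a j)\<^sup>2 * N j)" for n a
  proof -
    have eq: "?S n a x * ?S n a x = (\<Sum>i<n. \<Sum>j<n. a i * a j * (e i x * e j x))" for x
      by (simp add: sum_product ac_simps)
    show "integrable M (\<lambda>x. ?S n a x * ?S n a x)"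
      unfolding eq by (intro Bochner_Integration.integrable_sum integrable_mult_right i)
    have "(LINT x|M. ?S n a x * ?S n a x) = (\<Sum>i<n. \<Sum>j<n. a i * a j * (LINT x|M. e i x * e j x))"
      unfolding eq by simp
    also have "\<dots> = (\<Sum>i<n. \<Sum>j<n. if i = j then a i * a j * N j else 0)"
      unfolding orth by (intro sum.cong refl) auto
    also have "\<dots> = (\<Sum>j<n. (a j)\<^sup>2 * N j)"
      by (intro sum.cong refl) (simp add: power2_eq_square)
    finally show "(LINT x|M. ?S n a x * ?S n a x) = (\<Sum>j<n. (a j)\<^sup>2 * N j)" .
  qed
  have qS: "integrable M (\<lambda>x. q x * ?S n a x)" "(LINT x|M. q x * ?S n a x) = (\<Sum>j<n. a j * c j * N j)" for n a
  proof -
    have eq: "q x * ?S n a x = (\<Sum>j<n. a j * (q x * e j x))" for x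
      by (simp add: sum_distrib_left ac_simps)
    show "integrable M (\<lambda>x. q x * ?S n a x)" unfolding eq by (intro Bochner_Integration.integrable_sum integrable_mult_right i)
    show "(LINT x|M. q x * ?S n a x) = (\<Sum>j<n. a j * c j * N j)"
      unfolding eq by (simp add: coef mult.assoc)
  qed
  have SP: "integrable M (\<lambda>x. ?S n a x * P x)" "(LINT x|M. ?S n a x * P x) = (\<Sum>j<n. a j * ?p j)" for n a
  proof -
    have eq: "?S n a x * P x = (\<Sum>j<n. a j * (e j x * P x))" for x
      by (simp add: sum_distrib_left ac_simps)
    show "integrable M (\<lambda>x. ?S n a x * P x)" unfolding eq by (intro Bochner_Integration.integrable_sum integrable_mult_right i)
    show "(LINT x|M. ?S n a x * P x) = (\<Sum>j<n. a j * ?p j)"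
      unfolding eq by simp
  qed
  \<comment> \<open>The squared distance from \<open>q\<close> to its partial sum. By Pythagoras
    (\<open>D\<close>) any other coefficients only increase the error.\<close>
  define r where "r n = A - (\<Sum>j<n. (c j)\<^sup>2 * N j)" for n
  have D: "integrable M (\<lambda>x. (q x - ?S n a x) * (q x - ?S n a x))"
    "(LINT x|M. (q x - ?S n a x) * (q x - ?S n a x)) = r n + (\<Sum>j<n. (a j - c j)\<^sup>2 * N j)" for n a
  proof -
    have eq: "(q x - ?S n a x) * (q x - ?S n a x) = q x * q x - 2 * (q x * ?S n a x) + ?S n a x * ?S n a x" for x
      by (simp add: algebra_simps)
    show "integrable M (\<lambda>x. (q x - ?S n a x) * (q x - ?S n a x))"
      unfolding eq by (intro LINT_integrable_add LINT_integrable_diff integrable_mult_right i SS qS)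
    have "(LINT x|M. (q x - ?S n a x) * (q x - ?S n a x)) = A - 2 * (\<Sum>j<n. a j * c j * N j) + (\<Sum>j<n. (a j)\<^sup>2 * N j)"
    proof -
      have ia: "integrable M (\<lambda>x. 2 * (q x * ?S n a x))" by (rule integrable_mult_right[OF qS(1)])
      show ?thesis
        unfolding eq A_def SS(2)[symmetric] qS(2)[symmetric]
          LINT_add[OF LINT_integrable_diff[OF i(4) ia] SS(1)]
          LINT_diff[OF i(4) ia] integral_mult_right_zero ..
    qed
    also have "\<dots> = r n + (\<Sum>j<n. (a j - c j)\<^sup>2 * N j)"
    proof -
      have "(a j - c j)\<^sup>2 * N j = (a j)\<^sup>2 * N j - 2 * (a j * c j * N j) + (c j)\<^sup>2 * N j" for j
        by (simp add: power2_eq_square algebra_simps)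
      then have "(\<Sum>j<n. (a j - c j)\<^sup>2 * N j) = (\<Sum>j<n. (a j)\<^sup>2 * N j) - 2 * (\<Sum>j<n. a j * c j * N j) + (\<Sum>j<n. (c j)\<^sup>2 * N j)"
        by (simp only: sum.distrib sum_subtractf sum_distrib_left)
      then show ?thesis unfolding r_def by linarith
    qed
    finally show "(LINT x|M. (q x - ?S n a x) * (q x - ?S n a x)) = r n + (\<Sum>j<n. (a j - c j)\<^sup>2 * N j)" .
  qed
  have r0: "r n = (LINT x|M. (q x - ?S n c x) * (q x - ?S n c x))" for n using D(2)[where n=n and a=c] by simp
  have rpos: "r n \<ge> 0" for n unfolding r0 by (rule integral_nonneg_AE) simp
  have rdec: "r m \<le> r n" if "n \<le> m" for n m
    unfolding r_def using that N by (intro diff_left_mono sum_mono2) auto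
  show "summable (\<lambda>j. \<bar>c j * ?p j\<bar>)"
  proof (rule bounded_imp_summable)
    show "(\<Sum>j\<le>n. \<bar>c j * ?p j\<bar>) \<le> (A + B) / 2" for n
    proof -
      \<comment> \<open>The signs turn the pairing with \<open>P\<close> into the sum of absolute
        values, while the norm of the combination is still bounded by Bessel's inequality.\<close>
      let ?a = "\<lambda>j. sgn (c j * ?p j) * c j"
      have "(LINT x|M. ?S (Suc n) ?a x * ?S (Suc n) ?a x) = (\<Sum>j<Suc n. (?a j)\<^sup>2 * N j)" by (rule SS(2))
      also have "\<dots> \<le> (\<Sum>j<Suc n. (c j)\<^sup>2 * N j)"
      proof (intro sum_mono mult_right_mono N)
        fix j
        have "(?a j)\<^sup>2 = (sgn (c j * ?p j))\<^sup>2 * (c j)\<^sup>2" by (simp add: power_mult_distrib)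
        also have "\<dots> \<le> 1 * (c j)\<^sup>2" by (intro mult_right_mono) (auto simp: sgn_if)
        finally show "(?a j)\<^sup>2 \<le> (c j)\<^sup>2" by simp
      qed
      also have "\<dots> \<le> A" using rpos[of "Suc n"] by (simp add: r_def)
      finally have SA: "(LINT x|M. ?S (Suc n) ?a x * ?S (Suc n) ?a x) \<le> A" .
      have "(\<Sum>j\<le>n. \<bar>c j * ?p j\<bar>) = (\<Sum>j<Suc n. ?a j * ?p j)"
        unfolding lessThan_Suc_atMost by (intro sum.cong refl) (subst abs_sgn, simp only: ac_simps)
      also have "\<dots> = (LINT x|M. ?S (Suc n) ?a x * P x)" by (simp only: SP(2))
      also have "\<dots> \<le> \<bar>LINT x|M. ?S (Suc n) ?a x * P x\<bar>" by (rule abs_ge_self)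
      also have "\<dots> \<le> (1 * (LINT x|M. ?S (Suc n) ?a x * ?S (Suc n) ?a x) + B / 1) / 2"
        unfolding B_def by (rule integral_mult_young[OF SS(1) i(5) SP(1) zero_less_one])
      also have "\<dots> \<le> (A + B) / 2" using SA by simp
      finally show ?thesis .
    qed
  qed simp
  show "(\<lambda>j. c j * ?p j) sums (LINT x|M. q x * P x)"
    unfolding sums_def
  proof (rule LIMSEQ_I)
    fix \<epsilon> :: real assume \<epsilon>: "\<epsilon> > 0"
    \<comment> \<open>Chosen so that \<open>B / t < \<epsilon>\<close> even if \<open>B = 0\<close>;
      an approximation error below \<open>\<epsilon> / t\<close> then makes both halves of Young's
      bound smaller than \<epsilon>.\<close>
    define t where "t = (B + 1) / \<epsilon>"
    have t0: "t > 0" using B \<epsilon> by (simp add: t_def)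
    have "\<epsilon> * t = B + 1" using \<epsilon> by (simp add: t_def)
    then have t: "t > 0" "B / t < \<epsilon>" using t0 by (simp_all add: pos_divide_less_eq)
    obtain n a where n: "(LINT x|M. (q x - ?S n a x)\<^sup>2) < \<epsilon> / t" using dens[of "\<epsilon> / t"] \<epsilon> t by auto
    have "r n \<le> r n + (\<Sum>j<n. (a j - c j)\<^sup>2 * N j)" using N by (simp add: sum_nonneg)
    also have "\<dots> = (LINT x|M. (q x - ?S n a x) * (q x - ?S n a x))" by (rule D(2)[symmetric])
    also have "\<dots> < \<epsilon> / t" using n by (simp only: power2_eq_square)
    finally have rn: "r n < \<epsilon> / t" .
    show "\<exists>no. \<forall>m\<ge>no. norm ((\<Sum>j<m. c j * ?p j) - (LINT x|M. q x * P x)) < \<epsilon>"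
    proof (intro exI allI impI)
      fix m assume m: "n \<le> m"
      have "(LINT x|M. (q x - ?S m c x) * P x) = (LINT x|M. q x * P x) - (\<Sum>j<m. c j * ?p j)"
        unfolding SP(2)[symmetric] left_diff_distrib by (rule LINT_diff) (rule i SP(1))+
      then have "norm ((\<Sum>j<m. c j * ?p j) - (LINT x|M. q x * P x)) = \<bar>LINT x|M. (q x - ?S m c x) * P x\<bar>"
        by (simp add: abs_minus_commute)
      also have "\<dots> \<le> (t * (LINT x|M. (q x - ?S m c x) * (q x - ?S m c x)) + B / t) / 2"
        unfolding B_def
      proof (intro integral_mult_young D(1) i t)
        show "integrable M (\<lambda>x. (q x - ?S m c x) * P x)"
          unfolding left_diff_distrib by (intro LINT_integrable_diff i SP(1))
      qed
      also have "\<dots> = (t * r m + B / t) / 2" unfolding r0 ..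
      also have "\<dots> < \<epsilon>"
      proof -
        have avg: "(X + Y) / 2 < \<epsilon>" if "X < \<epsilon>" "Y < \<epsilon>" for X Y using that by simp
        have "t * r m \<le> t * r n" using t rdec[OF m] by (intro mult_left_mono) auto
        also have "\<dots> < \<epsilon>" using rn t by (simp add: field_simps)
        finally show ?thesis using t(2) by (rule avg)
      qed
      finally show "norm ((\<Sum>j<m. c j * ?p j) - (LINT x|M. q x * P x)) < \<epsilon>" .
    qed
  qed
qed

section \<open>Polynomials as combinations of zonal polynomials, and the resulting expansion\<close>

definition zspan :: "nat \<Rightarrow> nat \<Rightarrow> (real \<Rightarrow> real) \<Rightarrow> bool" where
  "zspan d n p \<longleftrightarrow> (\<exists>a. \<forall>t. p t = (\<Sum>j<n. a j * zpoly d j t))"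

lemma zspan_add: "zspan d n p \<Longrightarrow> zspan d n q \<Longrightarrow> zspan d n (\<lambda>t. p t + q t)"
  unfolding zspan_def by (elim exE, rule_tac x="\<lambda>j. a j + aa j" in exI) (simp add: sum.distrib distrib_right)

lemma zspan_cmult: "zspan d n p \<Longrightarrow> zspan d n (\<lambda>t. c * p t)"
  unfolding zspan_def by (elim exE, rule_tac x="\<lambda>j. c * a j" in exI) (simp add: sum_distrib_left mult.assoc)

lemma zspan_sum: "(\<And>i. i \<in> I \<Longrightarrow> zspan d n (p i)) \<Longrightarrow> zspan d n (\<lambda>t. \<Sum>i\<in>I. p i t)"
proof (induction I rule: infinite_finite_induct)
  case empty
  show ?case unfolding zspan_def by (rule exI[of _ "\<lambda>_. 0"]) simp
next
  case (infinite A)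
  show ?case unfolding zspan_def using infinite by (intro exI[of _ "\<lambda>_. 0"]) simp
qed (auto intro: zspan_add)

lemma zspan_mono:
  assumes "zspan d n p" "n \<le> m" shows "zspan d m p"
proof -
  from assms(1) obtain a where a: "p t = (\<Sum>j<n. a j * zpoly d j t)" for t unfolding zspan_def by blast
  have "p t = (\<Sum>j<m. (if j < n then a j else 0) * zpoly d j t)" for t
    unfolding a using assms(2) by (intro sum.mono_neutral_cong_left) auto
  then show ?thesis unfolding zspan_def by (intro exI[of _ "\<lambda>j. if j < n then a j else 0"]) auto
qed

lemma zspan_zpoly: "j < n \<Longrightarrow> zspan d n (zpoly d j)"
  unfolding zspan_def by (intro exI[of _ "\<lambda>i. if i = j then 1 else 0"]) (simp add: if_distrib[of "\<lambda>x. x * _"] cong: if_cong)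

text \<open>Triangularity: \<open>zpoly d i\<close> has nonzero leading coefficient, so it can be
  solved for \<open>t ^ i\<close> in terms of lower powers.\<close>

lemma zspan_power:
  assumes d: "d > 0" shows "zspan d (Suc i) (\<lambda>t. t ^ i)"
proof (induction i rule: less_induct)
  case (less i)
  have z0: "zcoef d i 0 \<noteq> 0" using w_coef_diag_pos[OF d, of i] by simp
  have eq: "t ^ i = 1 / zcoef d i 0 * zpoly d i t + (\<Sum>k\<in>{..i div 2} - {0}. (- zcoef d i k / zcoef d i 0) * t ^ (i - 2 * k))" for t
  proof -
    have "zpoly d i t = zcoef d i 0 * t ^ i + (\<Sum>k\<in>{..i div 2} - {0}. zcoef d i k * t ^ (i - 2 * k))"
      unfolding zpoly_def by (subst sum.remove[of _ 0]) simp_all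
    then have "1 / zcoef d i 0 * zpoly d i t = t ^ i + (\<Sum>k\<in>{..i div 2} - {0}. (zcoef d i k / zcoef d i 0) * t ^ (i - 2 * k))"
      using z0 by (simp add: distrib_left sum_divide_distrib add_divide_distrib del: zcoef.simps)
    then show ?thesis by (simp add: sum_negf del: zcoef.simps)
  qed
  have "zspan d (Suc i) (\<lambda>t. t ^ (i - 2 * k))" if "k \<in> {..i div 2} - {0}" for k
    using that by (intro zspan_mono[OF less.IH]) auto
  then show ?case unfolding eq by (intro zspan_add zspan_cmult zspan_sum zspan_zpoly) auto
qed

lemma zpoly_minus: "zpoly d j (- t) = (-1) ^ j * zpoly d j t"
  unfolding zpoly_def sum_distrib_left
proof (intro sum.cong refl)
  fix k assume "k \<in> {..j div 2}"
  then have "even (j - 2 * k) = even j" by auto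
  then have "(-1::real) ^ j = (-1) ^ (j - 2 * k)" by (simp add: minus_one_power_iff)
  then show "zcoef d j k * (- t) ^ (j - 2 * k) = (-1) ^ j * (zcoef d j k * t ^ (j - 2 * k))"
    by (simp add: power_minus[of t])
qed

text \<open>The orthogonal family is \<open>zpoly\<close> along the fixed direction
  \<open>u\<close>. Density holds for zonal functions because a uniformly close polynomial in
  \<open>u \<bullet> v\<close> is a finite combination of this family.\<close>

theorem sphere_zonal_expansion:
  fixes u :: "real^'n" and q :: "real \<Rightarrow> real" and P :: "real^'n \<Rightarrow> real"
  assumes u: "norm u = 1" and d: "CARD('n) \<ge> 2"
    and q: "continuous_on {-1..1} q"
    and coef: "\<And>j. (SI v. q (u \<bullet> v) * zpoly CARD('n) j (u \<bullet> v)) = c j * zpoly CARD('n) j 1"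
    and P: "integrable \<omega> P" "integrable \<omega> (\<lambda>v. P v * P v)"
  shows "summable (\<lambda>j. \<bar>c j * (SI v. zpoly CARD('n) j (u \<bullet> v) * P v)\<bar>)"
    and "(\<lambda>j. c j * (SI v. zpoly CARD('n) j (u \<bullet> v) * P v)) sums
      (SI v. q (u \<bullet> v) * P v)"
proof -
  let ?d = "CARD('n)"
  let ?q = "\<lambda>v. q (u \<bullet> v)" and ?e = "\<lambda>j v. zpoly ?d j (u \<bullet> v)"
  have cont: "continuous_on (sphere 0 1) (\<lambda>v. p (u \<bullet> v))" if "continuous_on {-1..1} p" for p :: "real \<Rightarrow> real"
    using sphere_inner_bound[OF u] by (intro continuous_on_compose2[OF that] continuous_intros) auto
  have cq: "continuous_on (sphere 0 1) ?q" and ce: "continuous_on (sphere 0 1) (?e j)" for j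
    using cont[OF q] cont[OF continuous_zpoly] by auto
  have int: "integrable \<omega> (\<lambda>v. f v * g v)"
    if fg: "f \<in> {?q, P} \<union> range ?e" "g \<in> {?q, P} \<union> range ?e" for f g
  proof -
    have f: "f = P \<or> continuous_on (sphere 0 1) f" and g: "g = P \<or> continuous_on (sphere 0 1) g"
      using fg cq ce by auto
    consider "f = P" "g = P" | "f = P" "continuous_on (sphere 0 1) g" | "g = P" "continuous_on (sphere 0 1) f"
      | "continuous_on (sphere 0 1) f" "continuous_on (sphere 0 1) g" using f g by blast
    then show ?thesis
    proof cases
      case 2
      then show ?thesis using integrable_sphere_cont_mult[OF 2(2) P(1)] by (simp add: mult.commute)
    next
      case 3
      then show ?thesis using integrable_sphere_cont_mult[OF 3(2) P(1)] by simp
    next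
      case 4
      then show ?thesis by (intro integrable_sphere_continuous continuous_on_mult)
    qed (use P in simp)
  qed
  have dens: "\<exists>n a. (SI v. (?q v - (\<Sum>j<n. a j * ?e j v))\<^sup>2) < \<epsilon>" if \<epsilon>: "\<epsilon> > 0" for \<epsilon>
  proof -
    define W where "W = measure (\<omega> :: (real^'n) measure) (sphere 0 1)"
    have W: "W \<ge> 0" by (simp add: W_def)
    \<comment> \<open>The bound by 1 allows the squared error to be estimated by \<delta> instead of
      its square; the \<open>1\<close> in the denominator covers \<open>W = 0\<close>.\<close>
    define \<delta> where "\<delta> = min 1 (\<epsilon> / (W + 1))"
    have \<delta>: "\<delta> > 0" "\<delta> \<le> 1" "\<delta> * W < \<epsilon>"
    proof -
      show "\<delta> > 0" "\<delta> \<le> 1" using \<epsilon> W by (auto simp: \<delta>_def)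
      have "\<delta> * W \<le> \<epsilon> / (W + 1) * W" using W by (intro mult_right_mono) (auto simp: \<delta>_def)
      also have "\<dots> < \<epsilon>" using W \<epsilon> by (simp add: field_simps)
      finally show "\<delta> * W < \<epsilon>" .
    qed
    obtain g where g: "real_polynomial_function g" "\<And>t. t \<in> {-1..1} \<Longrightarrow> \<bar>q t - g t\<bar> < \<delta>"
      using Stone_Weierstrass_real_polynomial_function[OF compact_Icc q \<delta>(1)] by auto
    obtain b n where gb: "g = (\<lambda>x. \<Sum>i\<le>n. b i * x ^ i)"
      using real_polynomial_function_imp_sum[OF g(1)] by blast
    have "zspan ?d (Suc n) g"
      unfolding gb by (intro zspan_sum zspan_cmult zspan_mono[OF zspan_power]) auto
    then obtain a where a: "\<And>t. g t = (\<Sum>j<Suc n. a j * zpoly ?d j t)" unfolding zspan_def by blast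
    have "(SI v. (?q v - g (u \<bullet> v))\<^sup>2) \<le> (LINT v|(\<omega> :: (real^'n) measure). \<delta>)"
    proof (rule integral_mono)
      have "continuous_on {-1..1} (\<lambda>t. (q t - g t)\<^sup>2)" unfolding gb by (intro continuous_intros q)
      then show "integrable \<omega> (\<lambda>v. (?q v - g (u \<bullet> v))\<^sup>2)" by (rule integrable_sphere_inner[OF u])
      show "(?q v - g (u \<bullet> v))\<^sup>2 \<le> \<delta>" if "v \<in> space \<omega>" for v
      proof -
        have "\<bar>?q v - g (u \<bullet> v)\<bar> \<le> \<delta>" using g(2)[OF sphere_inner_bound[OF u that]] by simp
        then have "\<bar>?q v - g (u \<bullet> v)\<bar> * \<bar>?q v - g (u \<bullet> v)\<bar> \<le> \<delta> * 1" using \<delta> by (intro mult_mono) auto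
        then show ?thesis by (simp add: power2_eq_square)
      qed
    qed simp
    also have "\<dots> = \<delta> * W" by (simp add: W_def mult.commute)
    finally have "(SI v. (?q v - (\<Sum>j<Suc n. a j * ?e j v))\<^sup>2) < \<epsilon>"
      using \<delta>(3) unfolding a by simp
    then show ?thesis by blast
  qed
  show "summable (\<lambda>j. \<bar>c j * (SI v. ?e j v * P v)\<bar>)"
    by (rule orthogonal_expansion(1)[OF int zpoly_orthogonal[OF d u] coef dens])
  show "(\<lambda>j. c j * (SI v. ?e j v * P v)) sums (SI v. ?q v * P v)"
    by (rule orthogonal_expansion(2)[OF int zpoly_orthogonal[OF d u] coef dens])
qed

text \<open>At 0 the function is dominated by \<open>2 * sqrt \<bar>t\<bar>\<close>: with
  \<open>s = sqrt \<bar>t\<bar>\<close> the logarithm is \<open>2 * ln s\<close>, and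
  \<open>- ln s \<le> 1 / s\<close>.\<close>

lemma continuous_on_times_ln_abs: "continuous_on A (\<lambda>t::real. t * ln \<bar>t\<bar>)"
proof (rule continuous_at_imp_continuous_on, rule ballI)
  fix t :: real
  show "isCont (\<lambda>t. t * ln \<bar>t\<bar>) t"
  proof (cases "t = 0")
    case True
    have "(\<lambda>t::real. t * ln \<bar>t\<bar>) \<midarrow>0\<rightarrow> 0"
    proof (rule Lim_null_comparison)
      show "(\<lambda>t::real. 2 * sqrt \<bar>t\<bar>) \<midarrow>0\<rightarrow> 0"
      proof -
        have "(\<lambda>t::real. 2 * sqrt \<bar>t\<bar>) \<midarrow>0\<rightarrow> 2 * sqrt \<bar>0\<bar>" by (intro tendsto_intros)
        then show ?thesis by simp
      qed
      have "norm (t * ln \<bar>t\<bar>) \<le> 2 * sqrt \<bar>t\<bar>" if t: "t \<noteq> 0" "\<bar>t\<bar> < 1" for t :: real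
      proof -
        define s where "s = sqrt \<bar>t\<bar>"
        have s: "0 < s" "s < 1" "\<bar>t\<bar> = s * s" using t by (auto simp: s_def)
        have "- ln s \<le> 1 / s" using ln_le_minus_one[of "1 / s"] s by (simp add: ln_div)
        then have "s * s * (2 * - ln s) \<le> s * s * (2 * (1 / s))" using s by (intro mult_left_mono) auto
        also have "\<dots> = 2 * s" using s by simp
        finally have "s * s * (2 * - ln s) \<le> 2 * s" .
        moreover have "norm (t * ln \<bar>t\<bar>) = s * s * (2 * - ln s)"
        proof -
          have l: "ln (s * s) = 2 * ln s" "\<bar>2 * ln s\<bar> = 2 * - ln s" using s(1,2) by (simp_all add: ln_mult)
          show ?thesis unfolding real_norm_def abs_mult[of t] s(3) l ..
        qed
        ultimately show ?thesis unfolding s_def[symmetric] by (simp only:)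
      qed
      then show "\<forall>\<^sub>F t in at 0. norm (t * ln \<bar>t\<bar>) \<le> 2 * sqrt \<bar>t\<bar>"
        unfolding eventually_at by (intro exI[of _ 1]) auto
    qed
    then show ?thesis using True by (simp add: isCont_def)
  next
    case False
    then have "((\<lambda>t::real. t * ln \<bar>t\<bar>) \<longlongrightarrow> t * ln \<bar>t\<bar>) (at t)"
      by (intro tendsto_mult tendsto_ident_at tendsto_ln tendsto_rabs) simp
    then show ?thesis by (simp add: isCont_def)
  qed
qed

text \<open>For the wrong parity of \<open>j\<close> the integrand is odd and its coefficient is 0,
  whatever \<open>w j\<close> is; the vanishing terms are then dropped by reindexing.\<close>

lemma sphere_parity_expansion:
  fixes u :: "real^'n" and q :: "real \<Rightarrow> real" and P :: "real^'n \<Rightarrow> real"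
  assumes u: "norm u = 1" and d: "CARD('n) \<ge> 2"
    and q: "continuous_on {-1..1} q" and par: "\<And>t. q (- t) = (-1) ^ e * q t" and e: "e = 0 \<or> e = 1"
    and coef: "\<And>j. even (j + e) \<Longrightarrow>
      (SI v. q (u \<bullet> v) * zpoly CARD('n) j (u \<bullet> v)) = w j * zpoly CARD('n) j 1"
    and P: "integrable \<omega> P" "integrable \<omega> (\<lambda>v. P v * P v)"
  shows "summable (\<lambda>k. \<bar>w (2 * k + e) * (SI v. zpoly CARD('n) (2 * k + e) (u \<bullet> v) * P v)\<bar>)"
    and "(\<lambda>k. w (2 * k + e) * (SI v. zpoly CARD('n) (2 * k + e) (u \<bullet> v) * P v)) sums
      (SI v. q (u \<bullet> v) * P v)"
proof -
  let ?d = "CARD('n)" and ?p = "\<lambda>j. LINT v|\<omega>. zpoly CARD('n) j (u \<bullet> v) * P v"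
  define c where "c j = (if even (j + e) then w j else 0)" for j
  have cc: "(SI v. q (u \<bullet> v) * zpoly ?d j (u \<bullet> v)) = c j * zpoly ?d j 1" for j
  proof (cases "even (j + e)")
    case False
    have "(SI v. q (u \<bullet> v) * zpoly ?d j (u \<bullet> v)) = 0"
    proof (rule sphere_inner_odd[OF u, where q="\<lambda>t. q t * zpoly ?d j t"])
      show "continuous_on {-1..1} (\<lambda>t. q t * zpoly ?d j t)" by (intro continuous_on_mult q continuous_zpoly)
      have "q (- t) * zpoly ?d j (- t) = (-1) ^ (j + e) * (q t * zpoly ?d j t)" for t
        by (simp add: par zpoly_minus power_add)
      then show "q (- t) * zpoly ?d j (- t) = - (q t * zpoly ?d j t)" for t using False by simp
    qed
    then show ?thesis using False by (simp add: c_def)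
  qed (simp add: c_def coef)
  have sm: "strict_mono (\<lambda>k. 2 * k + e)" by (auto simp: strict_mono_def)
  have rg: "c j = 0" if "j \<notin> range (\<lambda>k. 2 * k + e)" for j
  proof (rule ccontr)
    assume "c j \<noteq> 0"
    then have "even (j + e)" by (auto simp: c_def split: if_splits)
    then have "\<exists>k. j = 2 * k + e" using e by (elim disjE) presburger+
    then show False using that by auto
  qed
  have c2: "c (2 * k + e) = w (2 * k + e)" for k by (simp add: c_def)
  have "summable (\<lambda>k. \<bar>c (2 * k + e) * ?p (2 * k + e)\<bar>)"
    using sphere_zonal_expansion(1)[OF u d q cc P] rg
    by (subst summable_mono_reindex[OF sm, where f="\<lambda>j. \<bar>c j * ?p j\<bar>"]) auto
  then show "summable (\<lambda>k. \<bar>w (2 * k + e) * ?p (2 * k + e)\<bar>)" by (simp only: c2)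
  have "(\<lambda>k. c (2 * k + e) * ?p (2 * k + e)) sums (SI v. q (u \<bullet> v) * P v)"
    using sphere_zonal_expansion(2)[OF u d q cc P] rg
    by (subst sums_mono_reindex[OF sm, where f="\<lambda>j. c j * ?p j"]) auto
  then show "(\<lambda>k. w (2 * k + e) * ?p (2 * k + e)) sums (SI v. q (u \<bullet> v) * P v)" by (simp only: c2)
qed

section \<open>Assembling the characteristic exponent\<close>

lemma sgn_powr_even: "even j \<Longrightarrow> sgn_powr j = sgn_powr 0" and sgn_powr_odd: "odd j \<Longrightarrow> sgn_powr j = sgn_powr 1"
  by (auto simp: sgn_powr_def fun_eq_iff)

theorem theorem3p1:
  fixes \<alpha> :: real and P :: "real^'n \<Rightarrow> real" and \<mu> :: "(real^'n) measure" and z :: "real^'n"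
  assumes d2: "CARD('n) \<ge> 2"
    and alpha: "0 < \<alpha>" "\<alpha> < 2"
    and P_meas: "P \<in> borel_measurable sphere_measure"
    and P_nonneg: "\<forall>v \<in> sphere 0 1. 0 \<le> P v"
    and P_L2: "integrable sphere_measure (\<lambda>v. (P v)\<^sup>2)"
    and lam_nonzero: "emeasure (density sphere_measure (\<lambda>v. ennreal (P v))) (sphere 0 1) \<noteq> 0"
    and mu_prob: "prob_space \<mu>" and mu_sets: "sets \<mu> = sets borel"
    and mu_char: "\<forall>\<xi>. integral\<^sup>L \<mu> (\<lambda>x. exp (\<i> * of_real (x \<bullet> \<xi>)))
                   = exp (- stable_exponent \<alpha> (density sphere_measure (\<lambda>v. ennreal (P v))) \<xi>)"
    and z: "z \<noteq> 0"
  shows "let d = CARD('n); u = sgn z;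
             Phi = stable_exponent \<alpha> (density sphere_measure (\<lambda>v. ennreal (P v))) z;
             Pj = (\<lambda>j. sph_proj j (\<lambda>v. complex_of_real (P v)) u) in
         (\<alpha> \<noteq> 1 \<longrightarrow>
            summable (\<lambda>k. norm (of_real (w_coef d (2*k) \<alpha>) * Pj (2*k))) \<and>
            summable (\<lambda>k. norm (of_real (w_coef d (2*k+1) \<alpha>) * Pj (2*k+1))) \<and>
            Phi = of_real (norm z powr \<alpha>) *
                  ((\<Sum>k. of_real (w_coef d (2*k) \<alpha>) * Pj (2*k))
                   - \<i> * of_real (tan (pi * \<alpha> / 2)) * (\<Sum>k. of_real (w_coef d (2*k+1) \<alpha>) * Pj (2*k+1)))) \<and>
         (\<alpha> = 1 \<longrightarrow>
            summable (\<lambda>k. norm (of_real (w_coef d (2*k) 1) * Pj (2*k))) \<and>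
            summable (\<lambda>k. norm (of_real (w_star d (2*k+1)) * Pj (2*k+1))) \<and>
            Phi = of_real (norm z) *
                  ((\<Sum>k. of_real (w_coef d (2*k) 1) * Pj (2*k))
                   + \<i> * of_real (2 / pi) * (\<Sum>k. of_real (w_star d (2*k+1)) * Pj (2*k+1)))
                  + \<i> * of_real (norm z * ln (norm z)
                      * (2 * pi powr (real d / 2 - 1) / Gamma (real d / 2 + 1))) * Pj 1)"
proof -
  let ?d = "CARD('n)" and ?\<Phi> = "stable_exponent \<alpha> (density \<omega> (\<lambda>v. ennreal (P v))) z"
  define u where "u = sgn z"
  have u: "norm u = 1" using z by (simp add: u_def norm_sgn)
  have zv: "z \<bullet> v = norm z * (u \<bullet> v)" for v
    using z by (simp add: u_def sgn_div_norm)
  have nz: "norm z > 0" using z by simp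
  have P2: "integrable \<omega> (\<lambda>v. P v * P v)" using P_L2 by (simp add: power2_eq_square)
  have P1: "integrable \<omega> P"
  proof (rule LINT_integrable_bound)
    show "integrable \<omega> (\<lambda>v. 1 + P v * P v)" using P2 by simp
    \<comment> \<open>On a finite measure space this makes a square integrable function
      integrable.\<close>
    have "\<bar>x\<bar> \<le> 1 + x * x" for x :: real
      using sum_squares_ge_zero[of "\<bar>x\<bar> - 1" 0] zero_le_square[of x] by (simp add: algebra_simps)
    then show "AE v in \<omega>. norm (P v) \<le> norm (1 + P v * P v)"
      by (intro AE_I2) (simp add: abs_of_nonneg)
  qed (rule P_meas)
  define p where "p j = (SI v. zpoly ?d j (u \<bullet> v) * P v)" for j
  have Pj: "sph_proj j (\<lambda>v. complex_of_real (P v)) (sgn z) = of_real (p j)" for j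
    unfolding p_def u_def[symmetric] by (rule sph_proj_real[OF d2 P1 u])
  have dens: "integral\<^sup>L (density \<omega> (\<lambda>v. ennreal (P v))) F = (SI v. P v *\<^sub>R F v)"
    if "F \<in> borel_measurable \<omega>" for F :: "real^'n \<Rightarrow> complex"
    using that P_meas P_nonneg by (intro integral_density) (auto intro!: AE_I2)
  have um [measurable]: "(\<lambda>v. u \<bullet> v) \<in> borel_measurable \<omega>" by (rule sphere_inner_measurable[OF u])
  have iq: "integrable \<omega> (\<lambda>v. q (u \<bullet> v) * P v)" if "continuous_on {-1..1} q" for q
  proof -
    have "continuous_on (sphere 0 1) (\<lambda>v. q (u \<bullet> v))"
      using sphere_inner_bound[OF u] by (intro continuous_on_compose2[OF that] continuous_intros) auto
    from integrable_sphere_cont_mult[OF this P1] show ?thesis .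
  qed
  have to_complex: "summable (\<lambda>k. norm (complex_of_real (w k) * of_real (s k)))" "(\<Sum>k. complex_of_real (w k) * of_real (s k)) = of_real I"
    if "summable (\<lambda>k. \<bar>w k * s k\<bar>)" "(\<lambda>k. w k * s k) sums I" for w s I
  proof -
    show "summable (\<lambda>k. norm (complex_of_real (w k) * of_real (s k)))"
      using that(1) by (simp add: norm_mult abs_mult)
    have "(\<lambda>k. complex_of_real (w k * s k)) sums of_real I" using that(2) by (rule sums_of_real)
    then show "(\<Sum>k. complex_of_real (w k) * of_real (s k)) = of_real I"
      using sums_unique[of "\<lambda>k. complex_of_real (w k * s k)"] by simp
  qed
  \<comment> \<open>Kept general in the exponent, since the even part has the same form for
    \<open>\<alpha> \<noteq> 1\<close> and \<open>\<alpha> = 1\<close>.\<close>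
  have even_c: "summable (\<lambda>k. norm (complex_of_real (w_coef ?d (2*k) \<alpha>) * of_real (p (2*k))))" (is ?thesis1)
    "(\<Sum>k. complex_of_real (w_coef ?d (2*k) \<alpha>) * of_real (p (2*k))) = of_real (SI v. sgn_powr 0 \<alpha> (u \<bullet> v) * P v)" (is ?thesis2)
    if \<alpha>: "\<alpha> > 0" for \<alpha>
  proof -
    have c: "(SI v. sgn_powr 0 \<alpha> (u \<bullet> v) * zpoly ?d j (u \<bullet> v)) = w_coef ?d j \<alpha> * zpoly ?d j 1" if "even (j + 0)" for j
    proof -
      have "sgn_powr j = sgn_powr 0" using that by (intro sgn_powr_even) simp
      then show ?thesis using funk_hecke_sgn_powr[OF u d2 \<alpha>, of j] by (simp only:)
    qed
    have par: "sgn_powr 0 \<alpha> (- t) = (-1) ^ 0 * sgn_powr 0 \<alpha> t" for t by (simp add: sgn_powr_def)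
    note * = to_complex[OF sphere_parity_expansion[where q="sgn_powr 0 \<alpha>" and w="\<lambda>j. w_coef ?d j \<alpha>" and e=0, OF u d2 continuous_sgn_powr[OF \<alpha>] par disjI1[OF refl] c P1 P2]]
    show ?thesis1 ?thesis2
      unfolding p_def using * unfolding add_0_right by blast+
  qed
  show ?thesis
    unfolding Let_def Pj
  proof (rule conjI; rule impI)
    assume ne: "\<alpha> \<noteq> 1"
    have c: "(SI v. sgn_powr 1 \<alpha> (u \<bullet> v) * zpoly ?d j (u \<bullet> v)) = w_coef ?d j \<alpha> * zpoly ?d j 1" if "even (j + 1)" for j
    proof -
      have "sgn_powr j = sgn_powr 1" using that by (intro sgn_powr_odd) simp
      then show ?thesis using funk_hecke_sgn_powr[OF u d2 alpha(1), of j] by (simp only:)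
    qed
    have par: "sgn_powr 1 \<alpha> (- t) = (-1) ^ 1 * sgn_powr 1 \<alpha> t" for t by (simp add: sgn_powr_def)
    have odd_c: "summable (\<lambda>k. norm (complex_of_real (w_coef ?d (2*k+1) \<alpha>) * of_real (p (2*k+1))))"
      "(\<Sum>k. complex_of_real (w_coef ?d (2*k+1) \<alpha>) * of_real (p (2*k+1))) = of_real (SI v. sgn_powr 1 \<alpha> (u \<bullet> v) * P v)"
      unfolding p_def using to_complex[OF sphere_parity_expansion[where q="sgn_powr 1 \<alpha>" and w="\<lambda>j. w_coef ?d j \<alpha>" and e=1,
          OF u d2 continuous_sgn_powr[OF alpha(1)] par disjI2[OF refl] c P1 P2]]
      by blast+
    let ?T = "tan (pi * \<alpha> / 2)"
    let ?q0 = "\<lambda>v. sgn_powr 0 \<alpha> (u \<bullet> v) * P v" and ?q1 = "\<lambda>v. sgn_powr 1 \<alpha> (u \<bullet> v) * P v"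
    have "?\<Phi> =
       (SI v. P v *\<^sub>R (of_real (\<bar>z \<bullet> v\<bar> powr \<alpha>) * (1 - \<i> * of_real (?T * sgn (z \<bullet> v)))))"
      unfolding stable_exponent_def using ne by (simp only: if_True not_False_eq_True) (intro dens, unfold zv, measurable)
    also have "\<dots> = (SI v. of_real (norm z powr \<alpha>) * complex_of_real (?q0 v) - (of_real (norm z powr \<alpha>) * (\<i> * of_real ?T)) * complex_of_real (?q1 v))"
    proof (intro LINT_cong refl)
      fix v
      have a: "\<bar>z \<bullet> v\<bar> powr \<alpha> = norm z powr \<alpha> * \<bar>u \<bullet> v\<bar> powr \<alpha>"
        unfolding zv abs_mult using nz by (simp add: powr_mult)
      have b: "sgn (z \<bullet> v) = sgn (u \<bullet> v)" unfolding zv sgn_mult using nz by simp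
      have q: "?q0 v = \<bar>u \<bullet> v\<bar> powr \<alpha> * P v" "?q1 v = (\<bar>u \<bullet> v\<bar> powr \<alpha> * sgn (u \<bullet> v)) * P v"
        by (simp_all add: sgn_powr_def)
      have "x *\<^sub>R (complex_of_real (n * a) * (1 - \<i> * of_real (T * s))) =
         of_real n * of_real (a * x) - (of_real n * (\<i> * of_real T)) * of_real ((a * s) * x)" for x n a T s :: real
        by (simp add: complex_eq_iff algebra_simps)
      then show "P v *\<^sub>R (of_real (\<bar>z \<bullet> v\<bar> powr \<alpha>) * (1 - \<i> * of_real (?T * sgn (z \<bullet> v)))) =
        of_real (norm z powr \<alpha>) * complex_of_real (?q0 v) - (of_real (norm z powr \<alpha>) * (\<i> * of_real ?T)) * complex_of_real (?q1 v)"
        unfolding a b q .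
    qed
    also have "\<dots> = of_real (norm z powr \<alpha>) * of_real (SI v. ?q0 v) - (of_real (norm z powr \<alpha>) * (\<i> * of_real ?T)) * of_real (SI v. ?q1 v)"
    proof -
      have i0: "integrable \<omega> (\<lambda>v. complex_of_real (?q0 v))" and i1: "integrable \<omega> (\<lambda>v. complex_of_real (?q1 v))"
        by (rule integrable_of_real[OF iq[OF continuous_sgn_powr[OF alpha(1)]]])+
      show ?thesis
        unfolding LINT_diff[OF integrable_mult_right[OF i0] integrable_mult_right[OF i1]]
          integral_mult_right_zero integral_complex_of_real ..
    qed
    finally show "summable (\<lambda>k. norm (complex_of_real (w_coef ?d (2*k) \<alpha>) * of_real (p (2*k)))) \<and>
        summable (\<lambda>k. norm (complex_of_real (w_coef ?d (2*k+1) \<alpha>) * of_real (p (2*k+1)))) \<and>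
        ?\<Phi> = of_real (norm z powr \<alpha>) * ((\<Sum>k. of_real (w_coef ?d (2*k) \<alpha>) * of_real (p (2*k)))
          - \<i> * of_real ?T * (\<Sum>k. of_real (w_coef ?d (2*k+1) \<alpha>) * of_real (p (2*k+1))))"
      using even_c(1)[OF alpha(1)] odd_c(1) unfolding even_c(2)[OF alpha(1)] odd_c(2)
      by (simp only: right_diff_distrib mult.assoc simp_thms)
  next
    assume a1: "\<alpha> = 1"
    have c: "(SI v. (u \<bullet> v * ln \<bar>u \<bullet> v\<bar>) * zpoly ?d j (u \<bullet> v)) = w_star ?d j * zpoly ?d j 1" if "even (j + 1)" for j
      using funk_hecke_log[OF u d2, of j] that by simp
    have par: "(- t) * ln \<bar>- t\<bar> = (-1) ^ 1 * (t * ln \<bar>t\<bar>)" for t :: real by simp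
    have odd_c: "summable (\<lambda>k. norm (complex_of_real (w_star ?d (2*k+1)) * of_real (p (2*k+1))))"
      "(\<Sum>k. complex_of_real (w_star ?d (2*k+1)) * of_real (p (2*k+1))) = of_real (SI v. (u \<bullet> v * ln \<bar>u \<bullet> v\<bar>) * P v)"
      unfolding p_def using to_complex[OF sphere_parity_expansion[where q="\<lambda>t. t * ln \<bar>t\<bar>" and w="w_star ?d" and e=1,
          OF u d2 continuous_on_times_ln_abs par disjI2[OF refl] c P1 P2]]
      by blast+
    let ?q0 = "\<lambda>v. sgn_powr 0 1 (u \<bullet> v) * P v" and ?q1 = "\<lambda>v. (u \<bullet> v * ln \<bar>u \<bullet> v\<bar>) * P v" and ?q2 = "\<lambda>v. (u \<bullet> v) * P v"
    have w1: "w_coef ?d 1 1 = pi powr (real ?d / 2) / Gamma (real ?d / 2 + 1)"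
    proof -
      have e: "(real 1 + 1 + real ?d) / 2 = real ?d / 2 + 1" "(1 - real 1) / 2 + 1 = (1::real)"
        "2 powr (1 - 1) = (1::real)" "Gamma (1 + 1) = (1::real)" "rGamma (1::real) = 1"
        using Gamma_fact[of 1, where 'a=real] by simp_all
      show ?thesis
        unfolding w_coef_def e rGamma_inverse_Gamma[of "real ?d / 2 + 1"]
        by (simp only: divide_inverse mult_1_right inverse_1)
    qed
    have w1pos: "w_coef ?d 1 1 > 0" using w_coef_diag_pos[of ?d 1] by simp
    \<comment> \<open>In degree 1 the kernel is linear, so the first moment of \<open>P\<close>
      along \<open>u\<close> is a multiple of the projection \<open>p 1\<close>.\<close>
    have "zpoly ?d 1 t = t / w_coef ?d 1 1" for t by (simp add: zpoly_def)
    then have "p 1 = (SI v. ?q2 v / w_coef ?d 1 1)" unfolding p_def by simp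
    also have "\<dots> = (SI v. ?q2 v) / w_coef ?d 1 1" by (rule integral_divide_zero)
    finally have q2: "(SI v. ?q2 v) = w_coef ?d 1 1 * p 1" using w1pos by simp
    have "?\<Phi> =
       (SI v. P v *\<^sub>R (of_real \<bar>z \<bullet> v\<bar> + \<i> * of_real (2 / pi * (z \<bullet> v) * ln \<bar>z \<bullet> v\<bar>)))"
      unfolding stable_exponent_def using a1 by (simp only: if_False simp_thms) (intro dens, unfold zv, measurable)
    also have "\<dots> = (SI v. (of_real (norm z) * complex_of_real (?q0 v) +
        (of_real (norm z) * (\<i> * of_real (2 / pi))) * complex_of_real (?q1 v)) +
        (\<i> * of_real (2 / pi * norm z * ln (norm z))) * complex_of_real (?q2 v))"
    proof (intro LINT_cong refl)
      fix v
      \<comment> \<open>Splitting the logarithm creates the extra term with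
        \<open>ln (norm z)\<close>, which is linear in \<open>u \<bullet> v\<close>. Where
        \<open>u \<bullet> v = 0\<close>, the outer factor makes both sides vanish.\<close>
      have "ln \<bar>z \<bullet> v\<bar> = ln (norm z) + ln \<bar>u \<bullet> v\<bar>" if "u \<bullet> v \<noteq> 0"
        unfolding zv abs_mult using nz that by (simp add: ln_mult)
      then have l: "(z \<bullet> v) * ln \<bar>z \<bullet> v\<bar> = norm z * (u \<bullet> v * ln \<bar>u \<bullet> v\<bar>) + norm z * ln (norm z) * (u \<bullet> v)"
        by (cases "u \<bullet> v = 0") (simp_all add: zv algebra_simps)
      have a: "\<bar>z \<bullet> v\<bar> = norm z * \<bar>u \<bullet> v\<bar>" unfolding zv abs_mult by simp
      have q: "?q0 v = \<bar>u \<bullet> v\<bar> * P v" by (simp add: sgn_powr_def)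
      have "x *\<^sub>R (complex_of_real (n * a) + \<i> * of_real (c * (n * b + n * m * t))) =
        (of_real n * of_real (a * x) + (of_real n * (\<i> * of_real c)) * of_real (b * x)) + (\<i> * of_real (c * n * m)) * of_real (t * x)"
        for x n a c b m t :: real
        by (simp add: complex_eq_iff algebra_simps)
      then show "P v *\<^sub>R (of_real \<bar>z \<bullet> v\<bar> + \<i> * of_real (2 / pi * (z \<bullet> v) * ln \<bar>z \<bullet> v\<bar>)) =
        (of_real (norm z) * complex_of_real (?q0 v) +
        (of_real (norm z) * (\<i> * of_real (2 / pi))) * complex_of_real (?q1 v)) +
        (\<i> * of_real (2 / pi * norm z * ln (norm z))) * complex_of_real (?q2 v)"
        unfolding mult.assoc[of "2 / pi" "z \<bullet> v"] l unfolding a q .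
    qed
    also have "\<dots> = (of_real (norm z) * of_real (SI v. ?q0 v) +
        (of_real (norm z) * (\<i> * of_real (2 / pi))) * of_real (SI v. ?q1 v)) +
        (\<i> * of_real (2 / pi * norm z * ln (norm z))) * of_real (SI v. ?q2 v)"
    proof -
      have i0: "integrable \<omega> (\<lambda>v. complex_of_real (?q0 v))"
        by (rule integrable_of_real[OF iq[OF continuous_sgn_powr[OF zero_less_one]]])
      have i1: "integrable \<omega> (\<lambda>v. complex_of_real (?q1 v))"
        by (rule integrable_of_real[OF iq[OF continuous_on_times_ln_abs]])
      have i2: "integrable \<omega> (\<lambda>v. complex_of_real (?q2 v))"
        by (rule integrable_of_real[OF iq[OF continuous_on_id]])
      show ?thesis
        unfolding LINT_add[OF LINT_integrable_add[OF
              integrable_mult_right[OF i0] integrable_mult_right[OF i1]] integrable_mult_right[OF i2]]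
          LINT_add[OF integrable_mult_right[OF i0] integrable_mult_right[OF i1]]
          integral_mult_right_zero integral_complex_of_real ..
    qed
    finally have S: "?\<Phi> =
        (of_real (norm z) * of_real (SI v. ?q0 v) +
        (of_real (norm z) * (\<i> * of_real (2 / pi))) * of_real (SI v. ?q1 v)) +
        (\<i> * of_real (2 / pi * norm z * ln (norm z))) * of_real (SI v. ?q2 v)" .
    \<comment> \<open>The constant of the logarithmic term is \<open>2 / pi\<close> times
      \<open>w_coef ?d 1 1\<close>.\<close>
    have "pi powr (real ?d / 2 - 1) = pi powr (real ?d / 2) / pi" by (simp add: powr_diff)
    then have r: "2 / pi * norm z * ln (norm z) * (w_coef ?d 1 1 * p 1) =
        norm z * ln (norm z) * (2 * pi powr (real ?d / 2 - 1) / Gamma (real ?d / 2 + 1)) * p 1"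
      unfolding w1 by simp
    have "(\<i> * of_real (2 / pi * norm z * ln (norm z))) * complex_of_real (w_coef ?d 1 1 * p 1) =
        \<i> * of_real (2 / pi * norm z * ln (norm z) * (w_coef ?d 1 1 * p 1))"
      by (simp only: of_real_mult mult.assoc)
    also have "\<dots> = \<i> * of_real (norm z * ln (norm z) * (2 * pi powr (real ?d / 2 - 1) / Gamma (real ?d / 2 + 1))) * of_real (p 1)"
      unfolding r by (simp only: of_real_mult mult.assoc)
    finally have r': "(\<i> * of_real (2 / pi * norm z * ln (norm z))) * complex_of_real (w_coef ?d 1 1 * p 1) =
        \<i> * of_real (norm z * ln (norm z) * (2 * pi powr (real ?d / 2 - 1) / Gamma (real ?d / 2 + 1))) * of_real (p 1)" .
    show "summable (\<lambda>k. norm (complex_of_real (w_coef ?d (2*k) 1) * of_real (p (2*k)))) \<and>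
        summable (\<lambda>k. norm (complex_of_real (w_star ?d (2*k+1)) * of_real (p (2*k+1)))) \<and>
        ?\<Phi> = of_real (norm z) * ((\<Sum>k. of_real (w_coef ?d (2*k) 1) * of_real (p (2*k)))
            + \<i> * of_real (2 / pi) * (\<Sum>k. of_real (w_star ?d (2*k+1)) * of_real (p (2*k+1))))
          + \<i> * of_real (norm z * ln (norm z)
            * (2 * pi powr (real ?d / 2 - 1) / Gamma (real ?d / 2 + 1))) * of_real (p 1)"
      using even_c(1)[OF zero_less_one] odd_c(1)
      unfolding S even_c(2)[OF zero_less_one] odd_c(2) q2 r' by (simp only: distrib_left mult.assoc simp_thms)
  qed
qed

end
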